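(* Let $r>6$ be an integer, let $M$ be a mesh of degree $r$, let $G_0 \subset M$ be a convex combinatorial disk, and let $G_{n+1} = T(G_n)$ for all $n\ge 0$. Let $v_0,e_0,f_0$ be the numbers of vertices, edges and interior faces of $G_0$, and for $n\ge1$ let $v_n,e_n,f_n$ be the numbers of vertices, edges and faces belonging to $G_n$ but not to $G_{n-1}$. Define $v_M = v_0 + \sum_{n=1}^{\infty} v_n$, $e_M = e_0 + \sum_{n=1}^{\infty} e_n$, $f_M = f_0 + \sum_{n=1}^{\infty} f_n$, where the infinite sums are Euler sums. Then these quantities do not depend on the choice of $G_0$; more precisely, $$v_M = \frac{-6}{r-6},\qquad e_M = \frac{-3r}{r-6},\qquad f_M = \frac{-2r}{r-6}.$$
   Context: All graphs are simple and undirected, considered with a fixed embedding in the plane. A mesh of degree $r$ is a connected infinite simple graph embedded in the Euclidean plane without edge crossings such that: every vertex has degree $r$; every face is a triangle, i.e. a region bounded by three distinct edges; and every bounded region of the plane contains only finitely many vertices and edges. For a simple cycle $C$ in $M$, the combinatorial disk with boundary $C$ is the subgraph $G$ of $M$ consisting of $C$ together with all vertices and edges of $M$ lying inside the region bounded by $C$. A combinatorial disk $G$ with boundary $C$ is convex if every vertex $w$ of $C$ satisfies $\deg_G(w) \leq 1 + \frac{r}{2}$. For a nonempty subgraph $G \subset M$, its expansion $T(G) = H$ is the subgraph of $M$ with vertex set $V_H = V_G \cup \{ w \in V_M \setminus V_G : w \text{ is adjacent in } M \text{ to some } u \in V_G\}$ and edge set consisting of all edges of $M$ with both endpoints in $V_H$.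 Euler sum: if $(x_n)_{n=1}^{\infty}$ satisfies $x_{n+2} = \gamma x_{n+1} - x_n$ for all $n\ge1$ with $\gamma\ne 2$, its Euler sum is $\sum_{n=1}^{\infty} x_n := \frac{(1-\gamma)x_1 + x_2}{2-\gamma}$ (the value at $t=1$ of the rational function equal to its generating function $\sum_{n\ge1}x_nt^n$). The sequences $(v_n)_{n\ge1},(e_n)_{n\ge1},(f_n)_{n\ge1}$ satisfy such a recurrence with $\gamma = r-4$, so their Euler sums are defined. *)

theory Defs
  imports "HOL-Analysis.Analysis"
begin

text \<open>The plane is modelled by the type complex. An embedded graph is given by a set V of
points (the vertices) and a set E of subsets of the plane (the edges); each edge is the image
of an arc joining two distinct vertices and meeting V only in its two endpoints.\<close>

definition is_edge :: "complex set \<Rightarrow> complex set \<Rightarrow> bool" where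
  "is_edge V e \<longleftrightarrow> (\<exists>g. arc g \<and> path_image g = e \<and>
      e \<inter> V = {pathstart g, pathfinish g})"

definition plane_graph :: "complex set \<Rightarrow> complex set set \<Rightarrow> bool" where
  "plane_graph V E \<longleftrightarrow> (\<forall>e\<in>E. is_edge V e) \<and>
     (\<forall>e1\<in>E. \<forall>e2\<in>E. e1 \<noteq> e2 \<longrightarrow> e1 \<inter> e2 \<subseteq> V \<and> e1 \<inter> V \<noteq> e2 \<inter> V)"

definition adj :: "complex set \<Rightarrow> complex set set \<Rightarrow> complex \<Rightarrow> complex \<Rightarrow> bool" where
  "adj V E u w \<longleftrightarrow> (\<exists>e\<in>E. e \<inter> V = {u, w})"

definition deg :: "complex set set \<Rightarrow> complex \<Rightarrow> nat" where
  "deg EG w = card {e\<in>EG. w \<in> e}"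

definition graph_connected :: "complex set \<Rightarrow> complex set set \<Rightarrow> bool" where
  "graph_connected V E \<longleftrightarrow> (\<forall>u\<in>V. \<forall>w\<in>V. (adj V E)\<^sup>*\<^sup>* u w)"

definition faces :: "complex set \<Rightarrow> complex set set \<Rightarrow> complex set set" where
  "faces V E = components (- (V \<union> \<Union>E))"

definition is_triangle_face :: "complex set set \<Rightarrow> complex set \<Rightarrow> bool" where
  "is_triangle_face E F \<longleftrightarrow> (\<exists>e1\<in>E. \<exists>e2\<in>E. \<exists>e3\<in>E.
      e1 \<noteq> e2 \<and> e1 \<noteq> e3 \<and> e2 \<noteq> e3 \<and> frontier F = e1 \<union> e2 \<union> e3)"

definition locally_finite :: "complex set \<Rightarrow> complex set set \<Rightarrow> bool" where
  "locally_finite V E \<longleftrightarrow> (\<forall>S. bounded S \<longrightarrow>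
      finite (V \<inter> S) \<and> finite {e\<in>E. e \<inter> S \<noteq> {}})"

definition mesh :: "nat \<Rightarrow> complex set \<Rightarrow> complex set set \<Rightarrow> bool" where
  "mesh r V E \<longleftrightarrow> plane_graph V E \<and> infinite V \<and> graph_connected V E \<and>
     (\<forall>w\<in>V. deg E w = r) \<and> (\<forall>F\<in>faces V E. is_triangle_face E F) \<and>
     locally_finite V E"

definition simple_cycle :: "complex set \<Rightarrow> complex set set \<Rightarrow> complex list \<Rightarrow> bool" where
  "simple_cycle V E cs \<longleftrightarrow> length cs \<ge> 3 \<and> distinct cs \<and> set cs \<subseteq> V \<and>
     (\<forall>i<length cs. adj V E (cs ! i) (cs ! ((i + 1) mod length cs)))"

definition cycle_edges :: "complex set \<Rightarrow> complex set set \<Rightarrow> complex list \<Rightarrow> complex set set" where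
  "cycle_edges V E cs = {e\<in>E. \<exists>i<length cs. e \<inter> V = {cs ! i, cs ! ((i + 1) mod length cs)}}"

definition cycle_image :: "complex set \<Rightarrow> complex set set \<Rightarrow> complex list \<Rightarrow> complex set" where
  "cycle_image V E cs = \<Union>(cycle_edges V E cs)"

definition comb_disk :: "complex set \<Rightarrow> complex set set \<Rightarrow> complex list \<Rightarrow> complex set \<times> complex set set" where
  "comb_disk V E cs =
     (let D = cycle_image V E cs \<union> inside (cycle_image V E cs)
      in (V \<inter> D, {e\<in>E. e \<subseteq> D}))"

definition convex_disk :: "nat \<Rightarrow> complex set \<Rightarrow> complex set set \<Rightarrow> complex list \<Rightarrow> bool" where
  "convex_disk r V E cs \<longleftrightarrow>
     (\<forall>w\<in>set cs. real (deg (snd (comb_disk V E cs)) w) \<le> 1 + real r / 2)"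

definition expansion :: "complex set \<Rightarrow> complex set set \<Rightarrow> complex set \<times> complex set set \<Rightarrow> complex set \<times> complex set set" where
  "expansion V E G =
     (let VH = fst G \<union> {w\<in>V. \<exists>u\<in>fst G. adj V E u w}
      in (VH, {e\<in>E. e \<inter> V \<subseteq> VH}))"

definition faces_of :: "complex set \<Rightarrow> complex set set \<Rightarrow> complex set \<times> complex set set \<Rightarrow> complex set set" where
  "faces_of V E G = {F\<in>faces V E. {e\<in>E. e \<subseteq> frontier F} \<subseteq> snd G}"

text \<open>Euler sum of a sequence (x_n)_{n>=1} satisfying x_{n+2} = g x_{n+1} - x_n.\<close>
definition lin_rec :: "real \<Rightarrow> (nat \<Rightarrow> real) \<Rightarrow> bool" where
  "lin_rec g x \<longleftrightarrow> (\<forall>n\<ge>1. x (n + 2) = g * x (n + 1) - x n)"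

definition euler_sum :: "real \<Rightarrow> (nat \<Rightarrow> real) \<Rightarrow> real" where
  "euler_sum g x = ((1 - g) * x 1 + x 2) / (2 - g)"

definition layer_count :: "('a \<Rightarrow> 'b set) \<Rightarrow> (nat \<Rightarrow> 'a) \<Rightarrow> nat \<Rightarrow> real" where
  "layer_count sel Gs n =
     (if n = 0 then real (card (sel (Gs 0))) else real (card (sel (Gs n) - sel (Gs (n - 1)))))"

end

theory Submission
  imports Defs
begin

text \<open>
  The vertices, edges and triangular faces of a mesh form a combinatorial surface in which every edge lies
  on two triangles and the link of every vertex is an \<open>r\<close>-cycle. By the Jordan curve theorem every simple
  cycle bounds a disk that can be cut along edges into smaller disks until only triangles remain. This yields
  Euler's formula for combinatorial disks, and it shows that closed walks lift to closed walks in every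
  combinatorial covering of the mesh, so that connected coverings are injective.

  Starting from the boundary walk of \<open>G\<^sub>0\<close>, attach abstractly one cyclic layer of triangles after the other,
  as if consecutive outer neighbours were all distinct. Convexity leaves every boundary vertex at least two
  outer neighbours, which is what makes the next layer well defined, and each new boundary vertex has
  one or two neighbours below it. The resulting complex covers the mesh, hence embeds into it, and so the
  layers really are the boundaries of the \<open>G\<^sub>n\<close>. If \<open>b n\<close> is the length of the \<open>n\<close>-th one, then the new
  vertices, edges and faces of \<open>G\<^sub>n\<close> number \<open>b n\<close>, \<open>2 b n + b (n - 1)\<close> and \<open>b n + b (n - 1)\<close>, while
  counting outgoing edges gives \<open>b (n + 1) = (r - 4) b n - b (n - 1)\<close>. Euler's formula for \<open>G\<^sub>0\<close> evaluates
  the sums.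
\<close>

section \<open>Arcs and theta curves\<close>

text \<open>Degree counts alone do not give the layer sizes: a priori the outer neighbours of
  distant boundary vertices could coincide, or a new vertex could have old neighbours that are not
  consecutive. Building the expected answer abstractly makes this global question local, because a
  covering is checked at one vertex at a time. Besides the Jordan curve theorem and the splitting of
  a disk by a crosscut, the topology rests on Janiszewski's theorem, which shows that a frontier
  made of three edges is a genuine triangle and that no edge lies on three of them. The bound
  \<open>deg \<le> 1 + r/2\<close> leaves a boundary vertex \<open>r - deg \<ge> r/2 - 1 > 2\<close>
  outer neighbours. Later layers sustain themselves: their vertices have \<open>r - 3\<close> or
  \<open>r - 4\<close> outer neighbours, again at least two. For the constants, note that
  \<open>2 - \<gamma> = 6 - r\<close> and that the numerator of the Euler sum for vertices collapses
  to \<open>b 1 - b 0\<close>. Euler's formula and the degree sum of \<open>G\<^sub>0\<close> give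
  \<open>(6 - r) v\<^sub>0 + b 1 - b 0 = 6\<close>, where nothing of \<open>G\<^sub>0\<close> is
  left.\<close>

definition arc_between :: "complex set \<Rightarrow> complex \<Rightarrow> complex \<Rightarrow> bool" where
  "arc_between S a b \<longleftrightarrow> (\<exists>g. arc g \<and> path_image g = S \<and> pathstart g = a \<and> pathfinish g = b)"

lemma arc_between_sym: "arc_between S a b \<Longrightarrow> arc_between S b a"
  unfolding arc_between_def
  by (metis arc_reversepath path_image_reversepath pathfinish_reversepath pathstart_reversepath)

lemma arc_betweenD:
  assumes "arc_between S a b"
  shows "a \<in> S" "b \<in> S" "a \<noteq> b" "compact S" "closed S" "bounded S" "connected S" "connected (- S)"
    "connected (S - {a, b})" "S - {a, b} \<noteq> {}" "S \<subseteq> closure (S - {a, b})"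
proof -
  obtain g where g: "arc g" "path_image g = S" "pathstart g = a" "pathfinish g = b"
    using assms arc_between_def by auto
  show "a \<in> S" "b \<in> S" using g by auto
  show "a \<noteq> b" using g arc_distinct_ends by metis
  show "compact S" using g compact_arc_image by blast
  then show "closed S" "bounded S" by (auto simp: compact_imp_closed compact_imp_bounded)
  show "connected S" using g connected_arc_image by blast
  show "connected (- S)" using g connected_arc_complement[of g] by simp
  have inj: "inj_on g {0..1}" and cont: "continuous_on {0..1} g"
    using g by (auto simp: arc_def path_def)
  have eq: "S - {a, b} = g ` {0<..<1}"
  proof -
    have "{0<..<1} = {0..1} - {0, 1::real}" by auto
    then have "g ` {0<..<1} = g ` {0..1} - g ` {0, 1}"
      using inj_on_image_set_diff[OF inj, of "{0..1}" "{0, 1}"] by auto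
    then show ?thesis using g by (simp add: path_image_def pathstart_def pathfinish_def)
  qed
  show "connected (S - {a, b})"
    unfolding eq by (intro connected_continuous_image continuous_on_subset[OF cont]) auto
  show "S - {a, b} \<noteq> {}" unfolding eq by auto
  have "g ` closure {0<..<1} \<subseteq> closure (g ` {0<..<1})"
    by (rule image_closure_subset) (use cont closure_subset[of "g ` {0<..<1}"] in auto)
  then show "S \<subseteq> closure (S - {a, b})"
    using g eq by (auto simp: path_image_def)
qed

text \<open>An arc is homeomorphic to an interval, and removing an inner point disconnects an
  interval, whereas a disk in the plane stays connected without one of its points.\<close>

lemma arc_between_interior_empty:
  assumes "arc_between S a b"
  shows "interior S = {}"
proof (rule ccontr)
  assume "interior S \<noteq> {}"
  then obtain q e where e: "e > 0" "ball q e \<subseteq> S"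
    by (metis equals0I mem_interior)
  obtain g where g: "arc g" "path_image g = S" using assms arc_between_def by auto
  obtain h where h: "homeomorphism {0..1} S g h" using homeomorphism_arc[OF g(1)] g(2) by metis
  define I where "I = h ` ball q e"
  have "x \<in> S \<Longrightarrow> g (h x) = x" for x using h by (simp add: homeomorphism_def)
  then have hinj: "inj_on h (ball q e)" using e(2) by (metis inj_on_def subsetD)
  have con: "connected (h ` X)" if "connected X" "X \<subseteq> ball q e" for X
    using that h e(2) by (intro connected_continuous_image) (auto simp: homeomorphism_def intro: continuous_on_subset)
  have "infinite (ball q e)" using e uncountable_ball countable_finite by blast
  then have "infinite I" unfolding I_def using hinj finite_image_iff by blast
  then have "\<not> I \<subseteq> {x}" for x using finite_subset by blast
  then obtain x' y' where "x' \<in> I" "y' \<in> I" "x' \<noteq> y'" by blast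
  then obtain x y where xy: "x \<in> I" "y \<in> I" "x < y" by (meson linorder_neqE_linordered_idom)
  then obtain t where t: "x < t" "t < y" using dense by blast
  have "connected I" unfolding I_def by (rule con) auto
  then have "t \<in> I" using xy t by (meson connected_contains_Icc atLeastAtMost_iff less_imp_le subsetD)
  then obtain z where z: "z \<in> ball q e" "h z = t" unfolding I_def by auto
  have "connected (h ` (ball q e - {z}))"
    by (rule con) (auto intro: connected_punctured_ball connected_open_delete)
  moreover have "h ` (ball q e - {z}) = I - {t}"
    unfolding I_def using z hinj by (auto simp: inj_on_def)
  ultimately have "connected (I - {t})" by simp
  then have "{x..y} \<subseteq> I - {t}" using xy t by (intro connected_contains_Icc) auto
  then have "t \<in> I - {t}" using t by (meson atLeastAtMost_iff less_imp_le subsetD)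
  then show False by simp
qed

lemma arc_between_join:
  assumes "arc_between S a b" "arc_between T b c" "S \<inter> T \<subseteq> {b}"
  shows "arc_between (S \<union> T) a c"
proof -
  obtain g where g: "arc g" "path_image g = S" "pathstart g = a" "pathfinish g = b"
    using assms arc_between_def by auto
  obtain h where h: "arc h" "path_image h = T" "pathstart h = b" "pathfinish h = c"
    using assms arc_between_def by auto
  show ?thesis
    unfolding arc_between_def
    by (rule exI[of _ "g +++ h"]) (use g h assms in \<open>simp add: arc_join path_image_join\<close>)
qed

lemma jordan_arcs:
  assumes S: "arc_between S a b" and T: "arc_between T a b" and ST: "S \<inter> T \<subseteq> {a, b}"
  shows "inside (S \<union> T) \<noteq> {}" "open (inside (S \<union> T))" "connected (inside (S \<union> T))"
    "outside (S \<union> T) \<noteq> {}" "open (outside (S \<union> T))" "connected (outside (S \<union> T))"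
    "bounded (inside (S \<union> T))" "\<not> bounded (outside (S \<union> T))"
    "frontier (inside (S \<union> T)) = S \<union> T" "frontier (outside (S \<union> T)) = S \<union> T" "compact (S \<union> T)"
proof -
  obtain g where g: "arc g" "path_image g = S" "pathstart g = a" "pathfinish g = b"
    using S arc_between_def by auto
  obtain h where h: "arc h" "path_image h = T" "pathstart h = b" "pathfinish h = a"
    using T arc_between_sym arc_between_def by meson
  have "simple_path (g +++ h)"
    using g h ST by (intro simple_path_join_loop) auto
  moreover have "path_image (g +++ h) = S \<union> T" "pathfinish (g +++ h) = pathstart (g +++ h)"
    using g h by (auto simp: path_image_join)
  ultimately show "inside (S \<union> T) \<noteq> {}" "open (inside (S \<union> T))" "connected (inside (S \<union> T))"
    "outside (S \<union> T) \<noteq> {}" "open (outside (S \<union> T))" "connected (outside (S \<union> T))"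
    "bounded (inside (S \<union> T))" "\<not> bounded (outside (S \<union> T))"
    "frontier (inside (S \<union> T)) = S \<union> T" "frontier (outside (S \<union> T)) = S \<union> T"
    using Jordan_inside_outside[of "g +++ h"] by auto
  show "compact (S \<union> T)" using arc_betweenD[OF S] arc_betweenD[OF T] by auto
qed

lemma theta_split:
  assumes "arc_between S1 a b" "arc_between S2 a b" "arc_between S a b"
    and "S1 \<inter> S2 \<subseteq> {a, b}" "S1 \<inter> S \<subseteq> {a, b}" "S2 \<inter> S \<subseteq> {a, b}"
    and ne: "S \<inter> inside (S1 \<union> S2) \<noteq> {}"
  shows "inside (S1 \<union> S) \<inter> inside (S2 \<union> S) = {}"
    "inside (S1 \<union> S) \<union> inside (S2 \<union> S) \<union> (S - {a, b}) = inside (S1 \<union> S2)"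
proof -
  have "\<exists>g. simple_path g \<and> path_image g = T \<and> pathstart g = a \<and> pathfinish g = b"
    if "arc_between T a b" for T
    using that arc_between_def arc_imp_simple_path by blast
  then obtain g1 g2 g where g: "simple_path g1" "path_image g1 = S1" "pathstart g1 = a" "pathfinish g1 = b"
    "simple_path g2" "path_image g2 = S2" "pathstart g2 = a" "pathfinish g2 = b"
    "simple_path g" "path_image g = S" "pathstart g = a" "pathfinish g = b"
    using assms(1-3) by metis
  have "a \<noteq> b" using assms(1) arc_betweenD by blast
  have eq: "S1 \<inter> S2 = {a, b}" "S1 \<inter> S = {a, b}" "S2 \<inter> S = {a, b}"
    using assms arc_betweenD[OF assms(1)] arc_betweenD[OF assms(2)] arc_betweenD[OF assms(3)] by auto
  note * = split_inside_simple_closed_curve[of g1 a b g2 g, unfolded g, OF g(1) refl refl g(5) refl refl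
      g(9) refl refl \<open>a \<noteq> b\<close> eq ne]
  show "inside (S1 \<union> S) \<inter> inside (S2 \<union> S) = {}" using * by blast
  show "inside (S1 \<union> S) \<union> inside (S2 \<union> S) \<union> (S - {a, b}) = inside (S1 \<union> S2)" using * by blast
qed

lemma connected_inside_or_outside:
  assumes "connected X" "X \<inter> C = {}" "open (inside C)" "open (outside C)"
  shows "X \<subseteq> inside C \<or> X \<subseteq> outside C"
proof -
  have "X \<subseteq> inside C \<union> outside C" using assms by auto
  then show ?thesis
    using connectedD[OF assms(1,3,4)] inside_Int_outside by blast
qed

text \<open>If the middle arc were outside, the two disks it borders would meet in an arc and, by Janiszewski's
  theorem, not separate the plane, although their union contains the Jordan curve of the other two arcs.\<close>
lemma theta_middle:
  assumes S1: "arc_between S1 a b" and S2: "arc_between S2 a b" and S: "arc_between S a b"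
    and i: "S1 \<inter> S2 \<subseteq> {a, b}" "S1 \<inter> S \<subseteq> {a, b}" "S2 \<inter> S \<subseteq> {a, b}"
    and d: "inside (S1 \<union> S) \<inter> S2 = {}" "inside (S2 \<union> S) \<inter> S1 = {}"
      "inside (S1 \<union> S) \<inter> inside (S2 \<union> S) = {}"
  shows "S - {a, b} \<subseteq> inside (S1 \<union> S2)"
proof (rule ccontr)
  assume neg: "\<not> ?thesis"
  define C where "C = S1 \<union> S2"
  note J = jordan_arcs[OF S1 S2 i(1), folded C_def]
  note J1 = jordan_arcs[OF S1 S i(2)]
  note J2 = jordan_arcs[OF S2 S i(3)]
  note A = arc_betweenD[OF S]
  have ab: "a \<in> S1" "b \<in> S1" "a \<in> S2" "b \<in> S2" using arc_betweenD[OF S1] arc_betweenD[OF S2] by auto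
  have "S - {a, b} \<subseteq> inside C \<or> S - {a, b} \<subseteq> outside C"
    by (rule connected_inside_or_outside) (use A J i in \<open>auto simp: C_def\<close>)
  with neg have Sout: "S - {a, b} \<subseteq> outside C" by (auto simp: C_def)
  \<comment> \<open>The set accumulates at a point of \<open>S\<close> that lies outside
    \<open>C\<close>; being connected and disjoint from \<open>C\<close>, it is then outside
    \<open>C\<close> altogether.\<close>
  have side: "inside X \<subseteq> outside C"
    if "connected (inside X)" "inside X \<inter> C = {}" "S \<subseteq> closure (inside X)" for X
  proof -
    obtain q where "q \<in> S - {a, b}" using A by auto
    then have "q \<in> outside C" "q \<in> closure (inside X)" using Sout that by auto
    then have "outside C \<inter> inside X \<noteq> {}"
      using J(5) open_Int_closure_eq_empty by blast
    moreover have "inside X \<subseteq> inside C \<or> inside X \<subseteq> outside C"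
      by (rule connected_inside_or_outside) (use that J in auto)
    ultimately show ?thesis using inside_Int_outside[of C] by blast
  qed
  have F1: "inside (S1 \<union> S) \<subseteq> outside C"
  proof (rule side)
    show "S \<subseteq> closure (inside (S1 \<union> S))" using J1(9) closure_Un_frontier by fastforce
    show "inside (S1 \<union> S) \<inter> C = {}"
      using d(1) inside_no_overlap[of "S1 \<union> S"] by (simp add: C_def Int_Un_distrib)
  qed (rule J1)
  have F2: "inside (S2 \<union> S) \<subseteq> outside C"
  proof (rule side)
    show "S \<subseteq> closure (inside (S2 \<union> S))" using J2(9) closure_Un_frontier by fastforce
    show "inside (S2 \<union> S) \<inter> C = {}"
      using d(2) inside_no_overlap[of "S2 \<union> S"] by (simp add: C_def Int_Un_distrib)
  qed (rule J2)
  define K1 where "K1 = (S1 \<union> S) \<union> inside (S1 \<union> S)"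
  define K2 where "K2 = (S2 \<union> S) \<union> inside (S2 \<union> S)"
  have K: "- K1 = outside (S1 \<union> S)" "- K2 = outside (S2 \<union> S)"
    unfolding K1_def K2_def by (simp_all add: outside_inside)
  have bK: "bounded K1" "bounded K2"
    unfolding K1_def K2_def
    using J1(7) J2(7) arc_betweenD(6)[OF S1] arc_betweenD(6)[OF S2] A(6) by simp_all
  have cK: "closed K1" "closed K2" unfolding closed_def K using J1(5) J2(5) by simp_all
  have "K1 \<inter> K2 = S"
  proof
    show "K1 \<inter> K2 \<subseteq> S"
    proof
      fix x assume x: "x \<in> K1 \<inter> K2"
      have "x \<notin> inside (S1 \<union> S)"
        using x d(1,3) inside_no_overlap[of "S1 \<union> S"] unfolding K2_def by blast
      moreover have "x \<notin> inside (S2 \<union> S)"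
        using x d(2,3) inside_no_overlap[of "S2 \<union> S"] unfolding K1_def by blast
      ultimately show "x \<in> S" using x i A(1,2) unfolding K1_def K2_def by blast
    qed
  qed (auto simp: K1_def K2_def)
  then have con: "connected (- (K1 \<union> K2))"
    using J1(6) J2(6) A(7) bK cK
    by (intro Janiszewski_connected) (simp_all add: compact_eq_bounded_closed K)
  have sub: "inside C \<subseteq> - (K1 \<union> K2)"
  proof
    fix x assume x: "x \<in> inside C"
    then have 1: "x \<notin> S1" "x \<notin> S2" using inside_no_overlap[of C] unfolding C_def by blast+
    have 2: "x \<notin> outside C" using x inside_Int_outside[of C] by blast
    have "x \<notin> S" using 1 2 Sout ab by blast
    moreover have "x \<notin> inside (S1 \<union> S)" "x \<notin> inside (S2 \<union> S)" using F1 F2 2 by blast+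
    ultimately show "x \<in> - (K1 \<union> K2)" using 1 by (simp add: K1_def K2_def)
  qed
  have "- (K1 \<union> K2) \<subseteq> inside C \<or> - (K1 \<union> K2) \<subseteq> outside C"
  proof (rule connected_inside_or_outside[OF con])
    show "- (K1 \<union> K2) \<inter> C = {}" by (auto simp: C_def K1_def K2_def)
  qed (rule J)+
  then have "- (K1 \<union> K2) \<subseteq> inside C"
    using sub J(1) inside_Int_outside[of C] by blast
  then have "bounded (- (K1 \<union> K2))" using J(7) bounded_subset by blast
  moreover have "bounded (K1 \<union> K2)" using bK by simp
  ultimately show False using cobounded_imp_unbounded by blast
qed

section \<open>Faces and links of a mesh\<close>

locale triangulated_mesh =
  fixes r :: nat and V :: "complex set" and E :: "complex set set"
  assumes mesh: "mesh r V E" and r_pos: "r > 0"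
begin

abbreviation nb :: "complex \<Rightarrow> complex \<Rightarrow> bool" where "nb \<equiv> adj V E"

text \<open>Since \<open>plane_graph\<close> forbids two edges with the same trace on
  \<open>V\<close>, the description has exactly one solution for adjacent \<open>u\<close> and
  \<open>w\<close>. For other pairs the value is arbitrary.\<close>

definition ed :: "complex \<Rightarrow> complex \<Rightarrow> complex set" where
  "ed u w = (THE e. e \<in> E \<and> e \<inter> V = {u, w})"

lemma edge_arc: "e \<in> E \<Longrightarrow> \<exists>u w. arc_between e u w \<and> e \<inter> V = {u, w}"
  using mesh unfolding mesh_def plane_graph_def is_edge_def arc_between_def by metis

lemma edge_eqI: "e \<in> E \<Longrightarrow> e' \<in> E \<Longrightarrow> e \<inter> V = e' \<inter> V \<Longrightarrow> e = e'"
  using mesh unfolding mesh_def plane_graph_def by metis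

lemma edge_Int: "e \<in> E \<Longrightarrow> e' \<in> E \<Longrightarrow> e \<noteq> e' \<Longrightarrow> e \<inter> e' \<subseteq> V"
  using mesh unfolding mesh_def plane_graph_def by metis

lemma edge_eqI2: "e \<in> E \<Longrightarrow> e' \<in> E \<Longrightarrow> p \<in> e \<Longrightarrow> p \<in> e' \<Longrightarrow> p \<notin> V \<Longrightarrow> e = e'"
  using edge_Int by blast

lemma edE:
  assumes "e \<in> E" "e \<inter> V = {u, w}"
  shows "nb u w" "ed u w = e"
proof -
  show "nb u w" using assms adj_def by blast
  show "ed u w = e" unfolding ed_def using assms edge_eqI by (intro the_equality) metis+
qed

lemma nb_sym: "nb u w \<Longrightarrow> nb w u"
  unfolding adj_def by (metis insert_commute)

lemma ed_commute: "ed u w = ed w u"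
  unfolding ed_def by (metis insert_commute)

lemma ed:
  assumes "nb u w"
  shows "ed u w \<in> E" "ed u w \<inter> V = {u, w}" "arc_between (ed u w) u w" "u \<noteq> w" "u \<in> V" "w \<in> V"
proof -
  obtain e where e: "e \<in> E" "e \<inter> V = {u, w}" using assms adj_def by blast
  then have eq: "ed u w = e" by (rule edE)
  then show "ed u w \<in> E" "ed u w \<inter> V = {u, w}" using e by auto
  then show *: "arc_between (ed u w) u w"
    using edge_arc[of "ed u w"] arc_between_sym by (metis doubleton_eq_iff)
  show "u \<noteq> w" using * arc_betweenD by blast
  show "u \<in> V" "w \<in> V" using e by auto
qed

lemma ed_eq_iff: "nb u w \<Longrightarrow> nb u' w' \<Longrightarrow> ed u w = ed u' w' \<longleftrightarrow> {u, w} = {u', w'}"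
  by (metis ed(1,2) edge_eqI)

lemma ed_Int:
  assumes "nb u w" "nb u' w'" "{u, w} \<noteq> {u', w'}"
  shows "ed u w \<inter> ed u' w' \<subseteq> {u, w} \<inter> {u', w'}"
  using edge_Int[of "ed u w" "ed u' w'"] ed[OF assms(1)] ed[OF assms(2)] assms ed_eq_iff by blast

lemma edge_cases: "e \<in> E \<Longrightarrow> \<exists>u w. nb u w \<and> e = ed u w"
  using edge_arc edE by metis

lemma card_nb: "w \<in> V \<Longrightarrow> card {u. nb w u} = r"
proof -
  assume w: "w \<in> V"
  have "bij_betw (ed w) {u. nb w u} {e\<in>E. w \<in> e}"
    unfolding bij_betw_def
  proof
    show "inj_on (ed w) {u. nb w u}"
      by (auto simp: inj_on_def ed_eq_iff doubleton_eq_iff)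
    show "ed w ` {u. nb w u} = {e\<in>E. w \<in> e}"
    proof
      show "ed w ` {u. nb w u} \<subseteq> {e\<in>E. w \<in> e}"
        using ed(1,2) by blast
      show "{e\<in>E. w \<in> e} \<subseteq> ed w ` {u. nb w u}"
      proof
        fix e assume e: "e \<in> {e\<in>E. w \<in> e}"
        then obtain u v where uv: "nb u v" "e = ed u v" using edge_cases by blast
        then have "w = u \<or> w = v" using ed(2)[OF uv(1)] e w by blast
        then show "e \<in> ed w ` {u. nb w u}" using uv nb_sym ed_commute by blast
      qed
    qed
  qed
  then have "card {u. nb w u} = deg E w" by (simp add: deg_def bij_betw_same_card)
  then show ?thesis using mesh w by (simp add: mesh_def)
qed

lemma V_subset_edges: "V \<subseteq> \<Union>E"
proof
  fix w assume "w \<in> V"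
  then obtain u where "nb w u" using card_nb r_pos by (metis card.empty empty_Collect_eq less_not_refl)
  then show "w \<in> \<Union>E" using ed(1,2) by blast
qed

text \<open>Local finiteness leaves finitely many edges and vertices near \<open>p\<close>. Those
  that miss \<open>p\<close> form a closed set, which has positive distance from
  \<open>p\<close>.\<close>

lemma small_ball:
  "\<exists>\<epsilon>>0. (\<forall>e\<in>E. e \<inter> ball p \<epsilon> \<noteq> {} \<longrightarrow> p \<in> e) \<and> V \<inter> ball p \<epsilon> \<subseteq> {p}"
proof -
  have "bounded (ball p 1)" by simp
  then have fin: "finite (V \<inter> ball p 1)" "finite {e\<in>E. e \<inter> ball p 1 \<noteq> {}}"
    using mesh unfolding mesh_def locally_finite_def by blast+
  define K where "K = \<Union>{e\<in>E. e \<inter> ball p 1 \<noteq> {} \<and> p \<notin> e} \<union> (V \<inter> ball p 1 - {p})"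
  have "finite {e\<in>E. e \<inter> ball p 1 \<noteq> {} \<and> p \<notin> e}" by (rule finite_subset[OF _ fin(2)]) auto
  moreover have "closed e" if "e \<in> E" for e using that edge_arc arc_betweenD(5) by blast
  ultimately have "closed K"
    unfolding K_def using fin(1) by (intro closed_Un closed_Union finite_imp_closed) auto
  moreover have "p \<notin> K" by (auto simp: K_def)
  ultimately obtain d where d: "d > 0" "ball p d \<subseteq> - K"
    using open_contains_ball[of "- K"] by (auto simp: open_Compl)
  have sub: "ball p (min d 1) \<subseteq> ball p 1" "ball p (min d 1) \<subseteq> ball p d" by auto
  show ?thesis
  proof (intro exI[of _ "min d 1"] conjI ballI impI)
    fix e assume "e \<in> E" "e \<inter> ball p (min d 1) \<noteq> {}"
    then show "p \<in> e" using d(2) sub unfolding K_def by blast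
  qed (use d sub in \<open>auto simp: K_def\<close>)
qed

lemma closed_graph: "closed (V \<union> \<Union>E)"
proof -
  have "open (- \<Union>E)"
    unfolding open_contains_ball
  proof
    fix p assume "p \<in> - \<Union>E"
    then have "p \<notin> e" if "e \<in> E" for e using that by blast
    moreover obtain \<epsilon> where "\<epsilon> > 0" "\<And>e. e \<in> E \<Longrightarrow> e \<inter> ball p \<epsilon> \<noteq> {} \<Longrightarrow> p \<in> e"
      using small_ball[of p] by metis
    ultimately have "\<epsilon> > 0" "e \<inter> ball p \<epsilon> = {}" if "e \<in> E" for e using that by blast+
    then show "\<exists>\<epsilon>>0. ball p \<epsilon> \<subseteq> - \<Union>E"
      using \<open>\<epsilon> > 0\<close> by (intro exI[of _ \<epsilon>]) blast
  qed
  moreover have "V \<union> \<Union>E = \<Union>E" using V_subset_edges by blast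
  ultimately show ?thesis by (simp add: closed_def)
qed

lemma face:
  assumes "F \<in> faces V E"
  shows "open F" "connected F" "F \<noteq> {}" "F \<inter> V = {}" "e \<in> E \<Longrightarrow> F \<inter> e = {}"
proof -
  have F: "F \<in> components (- (V \<union> \<Union>E))" using assms by (simp add: faces_def)
  show "open F" using F closed_graph open_components by blast
  show "connected F" using F in_components_connected by blast
  show "F \<noteq> {}" using F in_components_nonempty by blast
  show "F \<inter> V = {}" "e \<in> E \<Longrightarrow> F \<inter> e = {}" using in_components_subset[OF F] by blast+
qed

lemma faces_disjoint: "F \<in> faces V E \<Longrightarrow> F' \<in> faces V E \<Longrightarrow> F \<inter> F' \<noteq> {} \<Longrightarrow> F = F'"
  unfolding faces_def using components_eq by blast

lemma in_face: "p \<notin> \<Union>E \<Longrightarrow> \<exists>F\<in>faces V E. p \<in> F"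
proof -
  assume "p \<notin> \<Union>E"
  then have "p \<in> - (V \<union> \<Union>E)" using V_subset_edges by blast
  then have "p \<in> \<Union>(faces V E)" unfolding faces_def by (metis Union_components)
  then show ?thesis by blast
qed

definition tri :: "complex \<Rightarrow> complex \<Rightarrow> complex \<Rightarrow> complex set" where
  "tri a b c = ed a b \<union> ed b c \<union> ed a c"

text \<open>Three mutually adjacent vertices are not known to bound a face, so the last conjunct
  separates facial triangles from other 3-cycles.\<close>

definition T :: "complex \<Rightarrow> complex \<Rightarrow> complex \<Rightarrow> bool" where
  "T a b c \<longleftrightarrow> nb a b \<and> nb b c \<and> nb a c \<and> inside (tri a b c) \<in> faces V E"

lemma tri_sym: "tri a b c = tri b a c" "tri a b c = tri a c b"
  unfolding tri_def using ed_commute by blast+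

lemma T_sym: "T a b c \<Longrightarrow> T b a c" "T a b c \<Longrightarrow> T a c b"
  unfolding T_def using tri_sym nb_sym by metis+

lemma T_D: "T a b c \<Longrightarrow> nb a b" "T a b c \<Longrightarrow> nb b c" "T a b c \<Longrightarrow> nb a c"
  "T a b c \<Longrightarrow> inside (tri a b c) \<in> faces V E" "T a b c \<Longrightarrow> a \<noteq> b" "T a b c \<Longrightarrow> b \<noteq> c"
  "T a b c \<Longrightarrow> a \<noteq> c"
  unfolding T_def using ed(4) by blast+

lemma path2_arc:
  assumes "nb a b" "nb b c" "a \<noteq> c"
  shows "arc_between (ed a b \<union> ed b c) a c"
  by (rule arc_between_join[OF ed(3)[OF assms(1)] ed(3)[OF assms(2)]])
    (use ed_Int[OF assms(1,2)] assms(3) in \<open>auto simp: doubleton_eq_iff\<close>)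

lemma tri_arcs:
  assumes "nb a b" "nb b c" "nb a c"
  shows "arc_between (ed a b \<union> ed b c) a c" "arc_between (ed a c) a c"
    "(ed a b \<union> ed b c) \<inter> ed a c \<subseteq> {a, c}"
proof -
  have ne: "a \<noteq> b" "b \<noteq> c" "a \<noteq> c" using assms ed(4) by auto
  show "arc_between (ed a b \<union> ed b c) a c" using path2_arc assms ne by blast
  show "arc_between (ed a c) a c" using assms ed(3) by blast
  have "ed a b \<inter> ed a c \<subseteq> {a}" "ed b c \<inter> ed a c \<subseteq> {c}"
    using ed_Int[OF assms(1,3)] ed_Int[OF assms(2,3)] ne by (auto simp: doubleton_eq_iff)
  then show "(ed a b \<union> ed b c) \<inter> ed a c \<subseteq> {a, c}" by blast
qed

lemma tri_V: "nb a b \<Longrightarrow> nb b c \<Longrightarrow> nb a c \<Longrightarrow> tri a b c \<inter> V = {a, b, c}"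
  unfolding tri_def using ed(2) by blast

lemma tri_jordan:
  assumes "nb a b" "nb b c" "nb a c"
  shows "inside (tri a b c) \<noteq> {}" "open (inside (tri a b c))" "connected (inside (tri a b c))"
    "outside (tri a b c) \<noteq> {}" "open (outside (tri a b c))" "connected (outside (tri a b c))"
    "bounded (inside (tri a b c))" "\<not> bounded (outside (tri a b c))"
    "frontier (inside (tri a b c)) = tri a b c" "frontier (outside (tri a b c)) = tri a b c"
  using jordan_arcs[OF tri_arcs(1)[OF assms] tri_arcs(2,3)[OF assms]] unfolding tri_def by auto

lemma T_frontier: "T a b c \<Longrightarrow> frontier (inside (tri a b c)) = tri a b c"
  using tri_jordan(9) T_D by blast

text \<open>An unbounded face with bounded frontier contains everything outside some ball. All
  vertices would then lie in that ball, against local finiteness and the infinity of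
  \<open>V\<close>.\<close>

lemma face_bounded:
  assumes "F \<in> faces V E"
  shows "bounded F" "bounded (frontier F)"
proof -
  obtain e1 e2 e3 where e: "e1 \<in> E" "e2 \<in> E" "e3 \<in> E" "frontier F = e1 \<union> e2 \<union> e3"
    using assms mesh unfolding mesh_def is_triangle_face_def by metis
  have "bounded e" if "e \<in> E" for e using that edge_arc arc_betweenD(6) by blast
  then show b: "bounded (frontier F)" using e by simp
  show "bounded F"
  proof (rule ccontr)
    assume "\<not> bounded F"
    obtain R where R: "R > 0" "frontier F \<subseteq> ball 0 R" using b bounded_subset_ballD by blast
    have con: "connected (- ball (0::complex) R)"
      by (rule connected_complement_bounded_convex) auto
    have "\<not> F \<subseteq> ball 0 R" using \<open>\<not> bounded F\<close> bounded_ball bounded_subset by blast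
    then have "- ball 0 R \<inter> F \<noteq> {}" by blast
    then have sub: "- ball 0 R \<subseteq> F" using connected_Int_frontier[OF con, of F] R(2) by blast
    have "V \<inter> F = {}" using face[OF assms] by blast
    then have "V = V \<inter> ball 0 R" using sub by blast
    moreover have "finite (V \<inter> ball 0 R)" using mesh unfolding mesh_def locally_finite_def by auto
    ultimately show False using mesh unfolding mesh_def by simp
  qed
qed

lemma connected_sub_singleton: "X \<subseteq> {x} \<Longrightarrow> connected X"
  by (metis connected_empty connected_sing subset_singletonD)

text \<open>The definition of a mesh only says that the frontier is a union of three distinct edges.
  That these close up to a 3-cycle with the face as its inside follows because the frontier
  separates the plane.\<close>

lemma face_triangle:
  assumes F: "F \<in> faces V E"
  shows "\<exists>a b c. T a b c \<and> F = inside (tri a b c)"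
proof -
  obtain e1 e2 e3 where e: "e1 \<in> E" "e2 \<in> E" "e3 \<in> E" "frontier F = e1 \<union> e2 \<union> e3"
    and ne: "e1 \<noteq> e2" "e1 \<noteq> e3" "e2 \<noteq> e3"
    using assms mesh unfolding mesh_def is_triangle_face_def by metis
  note fF = face[OF F]
  \<comment> \<open>With a connected complement of the frontier, the face would be this whole
    complement; but a bounded set in the plane has an unbounded complement.\<close>
  have sep: "\<not> connected (- frontier F)"
  proof
    assume con: "connected (- frontier F)"
    have "F \<subseteq> - frontier F" using fF(1) frontier_disjoint_eq by blast
    then have "- frontier F \<subseteq> F" using connected_Int_frontier[OF con, of F] fF(3) by blast
    then have "bounded (- frontier F)" using face_bounded[OF F] bounded_subset by blast
    then show False using face_bounded(2)[OF F] cobounded_imp_unbounded by blast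
  qed
  obtain a1 b1 where 1: "nb a1 b1" "e1 = ed a1 b1" using e edge_cases by metis
  obtain a2 b2 where 2: "nb a2 b2" "e2 = ed a2 b2" using e edge_cases by metis
  obtain a3 b3 where 3: "nb a3 b3" "e3 = ed a3 b3" using e edge_cases by metis
  \<comment> \<open>If an endpoint of one edge were on neither of the others, adding the edges one
    by one would only produce intersections with at most one point, and by Janiszewski's theorem the
    complement would stay connected.\<close>
  have key: "e3' \<inter> V \<subseteq> e1' \<union> e2'"
    if E': "e1' \<in> E" "e2' \<in> E" "e3' \<in> E" "frontier F = e1' \<union> e2' \<union> e3'"
      "e1' \<noteq> e2'" "e1' \<noteq> e3'" "e2' \<noteq> e3'" for e1' e2' e3'
  proof (rule ccontr)
    assume "\<not> ?thesis"
    then obtain x where x: "x \<in> e3'" "x \<in> V" "x \<notin> e1' \<union> e2'" by blast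
    have arc: "compact e'" "connected (- e')" if "e' \<in> E" for e'
      using edge_arc[OF that] arc_betweenD(4,8) by metis+
    obtain u w where uw: "nb u w" "e3' = ed u w" using edge_cases E' by metis
    then have "(e1' \<union> e2') \<inter> e3' \<subseteq> {u, w}"
      using ed(2)[OF uw(1)] edge_Int[OF E'(1,3)] edge_Int[OF E'(2,3)] E'(6,7) by blast
    then have s3: "\<exists>y. (e1' \<union> e2') \<inter> e3' \<subseteq> {y}"
    proof -
      assume sub: "(e1' \<union> e2') \<inter> e3' \<subseteq> {u, w}"
      have "x \<in> {u, w}" using x ed(2)[OF uw(1)] uw(2) by auto
      then show ?thesis using sub x(3) by (intro exI[of _ "if x = u then w else u"]) auto
    qed
    obtain s t where st: "nb s t" "e1' = ed s t" using edge_cases E' by metis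
    obtain s' t' where st': "nb s' t'" "e2' = ed s' t'" using edge_cases E' by metis
    have "{s, t} \<noteq> {s', t'}" using st st' E'(5) ed_eq_iff by metis
    then have "\<exists>y. {s, t} \<inter> {s', t'} \<subseteq> {y}" by auto
    then have s12: "\<exists>y. e1' \<inter> e2' \<subseteq> {y}"
      using ed_Int[OF st(1) st'(1)] \<open>{s, t} \<noteq> {s', t'}\<close> st st' by (metis subset_trans)
    have "connected (- (e1' \<union> e2'))"
      using arc[OF E'(1)] arc[OF E'(2)] s12 connected_sub_singleton
      by (metis Janiszewski_connected compact_imp_closed)
    then have "connected (- (e1' \<union> e2' \<union> e3'))"
      using arc[OF E'(1)] arc[OF E'(2)] arc[OF E'(3)] s3 connected_sub_singleton
      by (metis Janiszewski_connected compact_imp_closed compact_Un)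
    then show False using sep E'(4) by simp
  qed
  have v: "e1 \<inter> V = {a1, b1}" "e2 \<inter> V = {a2, b2}" "e3 \<inter> V = {a3, b3}"
    using 1 2 3 ed(2) by auto
  have k3: "{a3, b3} \<subseteq> {a1, b1} \<union> {a2, b2}"
    unfolding v[symmetric] using key[OF e(1,2,3) e(4) ne] by blast
  have "frontier F = e1 \<union> e3 \<union> e2" "frontier F = e2 \<union> e3 \<union> e1" using e(4) by blast+
  then have "e2 \<inter> V \<subseteq> e1 \<union> e3" "e1 \<inter> V \<subseteq> e2 \<union> e3"
    using key[OF e(1,3,2) _ ne(2,1) ne(3)[symmetric]] key[OF e(2,3,1) _ ne(3) ne(1)[symmetric] ne(2)[symmetric]]
    by metis+
  then have k12: "{a2, b2} \<subseteq> {a1, b1} \<union> {a3, b3}" "{a1, b1} \<subseteq> {a2, b2} \<union> {a3, b3}"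
    unfolding v[symmetric] by blast+
  have dis: "{a1, b1} \<noteq> {a2, b2}" "{a1, b1} \<noteq> {a3, b3}" "{a2, b2} \<noteq> {a3, b3}"
    using ne 1 2 3 ed_eq_iff by metis+
  have "a1 \<noteq> b1" "a2 \<noteq> b2" "a3 \<noteq> b3" using 1 2 3 ed(4) by auto
  \<comment> \<open>Three distinct pairs, each contained in the union of the other two, are the
    sides of a triangle.\<close>
  then have "\<exists>c. {{a2, b2}, {a3, b3}} = {{b1, c}, {a1, c}}"
    using k12 k3 dis by (simp add: doubleton_eq_iff) metis
  then obtain c where "{{a2, b2}, {a3, b3}} = {{b1, c}, {a1, c}}" by blast
  then have "(e2 = ed b1 c \<and> nb b1 c \<and> e3 = ed a1 c \<and> nb a1 c) \<or> (e3 = ed b1 c \<and> nb b1 c \<and> e2 = ed a1 c \<and> nb a1 c)"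
    using 2 3 ed_commute nb_sym by (auto simp: doubleton_eq_iff)
  then have c: "nb b1 c" "nb a1 c" "frontier F = tri a1 b1 c"
    using e(4) 1 unfolding tri_def by auto
  note J = tri_jordan[OF 1(1) c(1,2)]
  have FK: "F \<inter> tri a1 b1 c = {}" using fF(1) c(3) frontier_disjoint_eq by blast
  have "F \<subseteq> inside (tri a1 b1 c) \<or> F \<subseteq> outside (tri a1 b1 c)"
    by (rule connected_inside_or_outside[OF fF(2) FK J(2,5)])
  moreover have "\<not> F \<subseteq> outside (tri a1 b1 c)"
  proof
    assume "F \<subseteq> outside (tri a1 b1 c)"
    then have "outside (tri a1 b1 c) \<subseteq> F"
      using connected_Int_frontier[OF J(6), of F] fF(3) c(3) outside_no_overlap[of "tri a1 b1 c"] by blast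
    then show False using J(8) face_bounded[OF F] bounded_subset by blast
  qed
  ultimately have "F \<subseteq> inside (tri a1 b1 c)" by blast
  moreover have "inside (tri a1 b1 c) \<subseteq> F"
    using connected_Int_frontier[OF J(3), of F] fF(3) c(3) calculation inside_no_overlap[of "tri a1 b1 c"]
    by blast
  ultimately have eq: "F = inside (tri a1 b1 c)" by (rule subset_antisym)
  have "T a1 b1 c" unfolding T_def using 1(1) c(1,2) F eq by simp
  then show ?thesis using eq by metis
qed

lemma inside_tri_eqD:
  assumes "T a b c" "T a' b' c'" "inside (tri a b c) = inside (tri a' b' c')"
  shows "tri a b c = tri a' b' c'" "{a, b, c} = {a', b', c'}"
proof -
  show *: "tri a b c = tri a' b' c'" using T_frontier assms by metis
  show "{a, b, c} = {a', b', c'}" using tri_V T_D(1-3) assms(1,2) * by metis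
qed

lemma T_of_edge:
  assumes T: "T x y z" and ab: "nb a b" and p: "p \<in> ed a b" "p \<notin> V" "p \<in> tri x y z"
  shows "\<exists>c. T a b c \<and> tri a b c = tri x y z"
proof -
  have *: "{a, b} = {s, t}" if "nb s t" "p \<in> ed s t" for s t
    using that p(1,2) ab edge_eqI2[of "ed a b" "ed s t"] ed(1) ed_eq_iff by metis
  consider "p \<in> ed x y" | "p \<in> ed y z" | "p \<in> ed x z" using p(3) unfolding tri_def by blast
  then show ?thesis
  proof cases
    case 1
    then have "{a, b} = {x, y}" using * T_D T by metis
    then show ?thesis using T T_sym tri_sym by (metis doubleton_eq_iff)
  next
    case 2
    then have "{a, b} = {y, z}" using * T_D T by metis
    then show ?thesis using T T_sym tri_sym by (metis doubleton_eq_iff)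
  next
    case 3
    then have "{a, b} = {x, z}" using * T_D T by metis
    then show ?thesis using T T_sym tri_sym by (metis doubleton_eq_iff)
  qed
qed

lemma frontier_hit:
  assumes "F \<in> faces V E" "x \<in> F" "x \<in> ball p \<epsilon>" "p \<notin> F" "\<epsilon> > 0"
  shows "\<exists>y\<in>ball p \<epsilon>. y \<in> frontier F"
proof -
  have "p \<in> ball p \<epsilon>" using assms by simp
  then have "ball p \<epsilon> \<inter> frontier F \<noteq> {}"
    using assms by (intro connected_Int_frontier) blast+
  then show ?thesis by blast
qed

text \<open>Near an inner point of an edge there is no other edge. A face that comes this close
  therefore has frontier points on this very edge, which makes it one of the sides.\<close>

lemma local_edge:
  assumes ab: "nb a b" and p: "p \<in> ed a b" "p \<notin> V"
  shows "\<exists>\<epsilon>>0. \<forall>x\<in>ball p \<epsilon>. x \<notin> ed a b \<longrightarrow> (\<exists>c. T a b c \<and> x \<in> inside (tri a b c))"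
proof -
  obtain \<epsilon> where e: "\<epsilon> > 0" "\<And>e. e \<in> E \<Longrightarrow> e \<inter> ball p \<epsilon> \<noteq> {} \<Longrightarrow> p \<in> e" "V \<inter> ball p \<epsilon> \<subseteq> {p}"
    using small_ball[of p] by metis
  have only: "e = ed a b" if "e \<in> E" "y \<in> e" "y \<in> ball p \<epsilon>" for e y
  proof -
    have "p \<in> e" using that e(2) by blast
    then show ?thesis using edge_eqI2 that(1) ed(1)[OF ab] p by blast
  qed
  have "\<exists>c. T a b c \<and> x \<in> inside (tri a b c)" if x: "x \<in> ball p \<epsilon>" "x \<notin> ed a b" for x
  proof -
    have "x \<notin> \<Union>E" using only x by blast
    then obtain F where F: "F \<in> faces V E" "x \<in> F" using in_face by blast
    have "p \<notin> F" using face(5)[OF F(1) ed(1)[OF ab]] p by blast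
    then obtain y where y: "y \<in> ball p \<epsilon>" "y \<in> frontier F" using frontier_hit F x e(1) by blast
    obtain s t u where stu: "T s t u" "F = inside (tri s t u)" using face_triangle F by blast
    then have yt: "y \<in> tri s t u" using y T_frontier by blast
    then have "\<exists>e\<in>E. y \<in> e" unfolding tri_def using T_D(1-3)[OF stu(1)] ed(1) by blast
    then have "y \<in> ed a b" using only y by blast
    moreover have "y \<notin> V" using e(3) y p by blast
    ultimately show ?thesis using T_of_edge[OF stu(1) ab _ _ yt] stu(2) F(2) by auto
  qed
  then show ?thesis using e(1) by blast
qed

lemma local_vertex:
  assumes w: "w \<in> V"
  shows "\<exists>\<epsilon>>0. (\<forall>e\<in>E. e \<inter> ball w \<epsilon> \<noteq> {} \<longrightarrow> w \<in> e) \<and> V \<inter> ball w \<epsilon> \<subseteq> {w} \<and>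
    (\<forall>x\<in>ball w \<epsilon>. x \<notin> \<Union>E \<longrightarrow> (\<exists>b c. T w b c \<and> x \<in> inside (tri w b c)))"
proof -
  obtain \<epsilon> where e: "\<epsilon> > 0" "\<And>e. e \<in> E \<Longrightarrow> e \<inter> ball w \<epsilon> \<noteq> {} \<Longrightarrow> w \<in> e" "V \<inter> ball w \<epsilon> \<subseteq> {w}"
    using small_ball[of w] by metis
  have "\<exists>b c. T w b c \<and> x \<in> inside (tri w b c)" if x: "x \<in> ball w \<epsilon>" "x \<notin> \<Union>E" for x
  proof -
    obtain F where F: "F \<in> faces V E" "x \<in> F" using in_face x by blast
    have "w \<notin> F" using face(4)[OF F(1)] w by blast
    then obtain y where y: "y \<in> ball w \<epsilon>" "y \<in> frontier F" using frontier_hit F x e(1) by blast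
    obtain s t u where stu: "T s t u" "F = inside (tri s t u)" using face_triangle F by blast
    then have "y \<in> tri s t u" using y T_frontier by blast
    then have "\<exists>e\<in>E. y \<in> e \<and> e \<subseteq> tri s t u" unfolding tri_def using T_D(1-3)[OF stu(1)] ed(1) by blast
    then have "w \<in> tri s t u" using e(2) y(1) by blast
    then have "w \<in> {s, t, u}" using tri_V T_D(1-3)[OF stu(1)] w by blast
    then have "\<exists>b c. T w b c \<and> tri w b c = tri s t u"
      using stu(1) T_sym tri_sym by (metis insertE singletonD)
    then show ?thesis using stu(2) F(2) by metis
  qed
  then show ?thesis using e by (intro exI[of _ \<epsilon>]) auto
qed

lemma edge_inner_point:
  assumes "nb a b"
  obtains p where "p \<in> ed a b" "p \<notin> V"
proof -
  have "ed a b - {a, b} \<noteq> {}" using arc_betweenD(10)[OF ed(3)[OF assms]] .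
  then show ?thesis using that ed(2)[OF assms] by blast
qed

lemma T_closure: "T a b c \<Longrightarrow> ed a b \<subseteq> closure (inside (tri a b c))"
  using T_frontier[of a b c] closure_Un_frontier[of "inside (tri a b c)"] unfolding tri_def by blast

lemma ex_T: "nb a b \<Longrightarrow> \<exists>c. T a b c"
proof -
  assume ab: "nb a b"
  obtain p where p: "p \<in> ed a b" "p \<notin> V" using edge_inner_point[OF ab] .
  obtain \<epsilon> where e: "\<epsilon> > 0" "\<forall>x\<in>ball p \<epsilon>. x \<notin> ed a b \<longrightarrow> (\<exists>c. T a b c \<and> x \<in> inside (tri a b c))"
    using local_edge[OF ab p] by blast
  have "\<not> ball p \<epsilon> \<subseteq> ed a b"
  proof
    assume "ball p \<epsilon> \<subseteq> ed a b"
    then have "p \<in> interior (ed a b)" using e(1) mem_interior by blast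
    then show False using arc_between_interior_empty[OF ed(3)[OF ab]] by simp
  qed
  then show ?thesis using e(2) by blast
qed

text \<open>The edge is also on the frontier of the outside of the first triangle. Points out there
  and close to the edge lie in a face on the edge, necessarily a different one.\<close>

lemma ex_T_other: "T a b c \<Longrightarrow> \<exists>d. T a b d \<and> d \<noteq> c"
proof -
  assume T: "T a b c"
  note nbs = T_D(1-3)[OF T]
  note J = tri_jordan[OF nbs]
  obtain p where p: "p \<in> ed a b" "p \<notin> V" using edge_inner_point[OF nbs(1)] .
  obtain \<epsilon> where e: "\<epsilon> > 0" "\<forall>x\<in>ball p \<epsilon>. x \<notin> ed a b \<longrightarrow> (\<exists>c. T a b c \<and> x \<in> inside (tri a b c))"
    using local_edge[OF nbs(1) p] by blast
  have "p \<in> frontier (outside (tri a b c))" using p J(10) unfolding tri_def by blast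
  then have "p \<in> closure (outside (tri a b c))" by (simp add: frontier_def)
  then obtain x where x: "x \<in> outside (tri a b c)" "x \<in> ball p \<epsilon>"
    using e(1) by (metis closure_approachable mem_ball dist_commute)
  have "x \<notin> tri a b c" using x(1) outside_no_overlap by blast
  then have "x \<notin> ed a b" unfolding tri_def by blast
  then obtain d where d: "T a b d" "x \<in> inside (tri a b d)" using e(2) x(2) by blast
  have "d \<noteq> c" using d(2) x(1) inside_Int_outside by blast
  then show ?thesis using d(1) by blast
qed

text \<open>Two triangles on an edge form a quadrilateral with the edge running through its inside,
  by \<open>theta_middle\<close>. That inside consists of the two faces and the open edge, so there
  is no room for a third face accumulating at the edge.\<close>

lemma T_at_most_two:
  assumes x: "T a b x" and y: "T a b y" and z: "T a b z" and ne: "x \<noteq> y"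
  shows "z = x \<or> z = y"
proof (rule ccontr)
  assume neg: "\<not> ?thesis"
  define S where "S = ed a b"
  define S1 where "S1 = ed a x \<union> ed x b"
  define S2 where "S2 = ed a y \<union> ed y b"
  have nbs: "nb a b" "nb a x" "nb x b" "nb a y" "nb y b" and ab: "a \<noteq> b" "a \<noteq> x" "b \<noteq> x" "a \<noteq> y" "b \<noteq> y"
    using T_D[OF x] T_D[OF y] nb_sym by blast+
  have arcs: "arc_between S1 a b" "arc_between S2 a b" "arc_between S a b"
    unfolding S_def S1_def S2_def using nbs path2_arc ab ed(3) by blast+
  have i: "ed s t \<inter> ed s' t' \<subseteq> {a, b}"
    if "nb s t" "nb s' t'" "{s, t} \<noteq> {s', t'}" "{s, t} \<inter> {s', t'} \<subseteq> {a, b}" for s t s' t'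
    using ed_Int[OF that(1-3)] that(4) by blast
  have i1: "S1 \<inter> S2 \<subseteq> {a, b}"
    unfolding S1_def S2_def using i[OF nbs(2,4)] i[OF nbs(2,5)] i[OF nbs(3,4)] i[OF nbs(3,5)] ab ne
    by (simp add: doubleton_eq_iff Int_Un_distrib Int_Un_distrib2)
  have i2: "S1 \<inter> S \<subseteq> {a, b}"
    unfolding S1_def S_def using i[OF nbs(2,1)] i[OF nbs(3,1)] ab
    by (simp add: doubleton_eq_iff Int_Un_distrib Int_Un_distrib2)
  have i3: "S2 \<inter> S \<subseteq> {a, b}"
    unfolding S2_def S_def using i[OF nbs(4,1)] i[OF nbs(5,1)] ab
    by (simp add: doubleton_eq_iff Int_Un_distrib Int_Un_distrib2)
  have eq: "S1 \<union> S = tri a b x" "S2 \<union> S = tri a b y"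
    unfolding S_def S1_def S2_def tri_def using ed_commute by blast+
  have dis: "inside (tri a b s) \<inter> inside (tri a b t) = {}" if "T a b s" "T a b t" "s \<noteq> t" for s t
  proof (rule ccontr)
    assume "\<not> ?thesis"
    then have "inside (tri a b s) = inside (tri a b t)" using that T_D(4) faces_disjoint by blast
    then have "{a, b, s} = {a, b, t}" using inside_tri_eqD that by blast
    moreover have "s \<noteq> a" "s \<noteq> b" using T_D(6,7)[OF that(1)] by auto
    ultimately show False using that(3) by (metis insertCI insertE singletonD)
  qed
  have in_ed: "inside (tri a b s) \<inter> ed u w = {}" if "T a b s" "nb u w" for s u w
    using face(5)[OF T_D(4)[OF that(1)] ed(1)[OF that(2)]] .
  have d1: "inside (S1 \<union> S) \<inter> S2 = {}" "inside (S2 \<union> S) \<inter> S1 = {}"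
    unfolding eq unfolding S1_def S2_def using in_ed[OF x nbs(4)] in_ed[OF x nbs(5)]
      in_ed[OF y nbs(2)] in_ed[OF y nbs(3)] by blast+
  have d2: "inside (S1 \<union> S) \<inter> inside (S2 \<union> S) = {}" unfolding eq using dis x y ne by blast
  have mid: "S - {a, b} \<subseteq> inside (S1 \<union> S2)"
    using theta_middle[OF arcs i1 i2 i3 d1 d2] .
  obtain p where p: "p \<in> S" "p \<notin> V" using edge_inner_point[OF nbs(1)] S_def by blast
  have "p \<noteq> a" "p \<noteq> b" using p ed(5,6)[OF nbs(1)] by auto
  then have pin: "p \<in> inside (S1 \<union> S2)" using mid p by blast
  have spl: "inside (S1 \<union> S) \<union> inside (S2 \<union> S) \<union> (S - {a, b}) = inside (S1 \<union> S2)"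
    using theta_split(2)[OF arcs i1 i2 i3] pin p by blast
  have "p \<in> closure (inside (tri a b z))" using T_closure[OF z] p S_def by blast
  moreover have "open (inside (S1 \<union> S2))" using jordan_arcs(2)[OF arcs(1,2) i1] .
  ultimately have "inside (S1 \<union> S2) \<inter> inside (tri a b z) \<noteq> {}"
    using pin open_Int_closure_eq_empty by blast
  moreover have "inside (tri a b x) \<inter> inside (tri a b z) = {}" "inside (tri a b y) \<inter> inside (tri a b z) = {}"
    using dis[OF x z] dis[OF y z] neg by auto
  moreover have "S \<inter> inside (tri a b z) = {}" using in_ed[OF z nbs(1)] S_def by blast
  ultimately show False using spl unfolding eq by blast
qed

lemma card_T: "nb a b \<Longrightarrow> card {x. T a b x} = 2"
proof -
  assume "nb a b"
  then obtain x where x: "T a b x" using ex_T by blast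
  then obtain y where y: "T a b y" "y \<noteq> x" using ex_T_other by blast
  have "{x. T a b x} = {x, y}" using x y T_at_most_two by blast
  then show ?thesis using y by simp
qed

text \<open>A small punctured disk around \<open>w\<close> is connected. It is covered by the
  relatively open regions \<open>reg v\<close>, made of the edge from \<open>w\<close> to
  \<open>v\<close> and the faces beside it, and there two regions meet only for equal or
  link-adjacent neighbours. A disconnected link would split the punctured disk.\<close>

lemma link_connected:
  assumes u: "nb w u" and u': "nb w u'"
  shows "(T w)\<^sup>*\<^sup>* u u'"
proof (rule ccontr)
  assume neg: "\<not> ?thesis"
  have wV: "w \<in> V" using ed(5)[OF u] .
  define U where "U = {x. nb w x \<and> (T w)\<^sup>*\<^sup>* u x}"
  define U' where "U' = {x. nb w x} - U"
  obtain \<epsilon> where e: "\<epsilon> > 0" "\<And>e. e \<in> E \<Longrightarrow> e \<inter> ball w \<epsilon> \<noteq> {} \<Longrightarrow> w \<in> e" "V \<inter> ball w \<epsilon> \<subseteq> {w}"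
    "\<And>x. x\<in>ball w \<epsilon> \<Longrightarrow> x \<notin> \<Union>E \<Longrightarrow> (\<exists>b c. T w b c \<and> x \<in> inside (tri w b c))"
    using local_vertex[OF wV] by metis
  define B where "B = ball w \<epsilon> - {w}"
  define reg where "reg v = ed w v \<union> \<Union>{inside (tri w v c) |c. T w v c}" for v
  have BV: "B \<inter> V = {}" unfolding B_def using e(3) by blast
  have "connected B" unfolding B_def by (rule connected_punctured_ball) simp
  have op: "open (B \<inter> reg v)" if v: "nb w v" for v
    unfolding open_contains_ball
  proof
    fix x assume x: "x \<in> B \<inter> reg v"
    have "open B" unfolding B_def by (simp add: open_delete)
    then obtain d where d: "d > 0" "ball x d \<subseteq> B" using x open_contains_ball by blast
    have "\<exists>d'>0. ball x d' \<subseteq> reg v"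
    proof (cases "x \<in> ed w v")
      case True
      have "x \<notin> V" using x BV by blast
      from local_edge[OF v True this] obtain d' where
        d': "d' > 0" "\<forall>y\<in>ball x d'. y \<notin> ed w v \<longrightarrow> (\<exists>c. T w v c \<and> y \<in> inside (tri w v c))" by metis
      have "ball x d' \<subseteq> reg v"
      proof
        fix y assume "y \<in> ball x d'"
        then have "y \<in> ed w v \<or> (\<exists>c. T w v c \<and> y \<in> inside (tri w v c))" using d'(2) by metis
        then show "y \<in> reg v" unfolding reg_def by blast
      qed
      then show ?thesis using d'(1) by metis
    next
      case False
      then obtain c where c: "T w v c" "x \<in> inside (tri w v c)" using x reg_def by blast
      have "open (inside (tri w v c))" using face(1)[OF T_D(4)[OF c(1)]] .
      then obtain d' where "d' > 0" "ball x d' \<subseteq> inside (tri w v c)" using c(2) open_contains_ball by blast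
      then show ?thesis unfolding reg_def using c(1) by blast
    qed
    then obtain d' where d': "d' > 0" "ball x d' \<subseteq> reg v" by blast
    have "ball x (min d d') \<subseteq> ball x d" "ball x (min d d') \<subseteq> ball x d'" by auto
    then have "ball x (min d d') \<subseteq> B \<inter> reg v" using d(2) d'(2) by blast
    then show "\<exists>e>0. ball x e \<subseteq> B \<inter> reg v" using d(1) d'(1) by (intro exI[of _ "min d d'"]) simp
  qed
  define A where "A X = (\<Union>v\<in>X. B \<inter> reg v)" for X
  have opA: "open (A U)" "open (A U')" unfolding A_def using op U_def U'_def by blast+
  have cov: "B \<subseteq> A U \<union> A U'"
  proof
    fix x assume x: "x \<in> B"
    have "\<exists>v. nb w v \<and> x \<in> reg v"
    proof (cases "x \<in> \<Union>E")
      case True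
      then obtain f where f: "f \<in> E" "x \<in> f" by blast
      then have "w \<in> f" using e(2) x B_def by blast
      obtain s t where st: "nb s t" "f = ed s t" using edge_cases f by blast
      have "w = s \<or> w = t" using ed(2)[OF st(1)] st(2) \<open>w \<in> f\<close> wV by blast
      then have "\<exists>v. nb w v \<and> f = ed w v" using st nb_sym ed_commute by metis
      then show ?thesis using f(2) reg_def by blast
    next
      case False
      then obtain b c where "T w b c" "x \<in> inside (tri w b c)" using e(4) x B_def by blast
      then show ?thesis unfolding reg_def using T_D(1) by blast
    qed
    then obtain v where "nb w v" "x \<in> reg v" by blast
    then show "x \<in> A U \<union> A U'" using x unfolding A_def U'_def by blast
  qed
  have meet: "v' = v \<or> T w v v'" if v: "nb w v" "nb w v'" and x: "x \<in> B" "x \<in> reg v" "x \<in> reg v'" for x v v'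
  proof -
    have xw: "x \<noteq> w" "x \<notin> V" using x BV B_def by auto
    consider (ee) "x \<in> ed w v" "x \<in> ed w v'"
      | (ef) c where "x \<in> ed w v" "T w v' c" "x \<in> inside (tri w v' c)"
      | (fe) c where "x \<in> ed w v'" "T w v c" "x \<in> inside (tri w v c)"
      | (ff) c c' where "T w v c" "x \<in> inside (tri w v c)" "T w v' c'" "x \<in> inside (tri w v' c')"
      using x(2,3) unfolding reg_def by blast
    then show ?thesis
    proof cases
      case ee
      then have "ed w v = ed w v'" using edge_eqI2 ed(1) v xw(2) by blast
      then show ?thesis using ed_eq_iff v by (metis doubleton_eq_iff)
    next
      case ef
      then show ?thesis using face(5)[OF T_D(4)[OF ef(2)] ed(1)[OF v(1)]] by blast
    next
      case fe
      then show ?thesis using face(5)[OF T_D(4)[OF fe(2)] ed(1)[OF v(2)]] by blast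
    next
      case ff
      then have "inside (tri w v c) = inside (tri w v' c')" using faces_disjoint T_D(4) by blast
      then have "{w, v, c} = {w, v', c'}" using inside_tri_eqD ff by blast
      moreover have "w \<noteq> v'" using ed(4) v by blast
      ultimately have "v' = v \<or> v' = c" by (metis insertCI insertE singletonD)
      then show ?thesis using ff(1) by blast
    qed
  qed
  have dis: "A U \<inter> A U' \<inter> B = {}"
  proof (rule ccontr)
    assume "\<not> ?thesis"
    then obtain x v v' where x: "x \<in> B" "x \<in> reg v" "x \<in> reg v'" and v: "v \<in> U" "v' \<in> U'"
      unfolding A_def by blast
    have "nb w v" "nb w v'" using v U_def U'_def by blast+
    then have "v' = v \<or> T w v v'" using meet x by blast
    then have "(T w)\<^sup>*\<^sup>* u v'" using v(1) unfolding U_def by (auto intro: rtranclp.rtrancl_into_rtrancl)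
    then show False using v(2) \<open>nb w v'\<close> unfolding U'_def U_def by blast
  qed
  have ne: "B \<inter> reg v \<noteq> {}" if v: "nb w v" for v
  proof -
    have "w \<in> closure (ed w v - {w, v})" using arc_betweenD(1,11)[OF ed(3)[OF v]] by blast
    then obtain x where "x \<in> ed w v - {w, v}" "x \<in> ball w \<epsilon>"
      using e(1) by (metis closure_approachable mem_ball dist_commute)
    then show ?thesis unfolding B_def reg_def by blast
  qed
  have "u \<in> U" unfolding U_def using u by simp
  then have neA: "A U \<inter> B \<noteq> {}" using ne[OF u] unfolding A_def by blast
  have "u' \<in> U'" unfolding U'_def U_def using u' neg by simp
  then have neA': "A U' \<inter> B \<noteq> {}" using ne[OF u'] unfolding A_def by blast
  show False using connectedD[OF \<open>connected B\<close> opA dis cov] neA neA' by blast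
qed

subsection \<open>Disks bounded by cycles\<close>

text \<open>The conclusions of the Jordan curve theorem for the union of a set of edges, so that
  disks can be cut and compared without parametrizing their boundaries.\<close>

definition jcurve :: "complex set set \<Rightarrow> bool" where
  "jcurve X \<longleftrightarrow> X \<subseteq> E \<and> inside (\<Union>X) \<noteq> {} \<and> open (inside (\<Union>X)) \<and> open (outside (\<Union>X)) \<and>
     connected (inside (\<Union>X)) \<and> connected (outside (\<Union>X)) \<and>
     bounded (inside (\<Union>X)) \<and> \<not> bounded (outside (\<Union>X)) \<and>
     frontier (inside (\<Union>X)) = \<Union>X \<and> frontier (outside (\<Union>X)) = \<Union>X \<and> bounded (\<Union>X)"

lemma jcurve_arcs:
  assumes "X \<subseteq> E" "Y \<subseteq> E" "arc_between (\<Union>X) a b" "arc_between (\<Union>Y) a b" "\<Union>X \<inter> \<Union>Y \<subseteq> {a, b}"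
  shows "jcurve (X \<union> Y)"
  unfolding jcurve_def Union_Un_distrib
  using jordan_arcs[OF assms(3-5)] assms(1,2) arc_betweenD(6)[OF assms(3)] arc_betweenD(6)[OF assms(4)]
  by simp

definition DV :: "complex set set \<Rightarrow> complex set" where
  "DV X = V \<inter> (\<Union>X \<union> inside (\<Union>X))"
definition DE :: "complex set set \<Rightarrow> complex set set" where
  "DE X = {e\<in>E. e \<subseteq> \<Union>X \<union> inside (\<Union>X)}"
definition DF :: "complex set set \<Rightarrow> complex set set" where
  "DF X = {F\<in>faces V E. F \<subseteq> inside (\<Union>X)}"

lemma edge_inner:
  assumes "e \<in> E"
  shows "connected (e - V)" "e - V \<noteq> {}" "e \<subseteq> closure (e - V)"
proof -
  obtain u w where uw: "arc_between e u w" "e \<inter> V = {u, w}" using edge_arc assms by blast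
  then have "e - V = e - {u, w}" by blast
  then show "connected (e - V)" "e - V \<noteq> {}" "e \<subseteq> closure (e - V)"
    using arc_betweenD(9-11)[OF uw(1)] by auto
qed

lemma tri_cong:
  assumes "T a b c" "T x y z" "{a, b, c} = {x, y, z}"
  shows "tri a b c = tri x y z"
proof -
  have *: "tri a b c = (\<Union>u\<in>{a, b, c}. \<Union>v\<in>{a, b, c} - {u}. ed u v)" if "T a b c" for a b c
  proof -
    have "{a, b, c} - {a} = {b, c}" "{a, b, c} - {b} = {a, c}" "{a, b, c} - {c} = {a, b}"
      using T_D(5-7)[OF that] by auto
    then show ?thesis unfolding tri_def
      using ed_commute[of a b] ed_commute[of a c] ed_commute[of b c] by auto
  qed
  show ?thesis unfolding *[OF assms(1)] *[OF assms(2)] assms(3) ..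
qed

text \<open>Allows faces to be counted as three-element vertex sets, both here for finiteness and
  later in the layers.\<close>

lemma faces_inj: "inj_on (\<lambda>F. frontier F \<inter> V) (faces V E)"
proof
  fix F G assume FG: "F \<in> faces V E" "G \<in> faces V E" "frontier F \<inter> V = frontier G \<inter> V"
  obtain a b c where F: "T a b c" "F = inside (tri a b c)" using face_triangle FG by blast
  obtain x y z where G: "T x y z" "G = inside (tri x y z)" using face_triangle FG by blast
  have "{a, b, c} = {x, y, z}"
    using FG(3) T_frontier F G tri_V T_D(1-3)[OF F(1)] T_D(1-3)[OF G(1)] by metis
  then show "F = G" unfolding F(2) G(2) using tri_cong F(1) G(1) by metis
qed

lemma edge_Int_curve: "X \<subseteq> E \<Longrightarrow> e \<in> E \<Longrightarrow> e \<notin> X \<Longrightarrow> (e - V) \<inter> \<Union>X = {}"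
  using edge_Int by blast

lemma edge_subset_Union: "X \<subseteq> E \<Longrightarrow> e \<in> E \<Longrightarrow> e \<subseteq> \<Union>X \<Longrightarrow> e \<in> X"
  using edge_Int_curve[of X e] edge_inner(2)[of e] by blast

context
  fixes X assumes X: "jcurve X"
begin

lemma jc: "X \<subseteq> E" "inside (\<Union>X) \<noteq> {}" "open (inside (\<Union>X))" "open (outside (\<Union>X))"
  "connected (inside (\<Union>X))" "connected (outside (\<Union>X))"
  "bounded (inside (\<Union>X))" "\<not> bounded (outside (\<Union>X))"
  "frontier (inside (\<Union>X)) = \<Union>X" "frontier (outside (\<Union>X)) = \<Union>X" "bounded (\<Union>X)"
  using X unfolding jcurve_def by auto

lemma closure_inside_jc: "closure (inside (\<Union>X)) = \<Union>X \<union> inside (\<Union>X)"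
  using jc(9) closure_Un_frontier[of "inside (\<Union>X)"] by blast

lemma closure_outside_jc: "closure (outside (\<Union>X)) = \<Union>X \<union> outside (\<Union>X)"
  using jc(10) closure_Un_frontier[of "outside (\<Union>X)"] by blast

lemma face_side: "F \<in> faces V E \<Longrightarrow> F \<subseteq> inside (\<Union>X) \<or> F \<subseteq> outside (\<Union>X)"
  using face(2,5)[of F] jc(1,3,4) by (intro connected_inside_or_outside) blast+

lemma edge_side: "e \<in> E \<Longrightarrow> e \<notin> X \<Longrightarrow> e - V \<subseteq> inside (\<Union>X) \<or> e - V \<subseteq> outside (\<Union>X)"
  using edge_inner(1)[of e] edge_Int_curve[OF jc(1)] jc(3,4) by (intro connected_inside_or_outside) auto

lemma DE_iff: "e \<in> E \<Longrightarrow> e \<in> DE X \<longleftrightarrow> e \<in> X \<or> e - V \<subseteq> inside (\<Union>X)"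
proof
  assume e: "e \<in> E" "e \<in> DE X"
  show "e \<in> X \<or> e - V \<subseteq> inside (\<Union>X)"
  proof (cases "e \<in> X")
    case False
    then have "(e - V) \<inter> \<Union>X = {}" using edge_Int_curve[OF jc(1)] e by blast
    then show ?thesis using e(2) unfolding DE_def by blast
  qed simp
next
  assume e: "e \<in> E" "e \<in> X \<or> e - V \<subseteq> inside (\<Union>X)"
  show "e \<in> DE X"
  proof (cases "e \<in> X")
    case False
    then have "closure (e - V) \<subseteq> closure (inside (\<Union>X))" using e(2) closure_mono by blast
    then have "e \<subseteq> \<Union>X \<union> inside (\<Union>X)" using edge_inner(3)[OF e(1)] closure_inside_jc by blast
    then show ?thesis using e(1) unfolding DE_def by blast
  next
    case True
    then show ?thesis using e(1) unfolding DE_def by blast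
  qed
qed

text \<open>The edge lies in the closure of the face, and the curve avoids the open edge, so both
  are on the same side.\<close>

lemma T_side_inside:
  assumes T: "T a b c" and ab: "ed a b \<notin> X"
  shows "ed a b - V \<subseteq> inside (\<Union>X) \<longleftrightarrow> inside (tri a b c) \<subseteq> inside (\<Union>X)"
proof -
  have e: "ed a b \<in> E" using ed(1) T_D(1) T by blast
  obtain p where p: "p \<in> ed a b - V" using edge_inner(2)[OF e] by blast
  have F: "inside (tri a b c) \<in> faces V E" using T_D(4) T by blast
  have pcl: "p \<in> closure (inside (tri a b c))" using T_closure[OF T] p by blast
  have meet: "S \<inter> inside (tri a b c) \<noteq> {}" if "open S" "p \<in> S" for S
    using that pcl open_Int_closure_eq_empty by blast
  note es = edge_side[OF e ab] and fs = face_side[OF F]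
  show ?thesis
  proof
    assume "ed a b - V \<subseteq> inside (\<Union>X)"
    then have "p \<in> inside (\<Union>X)" using p by blast
    then have "inside (\<Union>X) \<inter> inside (tri a b c) \<noteq> {}" using meet jc(3) by blast
    then show "inside (tri a b c) \<subseteq> inside (\<Union>X)" using fs inside_Int_outside[of "\<Union>X"] by blast
  next
    assume i: "inside (tri a b c) \<subseteq> inside (\<Union>X)"
    show "ed a b - V \<subseteq> inside (\<Union>X)"
    proof (rule ccontr)
      assume "\<not> ?thesis"
      then have "p \<in> outside (\<Union>X)" using es p by blast
      then have "outside (\<Union>X) \<inter> inside (tri a b c) \<noteq> {}" using meet jc(4) by blast
      then show False using i inside_Int_outside[of "\<Union>X"] by blast
    qed
  qed
qed

text \<open>Each point of a Jordan curve is a limit of inside points and of outside points, and near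
  an inner point of the edge all of these lie in faces on the edge.\<close>

lemma T_side_curve:
  assumes ab: "nb a b" "ed a b \<in> X"
  shows "\<exists>c. T a b c \<and> inside (tri a b c) \<subseteq> inside (\<Union>X)"
    and "\<exists>d. T a b d \<and> \<not> inside (tri a b d) \<subseteq> inside (\<Union>X)"
proof -
  obtain p where p: "p \<in> ed a b" "p \<notin> V" using edge_inner_point[OF ab(1)] .
  obtain \<epsilon> where e: "\<epsilon> > 0" "\<forall>x\<in>ball p \<epsilon>. x \<notin> ed a b \<longrightarrow> (\<exists>c. T a b c \<and> x \<in> inside (tri a b c))"
    using local_edge[OF ab(1) p] by blast
  have pX: "p \<in> \<Union>X" using p ab by blast
  then have "p \<in> closure (inside (\<Union>X))" using closure_inside_jc by blast
  then obtain x where x: "x \<in> inside (\<Union>X)" "x \<in> ball p \<epsilon>"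
    using e(1) by (metis closure_approachable mem_ball dist_commute)
  have "x \<notin> ed a b" using x(1) ab(2) inside_no_overlap by blast
  then obtain c where c: "T a b c" "x \<in> inside (tri a b c)" using e(2) x(2) by blast
  then have "inside (tri a b c) \<subseteq> inside (\<Union>X)"
    using face_side[OF T_D(4)[OF c(1)]] x(1) inside_Int_outside[of "\<Union>X"] by blast
  then show "\<exists>c. T a b c \<and> inside (tri a b c) \<subseteq> inside (\<Union>X)" using c(1) by blast
  have "p \<in> closure (outside (\<Union>X))" using closure_outside_jc pX by blast
  then obtain y where y: "y \<in> outside (\<Union>X)" "y \<in> ball p \<epsilon>"
    using e(1) by (metis closure_approachable mem_ball dist_commute)
  have "y \<notin> ed a b" using y(1) ab(2) outside_no_overlap by blast
  then obtain d where d: "T a b d" "y \<in> inside (tri a b d)" using e(2) y(2) by blast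
  then have "\<not> inside (tri a b d) \<subseteq> inside (\<Union>X)" using y(1) inside_Int_outside[of "\<Union>X"] by blast
  then show "\<exists>d. T a b d \<and> \<not> inside (tri a b d) \<subseteq> inside (\<Union>X)" using d(1) by blast
qed

lemma T_side_curve_unique:
  assumes "ed a b \<in> X" "T a b c" "T a b d" "c \<noteq> d"
  shows "inside (tri a b c) \<subseteq> inside (\<Union>X) \<longleftrightarrow> \<not> inside (tri a b d) \<subseteq> inside (\<Union>X)"
  using T_side_curve[OF T_D(1)[OF assms(2)] assms(1)] T_at_most_two[OF assms(2,3) _ assms(4)] by metis

lemma T_DE:
  assumes "T a b c" "inside (tri a b c) \<subseteq> inside (\<Union>X)"
  shows "ed a b \<in> DE X"
proof -
  have "closure (inside (tri a b c)) \<subseteq> closure (inside (\<Union>X))" using assms(2) closure_mono by blast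
  then have "ed a b \<subseteq> \<Union>X \<union> inside (\<Union>X)" using T_closure[OF assms(1)] closure_inside_jc by blast
  then show ?thesis using ed(1)[OF T_D(1)[OF assms(1)]] unfolding DE_def by blast
qed

lemma finite_DV: "finite (DV X)"
  using mesh jc(7,11) unfolding DV_def mesh_def locally_finite_def by (simp add: Int_Un_distrib)

lemma finite_DE: "finite (DE X)"
proof -
  have "finite {e\<in>E. e \<inter> (\<Union>X \<union> inside (\<Union>X)) \<noteq> {}}"
    using mesh jc(7,11) unfolding mesh_def locally_finite_def by (meson bounded_Un)
  moreover have "DE X \<subseteq> {e\<in>E. e \<inter> (\<Union>X \<union> inside (\<Union>X)) \<noteq> {}}"
    unfolding DE_def using edge_inner(2) by blast
  ultimately show ?thesis using finite_subset by blast
qed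

text \<open>This is the form in which \<open>faces_of\<close> selects faces. The point is that a
  face with all sides in the closed disk cannot lie outside: its frontier would miss the outside
  region, which would then be contained in the bounded face.\<close>

lemma DF_iff:
  assumes "F \<in> faces V E"
  shows "F \<in> DF X \<longleftrightarrow> {e\<in>E. e \<subseteq> frontier F} \<subseteq> DE X"
proof
  assume F: "F \<in> DF X"
  then have "frontier F \<subseteq> \<Union>X \<union> inside (\<Union>X)"
    using closure_mono[of F "inside (\<Union>X)"] closure_inside_jc closure_Un_frontier[of F]
    unfolding DF_def by blast
  then show "{e\<in>E. e \<subseteq> frontier F} \<subseteq> DE X" unfolding DE_def by blast
next
  assume sub: "{e\<in>E. e \<subseteq> frontier F} \<subseteq> DE X"
  obtain a b c where abc: "T a b c" "F = inside (tri a b c)" using face_triangle assms by blast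
  have fr: "frontier F = ed a b \<union> ed b c \<union> ed a c" using T_frontier abc unfolding tri_def by blast
  have "ed a b \<in> E" "ed b c \<in> E" "ed a c \<in> E" using ed(1) T_D(1-3)[OF abc(1)] by auto
  then have "ed a b \<in> DE X" "ed b c \<in> DE X" "ed a c \<in> DE X" using sub fr by blast+
  then have fs: "frontier F \<subseteq> \<Union>X \<union> inside (\<Union>X)" unfolding fr DE_def by blast
  have "\<not> F \<subseteq> outside (\<Union>X)"
  proof
    assume o: "F \<subseteq> outside (\<Union>X)"
    have "outside (\<Union>X) \<inter> frontier F = {}"
      using fs outside_no_overlap[of "\<Union>X"] inside_Int_outside[of "\<Union>X"] by blast
    then have "outside (\<Union>X) \<subseteq> F"
      using connected_Int_frontier[OF jc(6), of F] o face(3)[OF assms] by blast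
    then show False using jc(8) face_bounded(1)[OF assms] bounded_subset by blast
  qed
  then show "F \<in> DF X" using face_side[OF assms] assms unfolding DF_def by blast
qed

lemma finite_DF: "finite (DF X)"
proof (rule finite_imageD)
  have "frontier F \<subseteq> \<Union>X \<union> inside (\<Union>X)" if "F \<in> DF X" for F
    using that closure_mono[of F "inside (\<Union>X)"] closure_inside_jc closure_Un_frontier[of F]
    unfolding DF_def by blast
  then have "(\<lambda>F. frontier F \<inter> V) ` DF X \<subseteq> Pow (DV X)" unfolding DV_def by blast
  then show "finite ((\<lambda>F. frontier F \<inter> V) ` DF X)" using finite_DV finite_subset by blast
  show "inj_on (\<lambda>F. frontier F \<inter> V) (DF X)"
    by (rule inj_on_subset[OF faces_inj]) (auto simp: DF_def)
qed

end

section \<open>Cutting a disk along a path inside it\<close>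

definition theta :: "complex set set \<Rightarrow> complex set set \<Rightarrow> complex set set \<Rightarrow> complex \<Rightarrow> complex \<Rightarrow> bool" where
  "theta X Y M x y \<longleftrightarrow> X \<subseteq> E \<and> Y \<subseteq> E \<and> M \<subseteq> E \<and>
     arc_between (\<Union>X) x y \<and> arc_between (\<Union>Y) x y \<and> arc_between (\<Union>M) x y \<and>
     \<Union>X \<inter> \<Union>Y \<subseteq> {x, y} \<and> \<Union>X \<inter> \<Union>M \<subseteq> {x, y} \<and> \<Union>Y \<inter> \<Union>M \<subseteq> {x, y} \<and>
     x \<in> V \<and> y \<in> V \<and> \<Union>M \<inter> inside (\<Union>X \<union> \<Union>Y) \<noteq> {}"

context
  fixes X Y M x y assumes th: "theta X Y M x y"
begin

lemma theta_jcurve: "jcurve (X \<union> Y)" "jcurve (X \<union> M)" "jcurve (Y \<union> M)"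
  using th unfolding theta_def by (blast intro: jcurve_arcs)+

lemma theta_inside:
  "inside (\<Union>(X \<union> M)) \<inter> inside (\<Union>(Y \<union> M)) = {}"
  "inside (\<Union>(X \<union> M)) \<union> inside (\<Union>(Y \<union> M)) \<union> (\<Union>M - {x, y}) = inside (\<Union>(X \<union> Y))"
proof -
  have a: "arc_between (\<Union>X) x y" "arc_between (\<Union>Y) x y" "arc_between (\<Union>M) x y"
    "\<Union>X \<inter> \<Union>Y \<subseteq> {x, y}" "\<Union>X \<inter> \<Union>M \<subseteq> {x, y}" "\<Union>Y \<inter> \<Union>M \<subseteq> {x, y}"
    "\<Union>M \<inter> inside (\<Union>X \<union> \<Union>Y) \<noteq> {}"
    using th unfolding theta_def by auto
  show "inside (\<Union>(X \<union> M)) \<inter> inside (\<Union>(Y \<union> M)) = {}"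
    "inside (\<Union>(X \<union> M)) \<union> inside (\<Union>(Y \<union> M)) \<union> (\<Union>M - {x, y}) = inside (\<Union>(X \<union> Y))"
    unfolding Union_Un_distrib using theta_split[OF a] by auto
qed

lemma theta_ends: "x \<in> \<Union>X" "y \<in> \<Union>X" "x \<in> \<Union>Y" "y \<in> \<Union>Y" "x \<in> \<Union>M" "y \<in> \<Union>M" "x \<in> V" "y \<in> V"
  using th arc_betweenD(1,2) unfolding theta_def by metis+

abbreviation disk :: "complex set set \<Rightarrow> complex set" where
  "disk Z \<equiv> \<Union>Z \<union> inside (\<Union>Z)"

lemma theta_Un: "disk (X \<union> Y) = disk (X \<union> M) \<union> disk (Y \<union> M)"
proof -
  have "{x, y} \<subseteq> \<Union>X" using theta_ends by blast
  then show ?thesis unfolding theta_inside(2)[symmetric] by blast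
qed

text \<open>The half disks share exactly the cutting path. Hence the vertices and edges of the path
  are counted twice when the pieces are added, and faces are counted once.\<close>

lemma theta_Int: "disk (X \<union> M) \<inter> disk (Y \<union> M) = \<Union>M"
proof
  have 1: "\<Union>X \<inter> inside (\<Union>(Y \<union> M)) = {}"
    using theta_inside(2) inside_no_overlap[of "\<Union>(X \<union> Y)"] by blast
  have 2: "\<Union>Y \<inter> inside (\<Union>(X \<union> M)) = {}"
    using theta_inside(2) inside_no_overlap[of "\<Union>(X \<union> Y)"] by blast
  have 3: "\<Union>M \<inter> inside (\<Union>(X \<union> M)) = {}" "\<Union>M \<inter> inside (\<Union>(Y \<union> M)) = {}"
    using inside_no_overlap[of "\<Union>(X \<union> M)"] inside_no_overlap[of "\<Union>(Y \<union> M)"] by blast+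
  have 4: "\<Union>X \<inter> \<Union>Y \<subseteq> \<Union>M" using th theta_ends unfolding theta_def by blast
  show "disk (X \<union> M) \<inter> disk (Y \<union> M) \<subseteq> \<Union>M"
  proof
    fix z assume z: "z \<in> disk (X \<union> M) \<inter> disk (Y \<union> M)"
    show "z \<in> \<Union>M"
    proof (rule ccontr)
      assume n: "z \<notin> \<Union>M"
      then have "z \<in> \<Union>X \<or> z \<in> inside (\<Union>(X \<union> M))" "z \<in> \<Union>Y \<or> z \<in> inside (\<Union>(Y \<union> M))" using z by auto
      then show False using 1 2 4 n theta_inside(1) by blast
    qed
  qed
qed blast

lemma theta_DV: "DV (X \<union> Y) = DV (X \<union> M) \<union> DV (Y \<union> M)" "DV (X \<union> M) \<inter> DV (Y \<union> M) = V \<inter> \<Union>M"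
proof -
  show "DV (X \<union> Y) = DV (X \<union> M) \<union> DV (Y \<union> M)"
    unfolding DV_def theta_Un by (rule Int_Un_distrib)
  have "DV (X \<union> M) \<inter> DV (Y \<union> M) = V \<inter> (disk (X \<union> M) \<inter> disk (Y \<union> M))" unfolding DV_def by blast
  then show "DV (X \<union> M) \<inter> DV (Y \<union> M) = V \<inter> \<Union>M" unfolding theta_Int .
qed

lemma theta_DE: "DE (X \<union> Y) = DE (X \<union> M) \<union> DE (Y \<union> M)" "DE (X \<union> M) \<inter> DE (Y \<union> M) = M"
proof -
  have sub: "X \<subseteq> E" "Y \<subseteq> E" "M \<subseteq> E" using th unfolding theta_def by auto
  show "DE (X \<union> M) \<inter> DE (Y \<union> M) = M"
  proof
    show "DE (X \<union> M) \<inter> DE (Y \<union> M) \<subseteq> M"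
    proof
      fix e assume "e \<in> DE (X \<union> M) \<inter> DE (Y \<union> M)"
      then have "e \<in> E" "e \<subseteq> disk (X \<union> M) \<inter> disk (Y \<union> M)" unfolding DE_def by auto
      then show "e \<in> M" using edge_subset_Union[OF sub(3)] unfolding theta_Int by blast
    qed
    show "M \<subseteq> DE (X \<union> M) \<inter> DE (Y \<union> M)" unfolding DE_def using sub by blast
  qed
  show "DE (X \<union> Y) = DE (X \<union> M) \<union> DE (Y \<union> M)"
  proof
    show "DE (X \<union> M) \<union> DE (Y \<union> M) \<subseteq> DE (X \<union> Y)" unfolding DE_def theta_Un by blast
    show "DE (X \<union> Y) \<subseteq> DE (X \<union> M) \<union> DE (Y \<union> M)"
    proof
      fix e assume e: "e \<in> DE (X \<union> Y)"
      then have eE: "e \<in> E" unfolding DE_def by blast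
      show "e \<in> DE (X \<union> M) \<union> DE (Y \<union> M)"
      proof (cases "e \<in> X \<union> Y \<union> M")
        case True
        then show ?thesis unfolding DE_def using eE by blast
      next
        case False
        then have n: "e - V \<subseteq> inside (\<Union>(X \<union> Y))" using DE_iff[OF theta_jcurve(1) eE] e by blast
        have s: "e - V \<subseteq> inside (\<Union>(X \<union> M)) \<or> e - V \<subseteq> outside (\<Union>(X \<union> M))"
          "e - V \<subseteq> inside (\<Union>(Y \<union> M)) \<or> e - V \<subseteq> outside (\<Union>(Y \<union> M))"
          using edge_side[OF theta_jcurve(2) eE] edge_side[OF theta_jcurve(3) eE] False by blast+
        obtain p where p: "p \<in> e - V" using edge_inner(2)[OF eE] by blast
        have "(e - V) \<inter> \<Union>M = {}" using edge_Int_curve[OF sub(3) eE] False by blast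
        then have "p \<in> inside (\<Union>(X \<union> M)) \<or> p \<in> inside (\<Union>(Y \<union> M))"
          using p n theta_inside(2) by blast
        then have "e - V \<subseteq> inside (\<Union>(X \<union> M)) \<or> e - V \<subseteq> inside (\<Union>(Y \<union> M))"
          using s p inside_Int_outside[of "\<Union>(X \<union> M)"] inside_Int_outside[of "\<Union>(Y \<union> M)"] by blast
        then show ?thesis
          using DE_iff[OF theta_jcurve(2) eE] DE_iff[OF theta_jcurve(3) eE] by blast
      qed
    qed
  qed
qed

lemma theta_DF: "DF (X \<union> Y) = DF (X \<union> M) \<union> DF (Y \<union> M)" "DF (X \<union> M) \<inter> DF (Y \<union> M) = {}"
proof -
  show "DF (X \<union> M) \<inter> DF (Y \<union> M) = {}"
      proof -
    have "F \<noteq> {}" if "F \<in> faces V E" for F using face(3) that by blast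
    then show ?thesis unfolding DF_def using theta_inside(1) by blast
  qed
  show "DF (X \<union> Y) = DF (X \<union> M) \<union> DF (Y \<union> M)"
  proof
    show "DF (X \<union> M) \<union> DF (Y \<union> M) \<subseteq> DF (X \<union> Y)" unfolding DF_def using theta_inside(2) by blast
    show "DF (X \<union> Y) \<subseteq> DF (X \<union> M) \<union> DF (Y \<union> M)"
    proof
      fix F assume "F \<in> DF (X \<union> Y)"
      then have F: "F \<in> faces V E" "F \<subseteq> inside (\<Union>(X \<union> Y))" unfolding DF_def by auto
      obtain p where p: "p \<in> F" using face(3)[OF F(1)] by blast
      have "M \<subseteq> E" using th unfolding theta_def by simp
      then have "F \<inter> \<Union>M = {}" using face(5)[OF F(1)] by blast
      then have "p \<in> inside (\<Union>(X \<union> M)) \<or> p \<in> inside (\<Union>(Y \<union> M))"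
        using p F(2) theta_inside(2) by blast
      then have "F \<subseteq> inside (\<Union>(X \<union> M)) \<or> F \<subseteq> inside (\<Union>(Y \<union> M))"
        using face_side[OF theta_jcurve(2) F(1)] face_side[OF theta_jcurve(3) F(1)] p
          inside_Int_outside[of "\<Union>(X \<union> M)"] inside_Int_outside[of "\<Union>(Y \<union> M)"] by blast
      then show "F \<in> DF (X \<union> M) \<union> DF (Y \<union> M)" unfolding DF_def using F(1) by blast
    qed
  qed
qed

end

section \<open>Cycles as vertex lists\<close>

fun pedges :: "complex list \<Rightarrow> complex set set" where
  "pedges (x # y # l) = insert (ed x y) (pedges (y # l))"
| "pedges _ = {}"

definition cedges :: "complex list \<Rightarrow> complex set set" where
  "cedges cs = pedges (cs @ [hd cs])"

definition Cyc :: "complex list \<Rightarrow> bool" where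
  "Cyc cs \<longleftrightarrow> length cs \<ge> 3 \<and> distinct cs \<and> successively nb (cs @ [hd cs])"

lemma pedges_append: "pedges (xs @ y # ys) = pedges (xs @ [y]) \<union> pedges (y # ys)"
proof (induction xs)
  case (Cons x xs)
  then show ?case by (cases xs) auto
qed simp

lemma pedges_rev: "pedges (rev xs) = pedges xs"
proof (induction xs rule: pedges.induct)
  case (1 x y l)
  have "pedges (rev (x # y # l)) = pedges (rev l @ [y]) \<union> pedges [y, x]"
    using pedges_append[of "rev l" y "[x]"] by simp
  then show ?case using 1 ed_commute[of x y] by simp
qed auto

lemma pedges_E: "successively nb xs \<Longrightarrow> pedges xs \<subseteq> E"
  by (induction xs rule: pedges.induct) (auto simp: ed)

lemma finite_pedges: "finite (pedges xs)"
  by (induction xs rule: pedges.induct) auto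

lemma pedges_V: "successively nb xs \<Longrightarrow> e \<in> pedges xs \<Longrightarrow> e \<inter> V \<subseteq> set xs"
proof (induction xs rule: pedges.induct)
  case (1 x y l)
  show ?case
  proof (cases "e = ed x y")
    case True
    then show ?thesis using ed(2)[of x y] 1(2) by simp
  qed (use 1 in auto)
qed auto

lemma Union_pedges_V: "successively nb xs \<Longrightarrow> length xs \<ge> 2 \<Longrightarrow> \<Union>(pedges xs) \<inter> V = set xs"
proof (induction xs rule: pedges.induct)
  case (1 x y l)
  have xy: "ed x y \<inter> V = {x, y}" using 1 ed(2) by auto
  show ?case
  proof (cases l)
    case Nil
    then show ?thesis using xy by simp
  next
    case (Cons z l')
    then have "\<Union>(pedges (y # l)) \<inter> V = set (y # l)" using 1 by simp
    then show ?thesis using xy by (simp add: Int_Un_distrib2 insert_commute)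
  qed
qed auto

lemma pedges_arc:
  "successively nb xs \<Longrightarrow> distinct xs \<Longrightarrow> length xs \<ge> 2 \<Longrightarrow> arc_between (\<Union>(pedges xs)) (hd xs) (last xs)"
proof (induction xs rule: pedges.induct)
  case (1 x y l)
  have xy: "nb x y" using 1 by auto
  show ?case
  proof (cases l)
    case Nil
    then show ?thesis using ed(3)[OF xy] by simp
  next
    case (Cons z l')
    have IH: "arc_between (\<Union>(pedges (y # l))) y (last (y # l))" using 1 Cons by simp
    have s: "successively nb (y # l)" using 1 by simp
    have "ed x y \<notin> pedges (y # l)"
      using pedges_V[OF s, of "ed x y"] ed(2)[OF xy] 1(3) by auto
    then have "ed x y \<inter> \<Union>(pedges (y # l)) \<subseteq> V"
      using edge_Int[OF ed(1)[OF xy]] pedges_E[OF s] by blast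
    moreover have "\<Union>(pedges (y # l)) \<inter> V = set (y # l)"
      by (rule Union_pedges_V[OF s]) (use Cons in simp)
    ultimately have "ed x y \<inter> \<Union>(pedges (y # l)) \<subseteq> (ed x y \<inter> V) \<inter> set (y # l)" by blast
    moreover have "x \<notin> set (y # l)" using 1(3) by simp
    ultimately have "ed x y \<inter> \<Union>(pedges (y # l)) \<subseteq> {y}" unfolding ed(2)[OF xy] by blast
    from arc_between_join[OF ed(3)[OF xy] IH this] show ?thesis by simp
  qed
qed auto

lemma card_pedges:
  "successively nb xs \<Longrightarrow> distinct xs \<Longrightarrow> card (pedges xs) = length xs - 1"
proof (induction xs rule: pedges.induct)
  case (1 x y l)
  have "ed x y \<notin> pedges (y # l)"
    using pedges_V[of "y # l" "ed x y"] ed(2)[of x y] 1(2,3) by auto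
  then show ?case using 1 finite_pedges by simp
qed auto

text \<open>Tells chords from cycle edges in \<open>disk_induct\<close>: only the first edge of the
  path contains \<open>x\<close>, and its other end is \<open>y\<close> only when nothing lies
  between.\<close>

lemma ed_in_pedges:
  assumes "successively nb (x # p @ [y])" "distinct (x # p @ [y])" "nb x y" "ed x y \<in> pedges (x # p @ [y])"
  shows "p = []"
proof (cases p)
  case (Cons a p')
  have s: "successively nb (a # p' @ [y])" "nb x a" using assms Cons by auto
  have "ed x y \<notin> pedges (a # p' @ [y])"
    using pedges_V[OF s(1), of "ed x y"] ed(2)[OF assms(3)] assms(2) Cons by auto
  then have "ed x y = ed x a" using assms(4) Cons by simp
  then have "y = a" using ed_eq_iff[OF assms(3) s(2)] by (auto simp: doubleton_eq_iff)
  then show ?thesis using assms(2) Cons by simp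
qed simp

text \<open>A shared edge would have both ends among the common vertices \<open>x\<close> and
  \<open>y\<close>, so each path would be the single edge between them, which the last assumption
  excludes.\<close>

lemma pedges_Int:
  assumes p: "successively nb (x # p @ [y])" "distinct (x # p @ [y])"
    and m: "successively nb (x # m @ [y])" "distinct (x # m @ [y])"
    and d: "set p \<inter> set m = {}" "p \<noteq> [] \<or> m \<noteq> []"
  shows "\<Union>(pedges (x # p @ [y])) \<inter> \<Union>(pedges (x # m @ [y])) \<subseteq> {x, y}"
proof -
  have i: "set (x # p @ [y]) \<inter> set (x # m @ [y]) = {x, y}" using d p(2) m(2) by auto
  have "pedges (x # p @ [y]) \<inter> pedges (x # m @ [y]) = {}"
  proof (rule ccontr)
    assume "\<not> ?thesis"
    then obtain e where e: "e \<in> pedges (x # p @ [y])" "e \<in> pedges (x # m @ [y])" by blast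
    then obtain u w where uw: "nb u w" "e = ed u w" using edge_cases pedges_E[OF p(1)] by blast
    have "e \<inter> V \<subseteq> {x, y}" using pedges_V[OF p(1) e(1)] pedges_V[OF m(1) e(2)] i by blast
    then have "{u, w} \<subseteq> {x, y}" "u \<noteq> w" using ed(2,4)[OF uw(1)] uw(2) by auto
    then have "{u, w} = {x, y}" by blast
    then have "nb x y" "e = ed x y" using uw nb_sym ed_commute by (metis doubleton_eq_iff)+
    then show False using ed_in_pedges[OF p] ed_in_pedges[OF m] e d(2) by blast
  qed
  then have "\<Union>(pedges (x # p @ [y])) \<inter> \<Union>(pedges (x # m @ [y])) \<subseteq> V"
    using edge_Int pedges_E[OF p(1)] pedges_E[OF m(1)] by blast
  moreover have v: "\<Union>(pedges (x # p @ [y])) \<inter> V = set (x # p @ [y])" "\<Union>(pedges (x # m @ [y])) \<inter> V = set (x # m @ [y])"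
    using Union_pedges_V p(1) m(1) by simp_all
  ultimately show ?thesis unfolding i[symmetric] v[symmetric] by blast
qed

lemma successively_rev_nb: "successively nb (rev xs) = successively nb xs"
proof -
  have "successively nb (rev xs) = successively (\<lambda>x y. nb y x) xs" by (rule successively_rev)
  also have "\<dots> = successively nb xs" using nb_sym by (intro successively_cong) auto
  finally show ?thesis .
qed

text \<open>Both arcs run from \<open>x\<close> to \<open>y\<close>, as a theta curve wants them.
  This is the origin of the reversed \<open>q\<close> here and of \<open>rev m\<close> in the cut
  cycles below.\<close>

lemma cedges_split: "cedges (x # p @ y # q) = pedges (x # p @ [y]) \<union> pedges (x # rev q @ [y])"
proof -
  have "cedges (x # p @ y # q) = pedges ((x # p) @ y # (q @ [x]))" by (simp add: cedges_def)
  also have "\<dots> = pedges ((x # p) @ [y]) \<union> pedges (y # q @ [x])" by (rule pedges_append)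
  also have "pedges (y # q @ [x]) = pedges (x # rev q @ [y])"
    using pedges_rev[of "y # q @ [x]"] by simp
  finally show ?thesis by simp
qed

lemma successively_split: "successively P (xs @ y # ys) \<longleftrightarrow> successively P (xs @ [y]) \<and> successively P (y # ys)"
  by (auto simp: successively_append_iff)

lemma Cyc_split:
  "Cyc (x # p @ y # q) \<longleftrightarrow> successively nb (x # p @ [y]) \<and> successively nb (x # rev q @ [y]) \<and>
     distinct (x # p @ y # q) \<and> (p \<noteq> [] \<or> q \<noteq> [])"
proof -
  have "successively nb ((x # p) @ y # (q @ [x])) \<longleftrightarrow>
      successively nb ((x # p) @ [y]) \<and> successively nb (y # q @ [x])" by (rule successively_split)
  moreover have "successively nb (y # q @ [x]) = successively nb (x # rev q @ [y])"
    using successively_rev_nb[of "y # q @ [x]"] by simp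
  moreover have "length (x # p @ y # q) \<ge> 3 \<longleftrightarrow> p \<noteq> [] \<or> q \<noteq> []" by (cases p; cases q) auto
  ultimately show ?thesis unfolding Cyc_def by auto
qed

lemma Cyc_rotate: "Cyc (x # xs) \<longleftrightarrow> Cyc (xs @ [x])"
  and cedges_rotate: "Cyc (x # xs) \<Longrightarrow> cedges (xs @ [x]) = cedges (x # xs)"
proof -
  show "Cyc (x # xs) \<longleftrightarrow> Cyc (xs @ [x])"
    by (cases xs) (auto simp: Cyc_def successively_append_iff successively_Cons hd_append)
  assume "Cyc (x # xs)"
  then obtain y ys where xs: "xs = y # ys" unfolding Cyc_def by (cases xs) auto
  show "cedges (xs @ [x]) = cedges (x # xs)"
    unfolding cedges_def xs using pedges_append[of "y # ys" x "[y]"] by auto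
qed

lemma Cyc_jcurve: "Cyc cs \<Longrightarrow> jcurve (cedges cs)"
proof -
  assume c: "Cyc cs"
  then obtain x y q where cs: "cs = x # [] @ y # q" unfolding Cyc_def
    by (cases cs; cases "tl cs") auto
  note c' = c[unfolded cs Cyc_split]
  have "arc_between (\<Union>(pedges (x # [] @ [y]))) x y" "arc_between (\<Union>(pedges (x # rev q @ [y]))) x y"
    using pedges_arc[of "x # [] @ [y]"] pedges_arc[of "x # rev q @ [y]"] c' by simp_all
  moreover have "\<Union>(pedges (x # [] @ [y])) \<inter> \<Union>(pedges (x # rev q @ [y])) \<subseteq> {x, y}"
    using c' by (intro pedges_Int) auto
  moreover have "pedges (x # [] @ [y]) \<subseteq> E" "pedges (x # rev q @ [y]) \<subseteq> E"
    using pedges_E c' by blast+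
  ultimately show ?thesis unfolding cs cedges_split by (intro jcurve_arcs)
qed

lemma theta_paths:
  assumes p: "successively nb (x # p @ [y])" and q: "successively nb (x # q @ [y])"
    and m: "successively nb (x # m @ [y])" and d: "distinct (x # p @ m @ q @ [y])"
    and ne: "p \<noteq> [] \<or> q \<noteq> []" "p \<noteq> [] \<or> m \<noteq> []" "q \<noteq> [] \<or> m \<noteq> []"
    and i: "\<Union>(pedges (x # m @ [y])) \<inter> inside (\<Union>(pedges (x # p @ [y]) \<union> pedges (x # q @ [y]))) \<noteq> {}"
  shows "theta (pedges (x # p @ [y])) (pedges (x # q @ [y])) (pedges (x # m @ [y])) x y"
proof -
  have dd: "distinct (x # p @ [y])" "distinct (x # q @ [y])" "distinct (x # m @ [y])"
    "set p \<inter> set q = {}" "set p \<inter> set m = {}" "set q \<inter> set m = {}" using d by auto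
  have "x \<in> V" "y \<in> V"
    using Union_pedges_V[OF m] by auto
  then show ?thesis unfolding theta_def
    using pedges_E[OF p] pedges_E[OF q] pedges_E[OF m] pedges_arc[OF p dd(1)] pedges_arc[OF q dd(2)]
      pedges_arc[OF m dd(3)] pedges_Int[OF p dd(1) q dd(2) dd(4) ne(1)] pedges_Int[OF p dd(1) m dd(3) dd(5) ne(2)]
      pedges_Int[OF q dd(2) m dd(3) dd(6) ne(3)] i by (simp add: Union_Un_distrib)
qed

section \<open>Induction over disks and Euler's formula\<close>

lemma Cyc_DF_nonempty: "Cyc cs \<Longrightarrow> DF (cedges cs) \<noteq> {}"
proof -
  assume c: "Cyc cs"
  then obtain x y q where cs: "cs = x # y # q" unfolding Cyc_def by (cases cs; cases "tl cs") auto
  have "nb x y" "ed x y \<in> cedges cs" using c unfolding cs Cyc_def cedges_def by auto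
  from T_side_curve(1)[OF Cyc_jcurve[OF c] this] T_D(4) show ?thesis unfolding DF_def by blast
qed

lemma cedges_V: "Cyc cs \<Longrightarrow> e \<in> cedges cs \<Longrightarrow> e \<inter> V \<subseteq> set cs"
  using pedges_V[of "cs @ [hd cs]" e] unfolding Cyc_def cedges_def by (cases cs) auto

text \<open>Induction on the number of faces inside. Let \<open>w\<close> be the apex of the inner
  triangle on the first edge \<open>a b\<close>. If \<open>w\<close> is off the cycle, cut along
  \<open>a w b\<close>; if it is on the cycle and one of \<open>a w\<close>, \<open>b w\<close> is a
  chord, cut along the chord; otherwise the cycle is the triangle. Each piece contains a face, so
  both pieces are smaller.\<close>

lemma disk_induct [consumes 1, case_names triangle rotate split]:
  assumes "Cyc cs"
    and tri: "\<And>a b c. T a b c \<Longrightarrow> P [a, b, c]"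
    and rot: "\<And>x xs. Cyc (x # xs) \<Longrightarrow> P (xs @ [x]) \<Longrightarrow> P (x # xs)"
    and split: "\<And>x p y q m. Cyc (x # p @ y # q) \<Longrightarrow> Cyc (x # p @ y # rev m) \<Longrightarrow> Cyc (x # m @ y # q) \<Longrightarrow>
      successively nb (x # m @ [y]) \<Longrightarrow> distinct (x # m @ [y]) \<Longrightarrow>
      theta (pedges (x # p @ [y])) (pedges (x # rev q @ [y])) (pedges (x # m @ [y])) x y \<Longrightarrow>
      P (x # p @ y # rev m) \<Longrightarrow> P (x # m @ y # q) \<Longrightarrow> P (x # p @ y # q)"
  shows "P cs"
  using assms(1)
proof (induction "card (DF (cedges cs))" arbitrary: cs rule: less_induct)
  case less
  have SPLIT: "P (x # p @ y # q)"
    if C: "Cyc (x # p @ y # q)" and eq: "cedges (x # p @ y # q) = cedges cs"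
      and m: "successively nb (x # m @ [y])" and d: "distinct (x # p @ m @ q @ [y])"
      and ne: "p \<noteq> [] \<or> m \<noteq> []" "q \<noteq> [] \<or> m \<noteq> []"
      and i: "\<Union>(pedges (x # m @ [y])) \<inter> inside (\<Union>(cedges cs)) \<noteq> {}" for x p y q m
  proof -
    note C' = C[unfolded Cyc_split]
    have th: "theta (pedges (x # p @ [y])) (pedges (x # rev q @ [y])) (pedges (x # m @ [y])) x y"
      using C' m d ne i[folded eq, unfolded cedges_split] by (intro theta_paths) auto
    have C1: "Cyc (x # p @ y # rev m)" unfolding Cyc_split using C' m d ne by auto
    have C2: "Cyc (x # m @ y # q)" unfolding Cyc_split using C' m d ne by auto
    have e1: "cedges (x # p @ y # rev m) = pedges (x # p @ [y]) \<union> pedges (x # m @ [y])"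
      unfolding cedges_split by simp
    have e2: "cedges (x # m @ y # q) = pedges (x # rev q @ [y]) \<union> pedges (x # m @ [y])"
      unfolding cedges_split by blast
    have U: "DF (cedges cs) = DF (cedges (x # p @ y # rev m)) \<union> DF (cedges (x # m @ y # q))"
      unfolding eq[symmetric] e1 e2 unfolding cedges_split by (rule theta_DF(1)[OF th])
    have I: "DF (cedges (x # p @ y # rev m)) \<inter> DF (cedges (x # m @ y # q)) = {}"
      unfolding e1 e2 by (rule theta_DF(2)[OF th])
    have "card (DF (cedges cs)) = card (DF (cedges (x # p @ y # rev m))) + card (DF (cedges (x # m @ y # q)))"
      unfolding U by (rule card_Un_disjoint[OF finite_DF[OF Cyc_jcurve[OF C1]] finite_DF[OF Cyc_jcurve[OF C2]] I])
    moreover have "card (DF (cedges (x # p @ y # rev m))) > 0" "card (DF (cedges (x # m @ y # q))) > 0"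
      using Cyc_DF_nonempty[OF C1] Cyc_DF_nonempty[OF C2] finite_DF[OF Cyc_jcurve[OF C1]]
        finite_DF[OF Cyc_jcurve[OF C2]] by (simp_all add: card_gt_0_iff)
    ultimately have "P (x # p @ y # rev m)" "P (x # m @ y # q)" using less(1) C1 C2 by simp_all
    then show ?thesis using split[OF C C1 C2 m _ th] d by simp
  qed
  note J = Cyc_jcurve[OF less(2)]
  obtain a b rest where cs: "cs = a # b # rest" and rne: "rest \<noteq> []"
    using less(2) unfolding Cyc_def by (cases cs; cases "tl cs"; cases "tl (tl cs)") auto
  have dis: "distinct (a # b # rest)" using less(2) cs unfolding Cyc_def by simp
  have ab: "nb a b" "ed a b \<in> cedges cs" using less(2) unfolding cs Cyc_def cedges_def by auto
  obtain w where w: "T a b w" "inside (tri a b w) \<subseteq> inside (\<Union>(cedges cs))"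
    using T_side_curve(1)[OF J ab] by blast
  have nw: "nb a w" "nb b w" "w \<noteq> a" "w \<noteq> b" using T_D[OF w(1)] by auto
  have inner: "ed s t \<inter> inside (\<Union>(cedges cs)) \<noteq> {}"
    if "T s t u" "tri s t u = tri a b w" "ed s t \<notin> cedges cs" for s t u
  proof -
    have "ed s t - V \<subseteq> inside (\<Union>(cedges cs))" using T_side_inside[OF J that(1,3)] w(2) that(2) by simp
    then show ?thesis using edge_inner(2)[OF ed(1)[OF T_D(1)[OF that(1)]]] by blast
  qed
  have Ts: "T a w b" "tri a w b = tri a b w" "T b w a" "tri b w a = tri a b w"
    using w(1) T_sym tri_sym by metis+
  show ?case
  proof (cases "w \<in> set cs")
    case False
    have n: "ed a w \<notin> cedges cs"
      using cedges_V[OF less(2), of "ed a w"] ed(2)[OF nw(1)] False by blast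
    have "P (a # [] @ b # rest)"
    proof (rule SPLIT[where m = "[w]"])
      show "\<Union>(pedges (a # [w] @ [b])) \<inter> inside (\<Union>(cedges cs)) \<noteq> {}"
        using inner[OF Ts(1,2) n] by auto
    qed (use less(2) cs nw nb_sym dis False rne in auto)
    then show ?thesis using cs by simp
  next
    case True
    then obtain p q where rest: "rest = p @ w # q" using cs nw(3,4) by (metis set_ConsD split_list)
    have rcs: "Cyc (b # p @ w # q @ [a])" "cedges (b # p @ w # q @ [a]) = cedges cs"
      using less(2) Cyc_rotate[of a "b # rest"] cedges_rotate[of a "b # rest"] unfolding cs rest by simp_all
    have Ca: "Cyc (a # (b # p) @ w # q)" using less(2) cs rest by simp
    show ?thesis
    proof (cases "ed a w \<in> cedges cs")
      case n: False
      have "q \<noteq> []"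
      proof
        assume "q = []"
        then have "ed w a \<in> cedges cs"
          unfolding cs rest cedges_def using pedges_append[of "a # b # p" w "[a]"] by simp
        then show False using n ed_commute by metis
      qed
      then have "P (a # (b # p) @ w # q)"
        using inner[OF Ts(1,2) n] Ca cs rest dis nw by (intro SPLIT[where m = "[]"]) auto
      then show ?thesis using cs rest by simp
    next
      case y: True
      show ?thesis
      proof (cases "ed b w \<in> cedges cs")
        case n: False
        have "p \<noteq> []"
        proof
          assume "p = []"
          then have "ed b w \<in> cedges cs" unfolding cs rest cedges_def by simp
          then show False using n by metis
        qed
        \<comment> \<open>A chord at \<open>b\<close> needs the cycle listed from \<open>b\<close>;
          the rotation case of the induction leads back to the list from \<open>a\<close>.\<close>
        then have "P (b # p @ w # (q @ [a]))"
          using inner[OF Ts(3,4) n] rcs dis nw rest by (intro SPLIT[where m = "[]"]) auto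
        then have "P ((b # rest) @ [a])" using rest by simp
        then show ?thesis using rot[of a "b # rest"] less(2) cs by blast
      next
        case y': True
        note C1 = Ca[unfolded Cyc_split] and C2 = rcs(1)[unfolded Cyc_split]
        \<comment> \<open>Both remaining sides are cycle edges. As each joins the ends of an arc of
          the cycle, that arc has no further vertices, so \<open>q\<close> and \<open>p\<close> are
          empty.\<close>
        have "ed a w \<notin> pedges (a # (b # p) @ [w])"
          using ed_in_pedges[of a "b # p" w] C1 nw(1) by auto
        then have "ed a w \<in> pedges (a # rev q @ [w])"
          using y cedges_split[of a "b # p" w q] cs rest by auto
        then have "rev q = []" using C1 nw(1) by (intro ed_in_pedges) auto
        moreover have "ed b w \<notin> pedges (b # rev (q @ [a]) @ [w])"
          using ed_in_pedges[of b "rev (q @ [a])" w] C2 nw(2) by auto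
        then have "ed b w \<in> pedges (b # p @ [w])"
          using y' cedges_split[of b p w "q @ [a]"] rcs(2) by auto
        then have "p = []" using C2 nw(2) by (intro ed_in_pedges) auto
        ultimately show ?thesis using tri[OF w(1)] cs rest by simp
      qed
    qed
  qed
qed

lemma triangle_disk:
  assumes "T a b c"
  shows "\<Union>(cedges [a, b, c]) = tri a b c" "DV (cedges [a, b, c]) = {a, b, c}"
    "DE (cedges [a, b, c]) = {ed a b, ed b c, ed a c}" "DF (cedges [a, b, c]) = {inside (tri a b c)}"
proof -
  note nbs = T_D(1-3)[OF assms]
  have ce: "cedges [a, b, c] = {ed a b, ed b c, ed a c}"
    unfolding cedges_def using ed_commute[of a c] by auto
  show U: "\<Union>(cedges [a, b, c]) = tri a b c" unfolding ce tri_def by auto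
  have F: "inside (tri a b c) \<in> faces V E" using T_D(4)[OF assms] .
  have "V \<inter> inside (tri a b c) = {}" using face(4)[OF F] by blast
  then show "DV (cedges [a, b, c]) = {a, b, c}" unfolding DV_def U using tri_V[OF nbs] by blast
  have sub: "cedges [a, b, c] \<subseteq> E" unfolding ce using nbs ed(1) by simp
  have "e \<in> cedges [a, b, c]" if "e \<in> E" "e \<subseteq> tri a b c \<union> inside (tri a b c)" for e
    using edge_subset_Union[OF sub that(1)] face(5)[OF F that(1)] that(2) unfolding U by blast
  then have "DE (cedges [a, b, c]) = cedges [a, b, c]"
    unfolding DE_def U using sub U by blast
  then show "DE (cedges [a, b, c]) = {ed a b, ed b c, ed a c}" unfolding ce .
  have "G = inside (tri a b c)" if "G \<in> faces V E" "G \<subseteq> inside (tri a b c)" for G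
    using faces_disjoint[OF that(1) F] that(2) face(3)[OF that(1)] by blast
  then show "DF (cedges [a, b, c]) = {inside (tri a b c)}" unfolding DF_def U using F by blast
qed

text \<open>The second equation counts sides of faces, two for an inner edge and one for a boundary
  edge. Under a cut along \<open>m\<close> the path has \<open>length m + 2\<close> vertices and
  \<open>length m + 1\<close> edges; the difference of one absorbs the extra constant in the first
  equation, and in the second the two boundaries together exceed the old one by twice the
  path.\<close>

lemma euler_disk:
  assumes "Cyc cs"
  shows "card (DV (cedges cs)) + card (DF (cedges cs)) = card (DE (cedges cs)) + 1 \<and>
    3 * card (DF (cedges cs)) + length cs = 2 * card (DE (cedges cs))"
  using assms
proof (induction rule: disk_induct)
  case (triangle a b c)
  note ne = T_D(5-7)[OF triangle] and nbs = T_D(1-3)[OF triangle]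
  have "ed a b \<noteq> ed b c" "ed a b \<noteq> ed a c" "ed b c \<noteq> ed a c"
    using ed_eq_iff[OF nbs(1,2)] ed_eq_iff[OF nbs(1,3)] ed_eq_iff[OF nbs(2,3)] ne
    by (auto simp: doubleton_eq_iff)
  then show ?case unfolding triangle_disk[OF triangle] using ne by simp
next
  case (rotate x xs)
  then show ?case using cedges_rotate[of x xs] by simp
next
  case (split x p y q m)
  note th = split(6)
  have e0: "cedges (x # p @ y # q) = pedges (x # p @ [y]) \<union> pedges (x # rev q @ [y])"
    by (rule cedges_split)
  have e1: "cedges (x # p @ y # rev m) = pedges (x # p @ [y]) \<union> pedges (x # m @ [y])"
    unfolding cedges_split by simp
  have e2: "cedges (x # m @ y # q) = pedges (x # rev q @ [y]) \<union> pedges (x # m @ [y])"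
    unfolding cedges_split by blast
  note J1 = Cyc_jcurve[OF split(2)] and J2 = Cyc_jcurve[OF split(3)]
  have "V \<inter> \<Union>(pedges (x # m @ [y])) = set (x # m @ [y])" using Union_pedges_V[OF split(4)] by auto
  then have cV: "card (V \<inter> \<Union>(pedges (x # m @ [y]))) = length m + 2"
    using distinct_card[OF split(5)] by simp
  have cE: "card (pedges (x # m @ [y])) = length m + 1" using card_pedges[OF split(4,5)] by simp
  have v: "card (DV (cedges (x # p @ y # q))) + (length m + 2) =
      card (DV (cedges (x # p @ y # rev m))) + card (DV (cedges (x # m @ y # q)))"
    using card_Un_Int[OF finite_DV[OF J1] finite_DV[OF J2]] theta_DV[OF th] cV unfolding e0 e1 e2 by simp
  have e: "card (DE (cedges (x # p @ y # q))) + (length m + 1) =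
      card (DE (cedges (x # p @ y # rev m))) + card (DE (cedges (x # m @ y # q)))"
    using card_Un_Int[OF finite_DE[OF J1] finite_DE[OF J2]] theta_DE[OF th] cE unfolding e0 e1 e2 by simp
  have f: "card (DF (cedges (x # p @ y # q))) =
      card (DF (cedges (x # p @ y # rev m))) + card (DF (cedges (x # m @ y # q)))"
    using card_Un_disjoint[OF finite_DF[OF J1] finite_DF[OF J2]] theta_DF[OF th] unfolding e0 e1 e2 by simp
  show ?case using v e f split(7,8) by simp
qed

definition dadj :: "complex set set \<Rightarrow> complex \<Rightarrow> complex \<Rightarrow> bool" where
  "dadj X u w \<longleftrightarrow> nb u w \<and> ed u w \<in> DE X"

text \<open>Both pieces of a cut disk contain the end \<open>x\<close> of the cutting path.
  Connectedness by edges of the disk itself is what makes the abstract complex connected at its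
  core.\<close>

lemma disk_connected:
  assumes "Cyc cs" "u \<in> DV (cedges cs)" "w \<in> DV (cedges cs)"
  shows "(dadj (cedges cs))\<^sup>*\<^sup>* u w"
  using assms
proof (induction arbitrary: u w rule: disk_induct)
  case (triangle a b c)
  have "dadj (cedges [a, b, c]) s t" if "s \<in> {a, b, c}" "t \<in> {a, b, c}" "s \<noteq> t" for s t
    unfolding dadj_def triangle_disk[OF triangle(1)]
    using that T_D(1-3)[OF triangle(1)] nb_sym ed_commute by blast
  then show ?case using triangle(2,3) unfolding triangle_disk[OF triangle(1)]
    by (metis r_into_rtranclp rtranclp.rtrancl_refl)
next
  case (rotate x xs)
  then show ?case using cedges_rotate[of x xs] by simp
next
  case (split x p y q m)
  note th = split(6)
  have e0: "cedges (x # p @ y # q) = pedges (x # p @ [y]) \<union> pedges (x # rev q @ [y])"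
    by (rule cedges_split)
  have e1: "cedges (x # p @ y # rev m) = pedges (x # p @ [y]) \<union> pedges (x # m @ [y])"
    unfolding cedges_split by simp
  have e2: "cedges (x # m @ y # q) = pedges (x # rev q @ [y]) \<union> pedges (x # m @ [y])"
    unfolding cedges_split by blast
  let ?R = "dadj (cedges (x # p @ y # q))"
  have sub: "DE (cedges (x # p @ y # rev m)) \<subseteq> DE (cedges (x # p @ y # q))"
    "DE (cedges (x # m @ y # q)) \<subseteq> DE (cedges (x # p @ y # q))"
    unfolding e0 e1 e2 theta_DE(1)[OF th] by auto
  have "dadj (cedges (x # p @ y # rev m)) \<le> ?R" "dadj (cedges (x # m @ y # q)) \<le> ?R"
    unfolding dadj_def using sub by blast+
  then have m: "(dadj (cedges (x # p @ y # rev m)))\<^sup>*\<^sup>* \<le> ?R\<^sup>*\<^sup>*" "(dadj (cedges (x # m @ y # q)))\<^sup>*\<^sup>* \<le> ?R\<^sup>*\<^sup>*"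
    by (simp_all add: rtranclp_mono)
  have c1: "?R\<^sup>*\<^sup>* s t" if "s \<in> DV (cedges (x # p @ y # rev m))" "t \<in> DV (cedges (x # p @ y # rev m))" for s t
    using split(7)[OF that] m(1) by blast
  have c2: "?R\<^sup>*\<^sup>* s t" if "s \<in> DV (cedges (x # m @ y # q))" "t \<in> DV (cedges (x # m @ y # q))" for s t
    using split(8)[OF that] m(2) by blast
  have "x \<in> V \<inter> \<Union>(pedges (x # m @ [y]))" using theta_ends[OF th] by blast
  then have x: "x \<in> DV (cedges (x # p @ y # rev m))" "x \<in> DV (cedges (x # m @ y # q))"
    using theta_DV(2)[OF th] unfolding e1 e2 by blast+
  have uw: "u \<in> DV (cedges (x # p @ y # rev m)) \<or> u \<in> DV (cedges (x # m @ y # q))"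
    "w \<in> DV (cedges (x # p @ y # rev m)) \<or> w \<in> DV (cedges (x # m @ y # q))"
    using split(9,10) theta_DV(1)[OF th] unfolding e0 e1 e2 by auto
  then have "?R\<^sup>*\<^sup>* u x" "?R\<^sup>*\<^sup>* x w" using c1 c2 x by blast+
  then show ?case by (rule rtranclp_trans)
qed

section \<open>Agreement with the given notions of cycle and disk\<close>

lemma pedges_conv: "pedges xs = {ed (xs ! i) (xs ! Suc i) |i. Suc i < length xs}"
proof (induction xs rule: pedges.induct)
  case (1 x y l)
  have "{ed ((x # y # l) ! i) ((x # y # l) ! Suc i) |i. Suc i < length (x # y # l)} =
    insert (ed x y) {ed ((y # l) ! i) ((y # l) ! Suc i) |i. Suc i < length (y # l)}" (is "?A = ?B")
  proof
    show "?A \<subseteq> ?B"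
    proof
      fix e assume "e \<in> ?A"
      then obtain i where "e = ed ((x # y # l) ! i) ((x # y # l) ! Suc i)" "Suc i < length (x # y # l)" by blast
      then show "e \<in> ?B" by (cases i) auto
    qed
    show "?B \<subseteq> ?A" by force
  qed
  then show ?case using 1 by simp
qed auto

lemma nth_closed:
  "i < length cs \<Longrightarrow> (cs @ [hd cs]) ! i = cs ! i"
  "i < length cs \<Longrightarrow> (cs @ [hd cs]) ! Suc i = cs ! ((i + 1) mod length cs)"
proof -
  assume i: "i < length cs"
  show "(cs @ [hd cs]) ! i = cs ! i" using i by (simp add: nth_append)
  have "cs \<noteq> []" using i by auto
  then show "(cs @ [hd cs]) ! Suc i = cs ! ((i + 1) mod length cs)"
    using i by (cases "Suc i = length cs") (auto simp: nth_append hd_conv_nth)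
qed

lemma simple_cycle_Cyc: "simple_cycle V E cs \<longleftrightarrow> Cyc cs"
proof -
  have "successively nb (cs @ [hd cs]) \<longleftrightarrow> (\<forall>i<length cs. nb (cs ! i) (cs ! ((i + 1) mod length cs)))"
    using nth_closed[of _ cs] by (simp add: successively_conv_nth)
  moreover have "set cs \<subseteq> V" if "\<forall>i<length cs. nb (cs ! i) (cs ! ((i + 1) mod length cs))"
    using that ed(5) by (metis in_set_conv_nth subsetI)
  ultimately show ?thesis unfolding simple_cycle_def Cyc_def by blast
qed

lemma cycle_edges_cedges: "Cyc cs \<Longrightarrow> cycle_edges V E cs = cedges cs"
proof -
  assume "Cyc cs"
  then have n: "nb (cs ! i) (cs ! ((i + 1) mod length cs))" if "i < length cs" for i
    using that simple_cycle_Cyc unfolding simple_cycle_def by blast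
  have "cedges cs = {ed (cs ! i) (cs ! ((i + 1) mod length cs)) |i. i < length cs}"
    unfolding cedges_def pedges_conv using nth_closed[of _ cs] by force
  also have "\<dots> = cycle_edges V E cs"
  proof
    show "{ed (cs ! i) (cs ! ((i + 1) mod length cs)) |i. i < length cs} \<subseteq> cycle_edges V E cs"
      unfolding cycle_edges_def using ed(1,2)[OF n] by blast
    show "cycle_edges V E cs \<subseteq> {ed (cs ! i) (cs ! ((i + 1) mod length cs)) |i. i < length cs}"
    proof
      fix e assume "e \<in> cycle_edges V E cs"
      then obtain i where "e \<in> E" "i < length cs" "e \<inter> V = {cs ! i, cs ! ((i + 1) mod length cs)}"
        unfolding cycle_edges_def by blast
      then show "e \<in> {ed (cs ! i) (cs ! ((i + 1) mod length cs)) |i. i < length cs}"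
        using edE(2) by blast
    qed
  qed
  finally show ?thesis by simp
qed

lemma comb_disk_eq: "Cyc cs \<Longrightarrow> comb_disk V E cs = (DV (cedges cs), DE (cedges cs))"
  unfolding comb_disk_def cycle_image_def DV_def DE_def Let_def using cycle_edges_cedges by simp

end

lemma successively_infix: "successively R (xs @ ys @ zs) \<Longrightarrow> successively R ys"
  by (auto simp: successively_append_iff)

section \<open>Links and coverings of triangulated surfaces\<close>

lemma successively_glue: "successively R (xs @ [y]) \<Longrightarrow> successively R (y # zs) \<Longrightarrow> successively R (xs @ y # zs)"
  by (auto simp: successively_append_iff)

text \<open>What the combinatorial half of the proof keeps of the plane. Without
  \<open>link_conn\<close> a link could be several disjoint cycles, that is, several cones pinched
  together at \<open>w\<close>.\<close>

locale triangulated_surface =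
  fixes r :: nat and A :: "'v \<Rightarrow> 'v \<Rightarrow> bool" and T :: "'v \<Rightarrow> 'v \<Rightarrow> 'v \<Rightarrow> bool"
  assumes r_pos: "r > 0"
    and T_swap: "T a b c \<Longrightarrow> T b a c" "T a b c \<Longrightarrow> T a c b"
    and T_A: "T a b c \<Longrightarrow> A a b"
    and A_sym: "A a b \<Longrightarrow> A b a"
    and A_irrefl: "\<not> A a a"
    and card_T: "A a b \<Longrightarrow> card {x. T a b x} = 2"
    and card_A: "A w u \<Longrightarrow> card {v. A w v} = r"
    and link_conn: "A w u \<Longrightarrow> A w v \<Longrightarrow> (T w)\<^sup>*\<^sup>* u v"
begin

lemma T_A2: "T a b c \<Longrightarrow> A a c" "T a b c \<Longrightarrow> A b c"
  using T_swap T_A by metis+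

lemma T_ne: "T a b c \<Longrightarrow> a \<noteq> b" "T a b c \<Longrightarrow> a \<noteq> c" "T a b c \<Longrightarrow> b \<noteq> c"
  using T_A T_A2 A_irrefl by metis+

lemma T_third: "T a b x \<Longrightarrow> T a b y \<Longrightarrow> x \<noteq> y \<Longrightarrow> T a b z \<Longrightarrow> z = x \<or> z = y"
proof (rule ccontr)
  assume T: "T a b x" "T a b y" "x \<noteq> y" "T a b z" "\<not> (z = x \<or> z = y)"
  have "{x, y, z} \<subseteq> {x. T a b x}" using T by blast
  moreover have c: "card {x. T a b x} = 2" using T card_T T_A by blast
  ultimately have "card {x, y, z} \<le> 2"
    by (metis card_mono card.infinite zero_neq_numeral)
  then show False using T by (auto simp: card_insert_if)
qed

lemma T_other: "T a b x \<Longrightarrow> \<exists>y. T a b y \<and> y \<noteq> x"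
proof (rule ccontr)
  assume T: "T a b x" "\<not> (\<exists>y. T a b y \<and> y \<noteq> x)"
  then have "{x. T a b x} = {x}" by blast
  then show False using card_T[OF T_A[OF T(1)]] by simp
qed

definition opp :: "'v \<Rightarrow> 'v \<Rightarrow> 'v \<Rightarrow> 'v" where
  "opp a b x = (SOME y. T a b y \<and> y \<noteq> x)"

lemma opp: "T a b x \<Longrightarrow> T a b (opp a b x)" "T a b x \<Longrightarrow> opp a b x \<noteq> x"
  unfolding opp_def using someI_ex[OF T_other] by blast+

lemma opp_eq: "T a b x \<Longrightarrow> T a b y \<Longrightarrow> y \<noteq> x \<Longrightarrow> y = opp a b x"
  using T_third opp by metis

text \<open>A walk around \<open>w\<close> that never turns back. Indexing by all integers avoids
  arithmetic at a seam; that the link is an \<open>r\<close>-cycle becomes a statement about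
  periods, see \<open>link_inj\<close>.\<close>

definition linkf :: "'v \<Rightarrow> (int \<Rightarrow> 'v) \<Rightarrow> bool" where
  "linkf w z \<longleftrightarrow> (\<forall>i. T w (z i) (z (i + 1)) \<and> z (i + 2) \<noteq> z i)"

lemma linkfD: "linkf w z \<Longrightarrow> T w (z i) (z (i + 1))" "linkf w z \<Longrightarrow> T w (z i) (z (i - 1))"
  "linkf w z \<Longrightarrow> z (i + 2) \<noteq> z i" "linkf w z \<Longrightarrow> A w (z i)" "linkf w z \<Longrightarrow> z (i + 1) \<noteq> z (i - 1)"
proof -
  assume z: "linkf w z"
  show "T w (z i) (z (i + 1))" "z (i + 2) \<noteq> z i" using z linkf_def by auto
  then show "A w (z i)" using T_A by blast
  have "T w (z (i - 1)) (z (i - 1 + 1))" "z (i - 1 + 2) \<noteq> z (i - 1)" using z unfolding linkf_def by blast+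
  moreover have "i - 1 + 1 = i" "i - 1 + 2 = i + 1" by simp_all
  ultimately show "T w (z i) (z (i - 1))" "z (i + 1) \<noteq> z (i - 1)" using T_swap(2) by metis+
qed

lemma link_nbr: "linkf w z \<Longrightarrow> T w (z i) x \<Longrightarrow> x = z (i + 1) \<or> x = z (i - 1)"
  using T_third linkfD(1,2,5) by blast

lemma link_shift: "linkf w z \<Longrightarrow> linkf w (\<lambda>i. z (i + k))"
  unfolding linkf_def
proof
  fix i assume a: "\<forall>i. T w (z i) (z (i + 1)) \<and> z (i + 2) \<noteq> z i"
  have "i + 1 + k = (i + k) + 1" "i + 2 + k = (i + k) + 2" by simp_all
  then show "T w (z (i + k)) (z (i + 1 + k)) \<and> z (i + 2 + k) \<noteq> z (i + k)" using a by metis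
qed

lemma link_reflect: "linkf w z \<Longrightarrow> linkf w (\<lambda>i. z (k - i))"
proof -
  assume z: "linkf w z"
  show ?thesis unfolding linkf_def
  proof
    fix i
    have "k - (i + 1) = (k - i) - 1" "k - i = (k - (i + 2)) + 2" by simp_all
    then show "T w (z (k - i)) (z (k - (i + 1))) \<and> z (k - (i + 2)) \<noteq> z (k - i)"
      using linkfD(2)[OF z, of "k - i"] linkfD(3)[OF z, of "k - (i + 2)"] by metis
  qed
qed

lemma link_unique0:
  assumes z: "linkf w z" and y: "linkf w y" and 0: "z 0 = y 0" "z 1 = y 1"
  shows "z k = y k"
proof -
  have up: "z (int n) = y (int n) \<and> z (int n + 1) = y (int n + 1)" for n
  proof (induction n)
    case (Suc n)
    have e: "int (Suc n) = int n + 1" "int (Suc n) + 1 = int n + 1 + 1" by simp_all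
    have "T w (z (int n + 1)) (y (int n + 1 + 1))" using linkfD(1)[OF y, of "int n + 1"] Suc by simp
    then have "y (int n + 1 + 1) = z (int n + 1 + 1) \<or> y (int n + 1 + 1) = z (int n)"
      using link_nbr[OF z, of "int n + 1"] by simp
    moreover have "y (int n + 1 + 1) \<noteq> z (int n)"
      using linkfD(3)[OF y, of "int n"] Suc by (simp add: algebra_simps)
    ultimately show ?case using Suc unfolding e by simp
  qed (use 0 in simp)
  have down: "z (- int n) = y (- int n) \<and> z (- int n + 1) = y (- int n + 1)" for n
  proof (induction n)
    case (Suc n)
    have e: "- int (Suc n) = - int n - 1" "- int (Suc n) + 1 = - int n" by simp_all
    have "T w (z (- int n)) (y (- int n - 1))" using linkfD(2)[OF y, of "- int n"] Suc by simp
    then have "y (- int n - 1) = z (- int n - 1) \<or> y (- int n - 1) = z (- int n + 1)"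
      using link_nbr[OF z, of "- int n"] by blast
    moreover have "y (- int n - 1) \<noteq> z (- int n + 1)"
      using linkfD(5)[OF y, of "- int n"] Suc by metis
    ultimately show ?case using Suc unfolding e by simp
  qed (use 0 in simp)
  show ?thesis
  proof (cases "k \<ge> 0")
    case True
    then show ?thesis using up[of "nat k"] by simp
  next
    case False
    then show ?thesis using down[of "nat (- k)"] by simp
  qed
qed

lemma link_unique:
  assumes z: "linkf w z" and y: "linkf w y" and 0: "z i = y j" "z (i + 1) = y (j + 1)"
  shows "z (i + k) = y (j + k)"
  using link_unique0[OF link_shift[OF z, of i] link_shift[OF y, of j], of k] 0 by (simp add: algebra_simps)

lemma link_unique_reflect:
  assumes z: "linkf w z" and y: "linkf w y" and 0: "z i = y j" "z (i + 1) = y (j - 1)"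
  shows "z (i + k) = y (j - k)"
  using link_unique[OF z link_reflect[OF y, of j], of i 0 k] 0 by simp

text \<open>A walk returning to a vertex leaves it either in the same direction as before or in the
  opposite one. In the second case uniqueness makes the walk symmetric about the midpoint of
  \<open>i\<close> and \<open>j\<close>, which is impossible for a walk that never turns.\<close>

lemma link_step:
  assumes z: "linkf w z" and ij: "z i = z j"
  shows "z (i + k) = z (j + k)"
proof -
  have "z (i + 1) \<noteq> z (j - 1)"
  proof
    assume a: "z (i + 1) = z (j - 1)"
    have fold: "z (i + k) = z (j - k)" for k using link_unique_reflect[OF z z ij a] .
    define d where "d = (j - i) div 2"
    \<comment> \<open>For an even distance the walk would turn back at the middle index; for an odd
      one the two middle vertices, which are adjacent, would coincide.\<close>
    have "j = i + 2 * d \<or> j = i + 2 * d + 1" unfolding d_def by presburger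
    then show False
    proof
      assume j: "j = i + 2 * d"
      have "z (i + d + 1) = z (i + d - 1)" using fold[of "d + 1"] j by (simp add: algebra_simps)
      then show False using linkfD(5)[OF z] by blast
    next
      assume j: "j = i + 2 * d + 1"
      have "z (i + d) = z (i + d + 1)" using fold[of d] j by (simp add: algebra_simps)
      then show False using linkfD(1)[OF z] T_ne(3) by metis
    qed
  qed
  moreover have "T w (z j) (z (i + 1))" using linkfD(1)[OF z, of i] ij by simp
  ultimately have "z (i + 1) = z (j + 1)" using link_nbr[OF z] by blast
  then show ?thesis using link_unique[OF z z ij] by blast
qed

lemma link_range: "linkf w z \<Longrightarrow> range z = {u. A w u}"
proof
  assume z: "linkf w z"
  show "range z \<subseteq> {u. A w u}" using linkfD(4)[OF z] by blast
  show "{u. A w u} \<subseteq> range z"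
  proof
    fix u assume "u \<in> {u. A w u}"
    then have "(T w)\<^sup>*\<^sup>* (z 0) u" using link_conn linkfD(4)[OF z] by blast
    then show "u \<in> range z"
    proof (induction)
      case (step y u)
      then show ?case using link_nbr[OF z] by blast
    qed simp
  qed
qed

text \<open>By \<open>link_step\<close> coincidences are governed by the least period. One period
  runs injectively through the range, which by connectedness of the link consists of all
  \<open>r\<close> neighbours, so the period is \<open>r\<close>.\<close>

lemma link_inj:
  assumes z: "linkf w z"
  shows "z i = z j \<longleftrightarrow> int r dvd i - j"
proof -
  define P where "P d \<longleftrightarrow> d > 0 \<and> z (int d) = z 0" for d :: nat
  have card: "card (range z) = r" unfolding link_range[OF z] by (rule card_A[OF linkfD(4)[OF z]])
  then have fin: "finite (range z)" using r_pos card_ge_0_finite by metis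
  have "\<exists>d. P d"
  proof -
    have "\<not> inj (\<lambda>n::nat. z (int n))"
      using fin finite_subset[of "range (\<lambda>n::nat. z (int n))" "range z"] finite_imageD by blast
    then obtain m n :: nat where mn: "m < n" "z (int m) = z (int n)"
      unfolding inj_def by (metis linorder_neqE_nat)
    have "z (int n + - int m) = z (int m + - int m)" using link_step[OF z, of "int n" "int m"] mn by metis
    then have "P (n - m)" unfolding P_def using mn by (simp add: of_nat_diff)
    then show ?thesis ..
  qed
  then obtain d where d: "P d" and least: "\<And>e. P e \<Longrightarrow> d \<le> e"
    by (metis LeastI_ex Least_le)
  have per: "z (k + int d) = z k" for k
    using link_step[OF z, of "int d" 0 k] d unfolding P_def by (simp add: add.commute)
  have permn: "z (k + int d * int n) = z k" for k n
  proof (induction n)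
    case (Suc n)
    have "k + int d * int (Suc n) = (k + int d * int n) + int d" by (simp add: algebra_simps)
    then show ?case using per Suc by metis
  qed simp
  have perm: "z (k + int d * m) = z k" for k m
  proof (cases "m \<ge> 0")
    case True
    then show ?thesis using permn[of k "nat m"] by simp
  next
    case False
    then show ?thesis using permn[of "k + int d * m" "nat (- m)"] by simp
  qed
  have modz: "z k = z (k mod int d)" for k
    using perm[of "k mod int d" "k div int d"] by (simp add: mult.commute)
  have iff: "z i = z j \<longleftrightarrow> int d dvd i - j" for i j
  proof
    assume "int d dvd i - j"
    then obtain m where "i = j + int d * m" by (metis dvd_def add.commute diff_add_cancel)
    then show "z i = z j" using perm by simp
  next
    assume ij: "z i = z j"
    have "z (i - j) = z 0" using link_step[OF z ij, of "- j"] by simp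
    then have e: "z ((i - j) mod int d) = z 0" using modz by metis
    have dpos: "int d > 0" using d P_def by simp
    show "int d dvd i - j"
    proof (rule ccontr)
      assume "\<not> int d dvd i - j"
      then have "(i - j) mod int d \<noteq> 0" by (simp add: dvd_eq_mod_eq_0)
      then have pos: "(i - j) mod int d > 0" using pos_mod_sign[OF dpos, of "i - j"] by linarith
      then have "P (nat ((i - j) mod int d))" unfolding P_def using e by simp
      then have "d \<le> nat ((i - j) mod int d)" using least by blast
      then show False using pos_mod_bound[OF dpos, of "i - j"] pos by linarith
    qed
  qed
  have dpos: "int d > 0" using d P_def by simp
  have "range z = z ` {0..<int d}"
  proof
    show "range z \<subseteq> z ` {0..<int d}"
    proof
      fix u assume "u \<in> range z"
      then obtain k where "u = z k" by blast
      then have "u = z (k mod int d)" using modz by metis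
      then show "u \<in> z ` {0..<int d}" using dpos by auto
    qed
  qed auto
  moreover have "inj_on z {0..<int d}"
  proof
    fix i j assume "i \<in> {0..<int d}" "j \<in> {0..<int d}" "z i = z j"
    then have "\<bar>i - j\<bar> < int d" "int d dvd i - j" using iff by auto
    then show "i = j" using zdvd_imp_le[of "int d" "\<bar>i - j\<bar>"] by force
  qed
  ultimately have "card (range z) = d" by (simp add: card_image)
  then show ?thesis using iff card by simp
qed

text \<open>The state of the walk is a directed edge of the link, because the next vertex depends on
  the last two. Moving on with \<open>opp\<close> is invertible, so the walk extends in both
  directions.\<close>

lemma link_ex:
  assumes "T w a b"
  shows "\<exists>z. linkf w z \<and> z 0 = a \<and> z 1 = b"
proof -
  define f where "f = (\<lambda>(a, b). (b, opp w b a))"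
  define g where "g = (\<lambda>(a, b). (opp w a b, a))"
  define S where "S = {(a, b). T w a b}"
  have S0: "(a, b) \<in> S" using assms S_def by simp
  have fS: "f s \<in> S" if s: "s \<in> S" for s
  proof -
    obtain x y where xy: "s = (x, y)" "T w x y" using s S_def by auto
    then show ?thesis using opp(1)[OF T_swap(2)[OF xy(2)]] by (simp add: f_def S_def)
  qed
  have gS: "g s \<in> S" if s: "s \<in> S" for s
  proof -
    obtain x y where xy: "s = (x, y)" "T w x y" using s S_def by auto
    then show ?thesis using T_swap(2)[OF opp(1)[OF xy(2)]] by (simp add: g_def S_def)
  qed
  have fg: "f (g s) = s" if s: "s \<in> S" for s
  proof -
    obtain x y where xy: "s = (x, y)" "T w x y" using s S_def by auto
    have "y = opp w x (opp w x y)" using opp[OF xy(2)] xy(2) by (intro opp_eq) auto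
    then show ?thesis using xy by (simp add: f_def g_def)
  qed
  define st where "st i = (if i \<ge> 0 then (f ^^ nat i) (a, b) else (g ^^ nat (- i)) (a, b))" for i :: int
  have fn: "(f ^^ n) (a, b) \<in> S" for n by (induction n) (auto simp: S0 fS)
  have gn: "(g ^^ n) (a, b) \<in> S" for n by (induction n) (auto simp: S0 gS)
  have stS: "st i \<in> S" for i unfolding st_def using fn gn by simp
  have step: "st (i + 1) = f (st i)" for i
  proof (cases "i \<ge> 0")
    case True
    then show ?thesis unfolding st_def by (simp add: nat_add_distrib)
  next
    case False
    then have "nat (- i) = Suc (nat (- (i + 1)))" by simp
    then have "st i = g ((g ^^ nat (- (i + 1))) (a, b))" unfolding st_def using False by simp
    moreover have "(g ^^ nat (- (i + 1))) (a, b) = st (i + 1)"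
      unfolding st_def using False by (cases "i = -1") auto
    ultimately show ?thesis using fg stS by simp
  qed
  define z where "z i = fst (st i)" for i
  have st: "st i = (z i, z (i + 1))" for i
    unfolding z_def step by (simp add: f_def split: prod.splits)
  have "linkf w z" unfolding linkf_def
  proof (intro allI conjI)
    fix i
    show T: "T w (z i) (z (i + 1))" using stS[of i] unfolding S_def st by simp
    have "st (i + 1) = f (z i, z (i + 1))" using step st by simp
    then have "z (i + 1 + 1) = opp w (z (i + 1)) (z i)" unfolding st f_def by simp
    then show "z (i + 2) \<noteq> z i" using opp(2)[OF T_swap(2)[OF T]] by (simp add: add.assoc)
  qed
  moreover have "z 0 = a" "z 1 = b" using st[of 0] unfolding st_def by auto
  ultimately show ?thesis by blast
qed

definition cyc :: "'v list \<Rightarrow> bool" where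
  "cyc cs \<longleftrightarrow> length cs \<ge> 3 \<and> distinct cs \<and> successively A (cs @ [hd cs])"

end

text \<open>Simple connectivity as an induction rule: every simple cycle arises from triangles by
  gluing along a common path, up to the choice of a starting point. In the mesh this is
  \<open>disk_induct\<close>.\<close>

locale simply_connected_surface = triangulated_surface +
  assumes cycle_induct: "\<And>P cs. cyc cs \<Longrightarrow> (\<And>a b c. T a b c \<Longrightarrow> P [a, b, c]) \<Longrightarrow>
    (\<And>x xs. cyc (x # xs) \<Longrightarrow> P (xs @ [x]) \<Longrightarrow> P (x # xs)) \<Longrightarrow>
    (\<And>x p y q m. cyc (x # p @ y # q) \<Longrightarrow> cyc (x # p @ y # rev m) \<Longrightarrow> cyc (x # m @ y # q) \<Longrightarrow>
      P (x # p @ y # rev m) \<Longrightarrow> P (x # m @ y # q) \<Longrightarrow> P (x # p @ y # q)) \<Longrightarrow> P cs"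

text \<open>A connected covering described by neighbourhoods. \<open>N_bij\<close> gives unique
  lifting of edges, and \<open>N_T\<close> says that a triangle below closes up above.\<close>

locale surface_covering = simply_connected_surface r A T
  for r :: nat and A :: "'v \<Rightarrow> 'v \<Rightarrow> bool" and T :: "'v \<Rightarrow> 'v \<Rightarrow> 'v \<Rightarrow> bool" +
  fixes X :: "'x set" and N :: "'x \<Rightarrow> 'x set" and \<phi> :: "'x \<Rightarrow> 'v"
  assumes N_X: "x \<in> X \<Longrightarrow> N x \<subseteq> X"
    and N_sym: "x \<in> X \<Longrightarrow> y \<in> N x \<Longrightarrow> x \<in> N y"
    and N_bij: "x \<in> X \<Longrightarrow> bij_betw \<phi> (N x) {u. A (\<phi> x) u}"
    and N_T: "x \<in> X \<Longrightarrow> y \<in> N x \<Longrightarrow> z \<in> N x \<Longrightarrow> T (\<phi> x) (\<phi> y) (\<phi> z) \<Longrightarrow> z \<in> N y"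
    and N_conn: "x \<in> X \<Longrightarrow> y \<in> X \<Longrightarrow> (\<lambda>x y. y \<in> N x)\<^sup>*\<^sup>* x y"
begin

section \<open>Lifting walks through a covering\<close>

definition nx :: "'x \<Rightarrow> 'v \<Rightarrow> 'x" where
  "nx x u = (SOME y. y \<in> N x \<and> \<phi> y = u)"

definition lift :: "'x \<Rightarrow> 'v list \<Rightarrow> 'x" where
  "lift x us = foldl nx x us"

lemma lift_simps [simp]: "lift x [] = x" "lift x (u # us) = lift (nx x u) us"
  "lift x (us @ vs) = lift (lift x us) vs"
  by (simp_all add: lift_def)

lemma nx: "x \<in> X \<Longrightarrow> A (\<phi> x) u \<Longrightarrow> nx x u \<in> N x" "x \<in> X \<Longrightarrow> A (\<phi> x) u \<Longrightarrow> \<phi> (nx x u) = u"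
  "x \<in> X \<Longrightarrow> A (\<phi> x) u \<Longrightarrow> nx x u \<in> X"
proof -
  assume x: "x \<in> X" and u: "A (\<phi> x) u"
  have "u \<in> \<phi> ` N x" using N_bij[OF x] u by (simp add: bij_betw_def)
  then have "\<exists>y. y \<in> N x \<and> \<phi> y = u" by blast
  then have "nx x u \<in> N x \<and> \<phi> (nx x u) = u" unfolding nx_def by (rule someI_ex)
  then show "nx x u \<in> N x" "\<phi> (nx x u) = u" "nx x u \<in> X" using N_X x by blast+
qed

lemma N_inj: "x \<in> X \<Longrightarrow> y \<in> N x \<Longrightarrow> z \<in> N x \<Longrightarrow> \<phi> y = \<phi> z \<Longrightarrow> y = z"
  using N_bij[of x] by (simp add: bij_betw_def inj_on_def)

lemma N_A: "x \<in> X \<Longrightarrow> y \<in> N x \<Longrightarrow> A (\<phi> x) (\<phi> y)"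
  using N_bij[of x] unfolding bij_betw_def by blast

lemma nx_eq: "x \<in> X \<Longrightarrow> y \<in> N x \<Longrightarrow> nx x (\<phi> y) = y"
  using nx(1,2) N_A N_inj by metis

lemma nx_back: "x \<in> X \<Longrightarrow> A (\<phi> x) u \<Longrightarrow> nx (nx x u) (\<phi> x) = x"
  using nx nx_eq N_sym by metis

lemma lift_walk:
  "x \<in> X \<Longrightarrow> successively A (\<phi> x # us) \<Longrightarrow> lift x us \<in> X \<and> \<phi> (lift x us) = last (\<phi> x # us)"
proof (induction us arbitrary: x)
  case (Cons u us)
  have u: "A (\<phi> x) u" "successively A (u # us)" using Cons(3) by auto
  then show ?case using Cons.IH[of "nx x u"] nx[OF Cons(2) u(1)] by simp
qed simp

lemma lift_reverse:
  "x \<in> X \<Longrightarrow> successively A (\<phi> x # us @ [b]) \<Longrightarrow> lift (lift x (us @ [b])) (rev us @ [\<phi> x]) = x"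
proof (induction us arbitrary: x)
  case Nil
  then show ?case using nx_back by simp
next
  case (Cons u us)
  have u: "A (\<phi> x) u" "successively A (u # us @ [b])" using Cons(3) by auto
  then have "lift (lift (nx x u) (us @ [b])) (rev us @ [u]) = nx x u"
    using Cons.IH[of "nx x u"] nx[OF Cons(2) u(1)] by simp
  then show ?case using nx_back[OF Cons(2) u(1)] by simp
qed

lemma cyc_path: "cyc (x # p @ y # q) \<Longrightarrow> successively A (x # p @ [y])" "cyc (x # p @ y # q) \<Longrightarrow> successively A (y # q @ [x])"
proof -
  assume "cyc (x # p @ y # q)"
  then have "successively A ((x # p @ [y]) @ (q @ [x]))" "successively A ((x # p) @ (y # q @ [x]))" unfolding cyc_def by simp_all
  then show "successively A (x # p @ [y])" "successively A (y # q @ [x])"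
    unfolding successively_append_iff by blast+
qed

text \<open>The property of closing up from every starting point above passes through
  \<open>cycle_induct\<close>: triangles close by \<open>N_T\<close>, and if two cycles sharing the
  path \<open>m\<close> close up, so does the cycle obtained by dropping \<open>m\<close>.\<close>

lemma lift_cycle:
  assumes "cyc cs" "x \<in> X" "\<phi> x = hd cs"
  shows "lift x (tl cs @ [hd cs]) = x"
proof -
  have "\<forall>x\<in>X. \<phi> x = hd cs \<longrightarrow> lift x (tl cs @ [hd cs]) = x"
  proof (induction rule: cycle_induct[OF assms(1)])
    case (1 a b c)
    show ?case
    proof (intro ballI impI)
      fix x assume x: "x \<in> X" "\<phi> x = hd [a, b, c]"
      have A: "A (\<phi> x) b" "A (\<phi> x) c" using 1 T_A T_A2 x by auto
      note y = nx[OF x(1) A(1)] and z = nx[OF x(1) A(2)]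
      have "nx x c \<in> N (nx x b)" using N_T[OF x(1) y(1) z(1)] y(2) z(2) 1 x(2) by simp
      then have "nx (nx x b) c = nx x c" using nx_eq[OF y(3)] z(2) by metis
      then show "lift x (tl [a, b, c] @ [hd [a, b, c]]) = x" using nx_back[OF x(1) A(2)] x(2) by simp
    qed
  next
    case (2 x0 xs)
    show ?case
    proof (intro ballI impI)
      fix x assume x: "x \<in> X" "\<phi> x = hd (x0 # xs)"
      obtain y ys where xs: "xs = y # ys" using 2(1) unfolding cyc_def by (cases xs) auto
      have s: "successively A (x0 # [] @ [y])" "successively A (y # ys @ [x0])"
        using cyc_path[of x0 "[]" y ys] 2(1) xs by auto
      have A: "A (\<phi> x) y" using s x by simp
      note y = nx[OF x(1) A]
      define t where "t = lift (nx x y) (ys @ [x0])"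
      have t: "t \<in> X" "\<phi> t = x0"
        using lift_walk[OF y(3), of "ys @ [x0]"] s(2) y(2) unfolding t_def by auto
      \<comment> \<open>The rotated cycle closes up from the neighbour \<open>nx x y\<close> of
        \<open>x\<close>. So \<open>t\<close> and \<open>x\<close> are neighbours of one vertex with
        the same image, and local injectivity applies.\<close>
      have "nx t y = nx x y" using 2(2) y(2,3) unfolding xs t_def by simp
      then have "t \<in> N (nx x y)" using nx(1)[OF t(1), of y] N_sym[OF t(1)] t(2) A x(2) by simp
      moreover have "x \<in> N (nx x y)" using y(1) N_sym[OF x(1)] by blast
      ultimately have "t = x" using N_inj[OF y(3)] t(2) x(2) by simp
      then show "lift x (tl (x0 # xs) @ [hd (x0 # xs)]) = x" unfolding t_def xs by simp
    qed
  next
    case (3 x0 p y q m)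
    show ?case
    proof (intro ballI impI)
      fix x assume x: "x \<in> X" "\<phi> x = hd (x0 # p @ y # q)"
      then have x0: "\<phi> x = x0" by simp
      define t where "t = lift x (p @ [y])"
      have t: "t \<in> X" "\<phi> t = y"
        using lift_walk[OF x(1), of "p @ [y]"] cyc_path(1)[OF 3(1)] x0 unfolding t_def by auto
      have "lift t (rev m @ [x0]) = x" using 3(4) x(1) x0 unfolding t_def by simp
      \<comment> \<open>Retracing the second half of the first cycle shows that the lifts along
        \<open>p\<close> and along \<open>m\<close> end at the same vertex, so the lift along
        \<open>q\<close> continues either of them.\<close>
      then have "lift x (m @ [y]) = t"
        using lift_reverse[OF t(1), of "rev m" x0] cyc_path(2)[OF 3(2)] t(2) by simp
      moreover have "lift x ((m @ [y]) @ (q @ [x0])) = x" using 3(5) x(1) x0 by simp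
      ultimately have "lift t (q @ [x0]) = x" by simp
      then show "lift x (tl (x0 # p @ y # q) @ [hd (x0 # p @ y # q)]) = x" unfolding t_def by simp
    qed
  qed
  then show ?thesis using assms by blast
qed

text \<open>A closed walk that repeats a vertex splits there into shorter closed walks. One without
  repetition is a simple cycle, a step forth and back, or trivial.\<close>

lemma lift_closed:
  "x \<in> X \<Longrightarrow> successively A (\<phi> x # us) \<Longrightarrow> last (\<phi> x # us) = \<phi> x \<Longrightarrow> lift x us = x"
proof (induction "length us" arbitrary: us x rule: less_induct)
  case less
  show ?case
  proof (cases us rule: rev_cases)
    case (snoc vs a)
    have a: "a = \<phi> x" using less(4) snoc by simp
    have w: "successively A (a # vs @ [a])" using less(3) snoc a by simp
    show ?thesis
    proof (cases "distinct (a # vs)")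
      case True
      show ?thesis
      proof (cases "length vs \<ge> 2")
        case True
        then have "cyc (a # vs)" unfolding cyc_def using \<open>distinct (a # vs)\<close> w by simp
        from lift_cycle[OF this less(2)] have "lift x (vs @ [a]) = x" unfolding list.sel using a by metis
        then show ?thesis using snoc by metis
      next
        case False
        then consider "vs = []" | b where "vs = [b]" by (cases vs; cases "tl vs") auto
        then show ?thesis
        proof cases
          case 1
          then show ?thesis using w A_irrefl by simp
        next
          case 2
          then show ?thesis using w a snoc nx_back[OF less(2)] by simp
        qed
      qed
    next
      case False
      then obtain xs ys zs y where d: "a # vs = xs @ [y] @ ys @ [y] @ zs" using not_distinct_decomp by blast
      show ?thesis
      proof (cases xs)
        case Nil
        then have y: "y = a" "vs = ys @ [a] @ zs" using d by auto
        have "successively A ((a # ys @ [a]) @ zs @ [a])" "successively A ((a # ys) @ (a # zs @ [a]))"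
          using w y by simp_all
        then have s: "successively A (a # ys @ [a])" "successively A (a # zs @ [a])"
          unfolding successively_append_iff by blast+
        have "lift x (ys @ [a]) = x" "lift x (zs @ [a]) = x"
          using less(1)[of "ys @ [a]" x] less(1)[of "zs @ [a]" x] less(2) s a y snoc by simp_all
        then show ?thesis using snoc y by simp
      next
        case (Cons a' xs')
        then have v: "vs = xs' @ [y] @ ys @ [y] @ zs" using d by auto
        have s: "successively A (a # xs' @ [y])" "successively A (y # ys @ [y])" "successively A (y # zs @ [a])"
          using w successively_infix[of A "[]" "a # xs' @ [y]" "ys @ [y] @ zs @ [a]"]
            successively_infix[of A "a # xs'" "y # ys @ [y]" "zs @ [a]"]
            successively_infix[of A "a # xs' @ [y] @ ys" "y # zs @ [a]" "[]"] unfolding v by simp_all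
        have s4: "successively A (a # (xs' @ [y] @ zs) @ [a])"
          using successively_glue[of A "a # xs'" y "zs @ [a]"] s(1,3) by simp
        define t where "t = lift x (xs' @ [y])"
        have t: "t \<in> X" "\<phi> t = y" using lift_walk[OF less(2), of "xs' @ [y]"] s(1) a unfolding t_def by auto
        have "lift t (ys @ [y]) = t" using less(1)[of "ys @ [y]" t] t s(2) snoc v by simp
        moreover have "lift x ((xs' @ [y] @ zs) @ [a]) = x"
          using less(1)[of "(xs' @ [y] @ zs) @ [a]" x] less(2) s4 a snoc v by simp
        ultimately show ?thesis using snoc v unfolding t_def by simp
      qed
    qed
  qed simp
qed

text \<open>A walk above between two points of one fibre projects to a closed walk, whose lift is
  closed.\<close>

theorem covering_inj: "inj_on \<phi> X"
proof
  fix x y assume xy: "x \<in> X" "y \<in> X" "\<phi> x = \<phi> y"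
  have "(\<lambda>x y. y \<in> N x)\<^sup>*\<^sup>* x y" using N_conn xy by blast
  then have "\<exists>us. successively A (\<phi> x # us) \<and> lift x us = y"
  proof (induction)
    case base
    show ?case by (rule exI[of _ "[]"]) simp
  next
    case (step y z)
    then obtain us where us: "successively A (\<phi> x # us)" "lift x us = y" by blast
    have y: "y \<in> X" "\<phi> y = last (\<phi> x # us)" using lift_walk[OF xy(1) us(1)] us(2) by auto
    have "successively A ((\<phi> x # us) @ [\<phi> z])"
      unfolding successively_append_iff using us(1) N_A[OF y(1) step(2)] y(2) by simp
    moreover have "lift x (us @ [\<phi> z]) = z" using us(2) nx_eq[OF y(1) step(2)] by simp
    ultimately show ?case by (intro exI[of _ "us @ [\<phi> z]"]) simp
  qed
  then obtain us where us: "successively A (\<phi> x # us)" "lift x us = y" by blast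
  then have "last (\<phi> x # us) = \<phi> x" using lift_walk[OF xy(1) us(1)] xy(3) by simp
  then show "x = y" using lift_closed[OF xy(1) us(1)] us(2) by simp
qed

end

section \<open>Layers around a convex patch\<close>

lemma int_step_induct:
  fixes P :: "int \<Rightarrow> bool"
  assumes "P 0" "\<And>i. P i \<longleftrightarrow> P (i + 1)"
  shows "P i"
proof (induction i rule: int_induct[of _ 0])
  case (step2 i)
  then show ?case using assms(2)[of "i - 1"] by simp
qed (use assms in auto)

lemma card_range_periodic:
  fixes f :: "int \<Rightarrow> 'a"
  assumes f: "\<And>i j. f i = f j \<longleftrightarrow> m dvd i - j" and m: "m > 0"
  shows "finite (range f)" "card (range f) = nat m"
proof -
  have "f i \<in> f ` {0..<m}" for i
  proof -
    have "f i = f (i mod m)" unfolding f by (simp add: minus_mod_eq_mult_div)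
    then show ?thesis using m by auto
  qed
  then have r: "range f = f ` {0..<m}" by auto
  have "inj_on f {0..<m}"
  proof
    fix i j assume "i \<in> {0..<m}" "j \<in> {0..<m}" "f i = f j"
    then have "\<bar>i - j\<bar> < m" "m dvd \<bar>i - j\<bar>" using f by auto
    then show "i = j" using zdvd_imp_le[of m "\<bar>i - j\<bar>"] by force
  qed
  then show "finite (range f)" "card (range f) = nat m" unfolding r by (simp_all add: card_image)
qed

text \<open>With \<open>u i\<close> outer neighbours at the \<open>i\<close>-th boundary vertex, of which consecutive vertices share one,
  \<open>psum u i\<close> is the index in the next layer of the vertex shared by \<open>i - 1\<close> and \<open>i\<close>.\<close>
definition psum :: "(int \<Rightarrow> int) \<Rightarrow> int \<Rightarrow> int" where
  "psum u i = (if i \<ge> 0 then (\<Sum>j\<in>{0..<i}. u j - 1) else - (\<Sum>j\<in>{i..<0}. u j - 1))"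

lemma psum_0 [simp]: "psum u 0 = 0" by (simp add: psum_def)

lemma psum_step: "psum u (i + 1) = psum u i + u i - 1"
proof -
  consider "i \<ge> 0" | "i = -1" | "i < -1" by linarith
  then show ?thesis
  proof cases
    case 1
    then have "{0..<i + 1} = insert i {0..<i}" by auto
    then show ?thesis using 1 by (simp add: psum_def)
  next
    case 2
    have "{-1..<0} = {-1::int}" by auto
    then show ?thesis using 2 by (simp add: psum_def)
  next
    case 3
    then have "{i..<0} = insert i {i + 1..<0}" by auto
    then show ?thesis using 3 by (simp add: psum_def)
  qed
qed

text \<open>The boundary index whose fan of outer neighbours contains index \<open>k\<close> of the
  next layer. The half-open range assigns a vertex shared by two fans to the later one.\<close>

definition slot :: "(int \<Rightarrow> int) \<Rightarrow> int \<Rightarrow> int" where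
  "slot u k = (THE j. psum u j \<le> k \<and> k < psum u (j + 1))"

context
  fixes u :: "int \<Rightarrow> int" and b :: int
  assumes u2: "\<And>i. u i \<ge> 2" and ub: "\<And>i. u (i + b) = u i"
begin

text \<open>Two outer neighbours per vertex are what makes the fans advance: the contribution
  \<open>u i - 1\<close> is positive.\<close>

lemma psum_less: "psum u i < psum u (i + 1)"
  using psum_step[of u i] u2[of i] by simp

lemma psum_mono: "i \<le> j \<Longrightarrow> psum u i + (j - i) \<le> psum u j"
proof (induction j rule: int_ge_induct)
  case (step j)
  then show ?case using psum_less[of j] by simp
qed simp

lemma psum_less_iff: "psum u i < psum u j \<longleftrightarrow> i < j"
  using psum_mono[of i j] psum_mono[of j i] by linarith

lemma psum_le_iff: "psum u i \<le> psum u j \<longleftrightarrow> i \<le> j"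
  using psum_less_iff[of j i] by linarith

lemma psum_eq_iff: "psum u i = psum u j \<longleftrightarrow> i = j"
  using psum_less_iff[of j i] psum_less_iff[of i j] by linarith

lemma psum_add: "psum u (i + b) = psum u i + psum u b"
  by (rule int_step_induct[where P = "\<lambda>i. psum u (i + b) = psum u i + psum u b"])
    (use psum_step[of u] ub in \<open>auto simp: add.commute[of _ 1] add.left_commute[of _ 1] add.assoc\<close>)

lemma slot_unique: "psum u j \<le> k \<Longrightarrow> k < psum u (j + 1) \<Longrightarrow> slot u k = j"
proof -
  assume j: "psum u j \<le> k" "k < psum u (j + 1)"
  show ?thesis unfolding slot_def
  proof (rule the_equality)
    fix i assume i: "psum u i \<le> k \<and> k < psum u (i + 1)"
    then have "psum u i < psum u (j + 1)" "psum u j < psum u (i + 1)" using j by auto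
    then show "i = j" unfolding psum_less_iff by simp
  qed (use j in auto)
qed

lemma slot: "psum u (slot u k) \<le> k" "k < psum u (slot u k + 1)"
proof -
  have "\<exists>j. psum u j \<le> k \<and> k < psum u (j + 1)"
  proof (induction k rule: int_induct[of _ 0])
    case base
    then show ?case using psum_less[of 0] by (intro exI[of _ 0]) simp
  next
    case (step1 k)
    then obtain j where j: "psum u j \<le> k" "k < psum u (j + 1)" by blast
    show ?case
    proof (cases "k + 1 < psum u (j + 1)")
      case True
      then show ?thesis using j by (intro exI[of _ j]) simp
    next
      case False
      then show ?thesis using j psum_less[of "j + 1"] by (intro exI[of _ "j + 1"]) simp
    qed
  next
    case (step2 k)
    then obtain j where j: "psum u j \<le> k" "k < psum u (j + 1)" by blast
    show ?case
    proof (cases "psum u j \<le> k - 1")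
      case True
      then show ?thesis using j by (intro exI[of _ j]) simp
    next
      case False
      then show ?thesis using j psum_less[of "j - 1"] by (intro exI[of _ "j - 1"]) simp
    qed
  qed
  then obtain j where j: "psum u j \<le> k" "k < psum u (j + 1)" by blast
  then show "psum u (slot u k) \<le> k" "k < psum u (slot u k + 1)" using slot_unique by auto
qed

lemma slot_psum: "slot u (psum u j) = j"
  using slot_unique psum_less by blast

lemma slot_add: "slot u (k + psum u b) = slot u k + b"
proof (rule slot_unique)
  have "slot u k + b + 1 = (slot u k + 1) + b" by simp
  then have "psum u (slot u k + b + 1) = psum u (slot u k + 1) + psum u b" using psum_add by metis
  then show "k + psum u b < psum u (slot u k + b + 1)" using slot(2)[of k] by simp
qed (use psum_add slot(1)[of k] in simp)

lemma slot_pred: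
  "slot u (k - 1) = (if k = psum u (slot u k) then slot u k - 1 else slot u k)"
proof -
  consider "k = psum u (slot u k)" | "k > psum u (slot u k)" using slot(1)[of k] by linarith
  then show ?thesis
  proof cases
    case 1
    then have "slot u (k - 1) = slot u k - 1"
      using psum_less[of "slot u k - 1"] by (intro slot_unique) auto
    then show ?thesis using 1 by simp
  next
    case 2
    then have "slot u (k - 1) = slot u k" using slot(2)[of k] by (intro slot_unique) auto
    then show ?thesis using 2 by simp
  qed
qed

end

context triangulated_surface
begin

definition ring :: "'v \<Rightarrow> 'v \<Rightarrow> 'v \<Rightarrow> int \<Rightarrow> 'v" where
  "ring w x y = (SOME z. linkf w z \<and> z 0 = x \<and> z 1 = y)"

lemma ring: "T w x y \<Longrightarrow> linkf w (ring w x y)" "T w x y \<Longrightarrow> ring w x y 0 = x" "T w x y \<Longrightarrow> ring w x y 1 = y"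
  unfolding ring_def using someI_ex[OF link_ex] by blast+

lemma ring_eq_reflect: "T w x y \<Longrightarrow> linkf w z \<Longrightarrow> z i = x \<Longrightarrow> z (i - 1) = y \<Longrightarrow> ring w x y k = z (i - k)"
  using link_unique_reflect[OF ring(1), of w x y z 0 i k] ring(2,3) by simp

text \<open>A closed boundary walk \<^term>\<open>c\<close> of length \<^term>\<open>b\<close>, indexed periodically by the integers. \<^term>\<open>L i\<close> is the
  third vertex of the triangle on the inner side of the edge from \<^term>\<open>c i\<close> to \<^term>\<open>c (i + 1)\<close>, and
  \<^term>\<open>u i\<close> is the number of neighbours of \<^term>\<open>c i\<close> strictly outside.\<close>
definition layer :: "int \<Rightarrow> (int \<Rightarrow> 'v) \<Rightarrow> (int \<Rightarrow> 'v) \<Rightarrow> (int \<Rightarrow> int) \<Rightarrow> bool" where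
  "layer b c L u \<longleftrightarrow> b \<ge> 3 \<and> (\<forall>i. c (i + b) = c i \<and> L (i + b) = L i \<and> u (i + b) = u i \<and>
     T (c i) (c (i + 1)) (L i) \<and> 2 \<le> u i \<and> u i \<le> int r - 2 \<and>
     ring (c i) (L (i - 1)) (c (i - 1)) (u i + 2) = c (i + 1) \<and>
     ring (c i) (L (i - 1)) (c (i - 1)) (u i + 3) = L i)"

text \<open>The offset 2 skips the positions 0 and 1 of the ring, held by \<open>L (j - 1)\<close>
  and \<open>c (j - 1)\<close>.\<close>

definition next_c :: "(int \<Rightarrow> 'v) \<Rightarrow> (int \<Rightarrow> 'v) \<Rightarrow> (int \<Rightarrow> int) \<Rightarrow> int \<Rightarrow> 'v" where
  "next_c c L u k = (let j = slot u k in ring (c j) (L (j - 1)) (c (j - 1)) (2 + k - psum u j))"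

text \<open>Of the \<open>r\<close> neighbours of a new vertex two are in its own layer. Below it
  there is one more, or two if the vertex is shared by consecutive fans.\<close>

definition next_u :: "(int \<Rightarrow> int) \<Rightarrow> int \<Rightarrow> int" where
  "next_u u k = (if k = psum u (slot u k) then int r - 4 else int r - 3)"

context
  fixes b c L u
  assumes lay: "layer b c L u" and r6: "r \<ge> 6"
begin

lemma layerD: "b \<ge> 3" "c (i + b) = c i" "L (i + b) = L i" "u (i + b) = u i"
  "T (c i) (c (i + 1)) (L i)" "2 \<le> u i" "u i \<le> int r - 2"
  "ring (c i) (L (i - 1)) (c (i - 1)) (u i + 2) = c (i + 1)"
  "ring (c i) (L (i - 1)) (c (i - 1)) (u i + 3) = L i"
  using lay unfolding layer_def by auto

text \<open>The ring of \<open>c i\<close> read from the inside: \<open>L (i - 1)\<close> and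
  \<open>c (i - 1)\<close> at 0 and 1, the outer neighbours at 2 to \<open>u i + 1\<close>, then
  \<open>c (i + 1)\<close> at \<open>u i + 2\<close> and \<open>L i\<close> at
  \<open>u i + 3\<close>.\<close>

abbreviation "zz i \<equiv> ring (c i) (L (i - 1)) (c (i - 1))"

lemma layer_T: "T (c i) (L (i - 1)) (c (i - 1))"
  using layerD(5)[of "i - 1"] T_swap by (metis diff_add_cancel)

lemma zz: "linkf (c i) (zz i)" "zz i 0 = L (i - 1)" "zz i 1 = c (i - 1)"
  "zz i (u i + 2) = c (i + 1)" "zz i (u i + 3) = L i" "zz i (k + int r) = zz i k"
proof -
  show z: "linkf (c i) (zz i)" "zz i 0 = L (i - 1)" "zz i 1 = c (i - 1)" using ring[OF layer_T] by auto
  show "zz i (u i + 2) = c (i + 1)" "zz i (u i + 3) = L i" using layerD by auto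
  show "zz i (k + int r) = zz i k" using link_inj[OF z(1), of "k + int r" k] by simp
qed

lemmas l_psum_less = psum_less[of u b, OF layerD(6) layerD(4)]
lemmas l_psum_mono = psum_mono[of u b, OF layerD(6) layerD(4)]
lemmas l_psum_add = psum_add[of u b, OF layerD(6) layerD(4)]
lemmas l_slot = slot[of u b, OF layerD(6) layerD(4)]
lemmas l_slot_psum = slot_psum[of u b, OF layerD(6) layerD(4)]
lemmas l_slot_add = slot_add[of u b, OF layerD(6) layerD(4)]
lemmas l_slot_pred = slot_pred[of u b, OF layerD(6) layerD(4)]
lemmas l_slot_unique = slot_unique[of u b, OF layerD(6) layerD(4)]

lemma zz_periodic: "zz (i + b) = zz i"
proof -
  have "L (i + b - 1) = L (i - 1)" "c (i + b - 1) = c (i - 1)"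
    using layerD(2,3)[of "i - 1"] by (simp_all add: algebra_simps)
  then show ?thesis using layerD(2)[of i] by simp
qed

text \<open>The last outer neighbour of \<open>c i\<close> and the first one of
  \<open>c (i + 1)\<close> both complete the edge between them to the triangle on the side opposite
  to \<open>L i\<close>.\<close>

lemma zz_last: "zz i (u i + 1) = zz (i + 1) 2"
proof -
  have T: "T (c i) (c (i + 1)) (L i)" using layerD(5) .
  have "T (c i) (zz i (u i + 2)) (zz i (u i + 2 - 1))" using linkfD(2)[OF zz(1)] .
  then have 1: "T (c i) (c (i + 1)) (zz i (u i + 1))" using zz(4)[of i] by (simp add: algebra_simps)
  have "zz i (u i + 2 + 1) \<noteq> zz i (u i + 2 - 1)" using linkfD(5)[OF zz(1)] .
  then have "zz i (u i + 1) \<noteq> L i" using zz(5)[of i] by (simp add: algebra_simps)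
  then have a: "zz i (u i + 1) = opp (c i) (c (i + 1)) (L i)" using opp_eq[OF T 1] by blast
  have "T (c (i + 1)) (zz (i + 1) 1) (zz (i + 1) (1 + 1))" using linkfD(1)[OF zz(1)] .
  then have "T (c (i + 1)) (c i) (zz (i + 1) 2)" using zz(3)[of "i + 1"] by simp
  then have 2: "T (c i) (c (i + 1)) (zz (i + 1) 2)" by (rule T_swap(1))
  have "zz (i + 1) (0 + 2) \<noteq> zz (i + 1) 0" using linkfD(3)[OF zz(1)] .
  then have "zz (i + 1) 2 \<noteq> L i" using zz(2)[of "i + 1"] by simp
  then have "zz (i + 1) 2 = opp (c i) (c (i + 1)) (L i)" using opp_eq[OF T 2] by blast
  then show ?thesis using a by simp
qed

text \<open>Here the fan is closed at both ends, unlike in \<open>slot\<close>; at the right end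
  \<open>zz_last\<close> says that the two readings of the shared vertex agree.\<close>

lemma next_c_eq:
  assumes "psum u j \<le> k" "k \<le> psum u (j + 1)"
  shows "next_c c L u k = zz j (2 + k - psum u j)"
proof (cases "k = psum u (j + 1)")
  case True
  have "slot u k = j + 1" using True l_slot_psum by blast
  then have "next_c c L u k = zz (j + 1) 2" unfolding next_c_def Let_def using True by simp
  also have "\<dots> = zz j (u j + 1)" using zz_last by simp
  also have "u j + 1 = 2 + k - psum u j" using True psum_step[of u j] by simp
  finally show ?thesis .
next
  case False
  then have "slot u k = j" using assms l_slot_unique[of j k] by simp
  then show ?thesis unfolding next_c_def Let_def by simp
qed

text \<open>Fans of at least two vertices have at least one edge, so the length does not shrink
  below 3. The essential part is to locate \<open>?c (k + 1)\<close> and \<open>?L k\<close> in the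
  ring of a new vertex.\<close>

lemma next_layer: "layer (psum u b) (next_c c L u) (\<lambda>k. c (slot u k)) (next_u u)"
  unfolding layer_def
proof (intro conjI allI)
  have "psum u 0 + (b - 0) \<le> psum u b" using l_psum_mono[of 0 b] layerD(1) by simp
  then show "3 \<le> psum u b" using layerD(1) by simp
  fix k
  have sa: "slot u (k + psum u b) = slot u k + b" by (rule l_slot_add)
  have pa: "psum u (i + b) = psum u i + psum u b" for i by (rule l_psum_add)
  show "next_c c L u (k + psum u b) = next_c c L u k"
    unfolding next_c_def Let_def sa pa zz_periodic by (simp add: algebra_simps)
  show "c (slot u (k + psum u b)) = c (slot u k)" unfolding sa using layerD by simp
  show "next_u u (k + psum u b) = next_u u k" unfolding next_u_def sa pa by simp
  show "2 \<le> next_u u k" "next_u u k \<le> int r - 2" unfolding next_u_def using r6 by auto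
  define j where "j = slot u k"
  have j: "psum u j \<le> k" "k < psum u (j + 1)" using l_slot unfolding j_def by blast+
  have Tk: "T (next_c c L u i) (next_c c L u (i + 1)) (c (slot u i))" for i
  proof -
    have i: "psum u (slot u i) \<le> i" "i < psum u (slot u i + 1)" using l_slot by blast+
    then have "next_c c L u i = zz (slot u i) (2 + i - psum u (slot u i))"
      "next_c c L u (i + 1) = zz (slot u i) (2 + i - psum u (slot u i) + 1)"
      using next_c_eq[of "slot u i" i] next_c_eq[of "slot u i" "i + 1"] by (simp_all add: algebra_simps)
    then show ?thesis using linkfD(1)[OF zz(1)] T_swap by metis
  qed
  show "T (next_c c L u k) (next_c c L u (k + 1)) (c (slot u k))" using Tk .
  let ?c = "next_c c L u"
  let ?L = "\<lambda>k. c (slot u k)"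
  have T': "T (?c k) (?L (k - 1)) (?c (k - 1))" using Tk[of "k - 1"] T_swap by (metis diff_add_cancel)
  have T'': "T (?c k) (?c (k - 1)) (?L (k - 1))" using T' T_swap by blast
  \<comment> \<open>Read backwards, the ring starts with \<open>?c (k - 1)\<close> at 0, has one or
    two lower neighbours from 1 on, and reaches \<open>?c (k + 1)\<close> at 2 or 3. Its period
    \<open>r\<close> turns these indices into \<open>next_u u k + 2\<close> for the forward
    reading.\<close>
  define Y where "Y = ring (?c k) (?c (k - 1)) (?L (k - 1))"
  note Y = ring[OF T'', folded Y_def]
  have refl: "ring (?c k) (?L (k - 1)) (?c (k - 1)) t = Y (1 - t)" for t
    using ring_eq_reflect[OF T' Y(1), of 1 t] Y(2,3) by simp
  have Yper: "Y (i - int r) = Y i" for i using link_inj[OF Y(1), of "i - int r" i] by simp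
  have ns: "slot u (k - 1) = (if k = psum u j then j - 1 else j)"
    using l_slot_pred[of k] unfolding j_def by blast
  have nT: "x = Y (i + 1)" if "T (?c k) (Y i) x" "x \<noteq> Y (i - 1)" for i x
    using link_nbr[OF Y(1) that(1)] that(2) by blast
  have ne: "?c i \<noteq> ?c (i + 1)" for i using Tk T_ne(1) by blast
  show "ring (?c k) (?L (k - 1)) (?c (k - 1)) (next_u u k + 2) = ?c (k + 1)"
    "ring (?c k) (?L (k - 1)) (?c (k - 1)) (next_u u k + 3) = ?L k"
  proof -
    have TL: "T (?c k) (c j) (?c (k + 1))" using Tk[of k] T_swap unfolding j_def by blast
    show "ring (?c k) (?L (k - 1)) (?c (k - 1)) (next_u u k + 2) = ?c (k + 1)"
      "ring (?c k) (?L (k - 1)) (?c (k - 1)) (next_u u k + 3) = ?L k"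
    proof (atomize (full), cases "k = psum u j")
      case False
      then have s: "slot u (k - 1) = j" using ns by simp
      have nu: "next_u u k = int r - 3" using False unfolding next_u_def j_def by simp
      have kj: "psum u j \<le> k - 1" using False j(1) by simp
      have "zz j (2 + (k - 1) - psum u j + 2) \<noteq> zz j (2 + (k - 1) - psum u j)" using linkfD(3)[OF zz(1)] .
      moreover have "?c (k - 1) = zz j (2 + (k - 1) - psum u j)" "?c (k + 1) = zz j (2 + (k - 1) - psum u j + 2)"
        using next_c_eq[of j "k - 1"] next_c_eq[of j "k + 1"] kj j by (simp_all add: algebra_simps)
      ultimately have "?c (k + 1) \<noteq> ?c (k - 1)" by simp
      then have "?c (k + 1) = Y (1 + 1)" using nT[of 1 "?c (k + 1)"] TL Y(2,3) s by simp
      then show "ring (?c k) (?L (k - 1)) (?c (k - 1)) (next_u u k + 2) = ?c (k + 1) \<and>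
        ring (?c k) (?L (k - 1)) (?c (k - 1)) (next_u u k + 3) = ?L k"
        unfolding refl nu using Yper[of 2] Yper[of 1] Y(3) s j_def by simp
    next
      case True
      then have s: "slot u (k - 1) = j - 1" using ns by simp
      have nu: "next_u u k = int r - 4" using True unfolding next_u_def j_def by simp
      have "zz j 2 = ?c k" using next_c_eq[of j k] True j by simp
      moreover have "T (c j) (zz j 1) (zz j (1 + 1))" using linkfD(1)[OF zz(1)] .
      ultimately have T3: "T (?c k) (c (j - 1)) (c j)" using zz(3)[of j] T_swap by (metis one_add_one)
      have lt: "psum u (j - 1) < psum u j" using l_psum_less[of "j - 1"] by simp
      have "k - 1 \<le> psum u (j - 1 + 1)" "psum u (j - 1) \<le> k - 1" using True lt by simp_all
      then have ck: "?c (k - 1) = zz (j - 1) (2 + (k - 1) - psum u (j - 1))" using next_c_eq by blast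
      have kk: "k - psum u (j - 1) = u (j - 1) - 1" using psum_step[of u "j - 1"] True by simp
      then have ck: "?c (k - 1) = zz (j - 1) (u (j - 1))" using ck by (simp add: algebra_simps)
      have "zz (j - 1) (u (j - 1) + 2) \<noteq> zz (j - 1) (u (j - 1))" using linkfD(3)[OF zz(1)] .
      then have "c j \<noteq> ?c (k - 1)" using zz(4)[of "j - 1"] ck by simp
      then have y2: "c j = Y 2" using nT[of 1 "c j"] T3 Y(2,3) s by simp
      have "?c (k + 1) = zz j 3" using next_c_eq[of j "k + 1"] True j by simp
      moreover have "zz j (1 + 2) \<noteq> zz j 1" using linkfD(3)[OF zz(1)] .
      ultimately have "?c (k + 1) \<noteq> c (j - 1)" using zz(3)[of j] by simp
      then have "?c (k + 1) = Y (2 + 1)" using nT[of 2 "?c (k + 1)"] TL y2 Y(3) s by simp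
      then show "ring (?c k) (?L (k - 1)) (?c (k - 1)) (next_u u k + 2) = ?c (k + 1) \<and>
        ring (?c k) (?L (k - 1)) (?c (k - 1)) (next_u u k + 3) = ?L k"
        unfolding refl nu using Yper[of 3] Yper[of 2] y2 j_def by simp
    qed
  qed
qed

end

end

text \<open>Adjacency \<open>AD\<close> within the disk is kept apart from \<open>A\<close>, since
  an edge between two disk vertices could a priori run outside the disk; \<open>A_AD\<close>
  excludes this at the end. The last two assumptions describe the inner sector at a boundary vertex,
  positions \<open>u0 i + 2\<close> to \<open>r + 1\<close>.\<close>

locale convex_patch = simply_connected_surface r A T
  for r :: nat and A :: "'v \<Rightarrow> 'v \<Rightarrow> bool" and T :: "'v \<Rightarrow> 'v \<Rightarrow> 'v \<Rightarrow> bool" +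
  fixes D :: "'v set" and AD :: "'v \<Rightarrow> 'v \<Rightarrow> bool" and b0 :: int and c0 L0 :: "int \<Rightarrow> 'v" and u0 :: "int \<Rightarrow> int"
  assumes r6: "r \<ge> 6"
    and AD_A: "AD v w \<Longrightarrow> A v w" and AD_D: "AD v w \<Longrightarrow> v \<in> D" and AD_sym: "AD v w \<Longrightarrow> AD w v"
    and D_conn: "v \<in> D \<Longrightarrow> w \<in> D \<Longrightarrow> AD\<^sup>*\<^sup>* v w"
    and c0_D: "c0 i \<in> D" and c0_inj: "c0 i = c0 j \<longleftrightarrow> b0 dvd i - j"
    and interior: "v \<in> D \<Longrightarrow> v \<notin> range c0 \<Longrightarrow> A v w \<Longrightarrow> AD v w"
      "v \<in> D \<Longrightarrow> v \<notin> range c0 \<Longrightarrow> T v x y \<Longrightarrow> AD x y"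
    and layer0: "layer b0 c0 L0 u0"
    and boundary: "AD (c0 i) w \<longleftrightarrow> w \<in> ring (c0 i) (L0 (i - 1)) (c0 (i - 1)) ` {u0 i + 2..int r + 1}"
      "u0 i + 2 \<le> t \<Longrightarrow> t \<le> int r \<Longrightarrow>
        AD (ring (c0 i) (L0 (i - 1)) (c0 (i - 1)) t) (ring (c0 i) (L0 (i - 1)) (c0 (i - 1)) (t + 1))"
begin

primrec lay :: "nat \<Rightarrow> int \<times> (int \<Rightarrow> 'v) \<times> (int \<Rightarrow> 'v) \<times> (int \<Rightarrow> int)" where
  "lay 0 = (b0, c0, L0, u0)"
| "lay (Suc n) = (case lay n of (b, c, L, u) \<Rightarrow> (psum u b, next_c c L u, \<lambda>k. c (slot u k), next_u u))"

definition "bb n = fst (lay n)"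
definition "cc n = fst (snd (lay n))"
definition "LL n = fst (snd (snd (lay n)))"
definition "uu n = snd (snd (snd (lay n)))"
definition "pp n = psum (uu n)"
definition "JJ n = slot (uu n)"
definition "Z n i = ring (cc n i) (LL n (i - 1)) (cc n (i - 1))"

lemma lay_0: "bb 0 = b0" "cc 0 = c0" "LL 0 = L0" "uu 0 = u0"
  by (simp_all add: bb_def cc_def LL_def uu_def)

lemma lay_Suc: "bb (Suc n) = pp n (bb n)" "cc (Suc n) = next_c (cc n) (LL n) (uu n)"
  "LL (Suc n) = (\<lambda>k. cc n (JJ n k))" "uu (Suc n) = next_u (uu n)"
  by (simp_all add: bb_def cc_def LL_def uu_def pp_def JJ_def split: prod.splits)

lemma layers: "layer (bb n) (cc n) (LL n) (uu n)"
proof (induction n)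
  case 0
  show ?case unfolding lay_0 by (rule layer0)
next
  case (Suc n)
  show ?case unfolding lay_Suc pp_def JJ_def by (rule next_layer[OF Suc r6])
qed

lemmas lyD = layerD[OF layers r6]
lemmas lyZ = zz[OF layers r6, folded Z_def]
lemmas pp_less = psum_less[of "uu n" "bb n", OF lyD(6) lyD(4), folded pp_def] for n
lemmas pp_less_iff = psum_less_iff[of "uu n" "bb n", OF lyD(6) lyD(4), folded pp_def] for n
lemmas pp_le_iff = psum_le_iff[of "uu n" "bb n", OF lyD(6) lyD(4), folded pp_def] for n
lemmas pp_eq_iff = psum_eq_iff[of "uu n" "bb n", OF lyD(6) lyD(4), folded pp_def] for n
lemmas pp_add0 = psum_add[of "uu n" "bb n", OF lyD(6) lyD(4), folded pp_def] for n
lemmas JJ = slot[of "uu n" "bb n", OF lyD(6) lyD(4), folded pp_def JJ_def] for n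
lemmas JJ_pp = slot_psum[of "uu n" "bb n", OF lyD(6) lyD(4), folded pp_def JJ_def] for n
lemmas JJ_pred = slot_pred[of "uu n" "bb n", OF lyD(6) lyD(4), folded pp_def JJ_def] for n
lemmas JJ_unique = slot_unique[of "uu n" "bb n", OF lyD(6) lyD(4), folded pp_def JJ_def] for n

lemma pp_0: "pp n 0 = 0" and pp_Suc: "pp n (i + 1) = pp n i + uu n i - 1"
  unfolding pp_def by (simp_all add: psum_step)

lemma cc_Suc: "pp n j \<le> k \<Longrightarrow> k \<le> pp n (j + 1) \<Longrightarrow> cc (Suc n) k = Z n j (2 + k - pp n j)"
  unfolding lay_Suc Z_def pp_def by (rule next_c_eq[OF layers r6])

lemma uu_Suc: "uu (Suc n) k = (if k = pp n (JJ n k) then int r - 4 else int r - 3)"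
  unfolding lay_Suc next_u_def pp_def JJ_def ..

lemma pp_add: "pp n (i + bb n * m) = pp n i + bb (Suc n) * m"
proof (rule int_step_induct[where P = "\<lambda>m. pp n (i + bb n * m) = pp n i + bb (Suc n) * m"])
  fix m
  have "i + bb n * (m + 1) = (i + bb n * m) + bb n" by (simp add: algebra_simps)
  then have "pp n (i + bb n * (m + 1)) = pp n (i + bb n * m) + bb (Suc n)"
    using pp_add0[of n "i + bb n * m"] lay_Suc(1)[of n] by metis
  then show "(pp n (i + bb n * m) = pp n i + bb (Suc n) * m) \<longleftrightarrow>
      (pp n (i + bb n * (m + 1)) = pp n i + bb (Suc n) * (m + 1))" by (simp add: algebra_simps)
qed simp

lemma JJ_add: "JJ n (k + bb (Suc n) * m) = JJ n k + bb n * m"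
proof (rule JJ_unique)
  have "JJ n k + bb n * m + 1 = (JJ n k + 1) + bb n * m" by simp
  then have "pp n (JJ n k + bb n * m + 1) = pp n (JJ n k + 1) + bb (Suc n) * m" using pp_add by metis
  then show "k + bb (Suc n) * m < pp n (JJ n k + bb n * m + 1)" using JJ(2)[where n = n and k = k] by simp
qed (use pp_add[of n "JJ n k" m] JJ(1)[where n = n and k = k] in simp)

lemma cc_per: "cc n (i + bb n * m) = cc n i"
proof (rule int_step_induct[where P = "\<lambda>m. cc n (i + bb n * m) = cc n i"])
  fix m
  have "i + bb n * (m + 1) = (i + bb n * m) + bb n" by (simp add: algebra_simps)
  then show "(cc n (i + bb n * m) = cc n i) \<longleftrightarrow> (cc n (i + bb n * (m + 1)) = cc n i)"
    using lyD(2)[of n "i + bb n * m"] by metis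
qed simp

lemma cc_cong: "bb n dvd i - j \<Longrightarrow> cc n i = cc n j"
proof -
  assume "bb n dvd i - j"
  then obtain m where "i = j + bb n * m" by (metis dvd_def add.commute diff_add_cancel)
  then show ?thesis using cc_per by simp
qed

text \<open>The abstract complex: \<open>Inl v\<close> is a vertex of the disk, \<open>Inr (n, k)\<close> with \<open>n > 0\<close> the \<open>k\<close>-th vertex of the
  \<open>n\<close>-th layer, so that layer \<open>0\<close> is identified with the boundary of the disk.\<close>
definition pos :: "nat \<Rightarrow> int \<Rightarrow> 'v + nat \<times> int" where
  "pos n k = (if n = 0 then Inl (c0 k) else Inr (n, k mod bb n))"

fun \<phi> :: "'v + nat \<times> int \<Rightarrow> 'v" where
  "\<phi> (Inl v) = v"
| "\<phi> (Inr (n, k)) = cc n k"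

definition X :: "('v + nat \<times> int) set" where
  "X = Inl ` D \<union> {pos n k |n k. True}"

text \<open>Horizontal edges start with layer 1, as those of layer 0 belong to the disk. A shared
  vertex lies in two closed fans and so receives two edges from below.\<close>

inductive R :: "'v + nat \<times> int \<Rightarrow> 'v + nat \<times> int \<Rightarrow> bool" where
  disk: "AD v w \<Longrightarrow> R (Inl v) (Inl w)"
| fwd: "n \<ge> 1 \<Longrightarrow> R (pos n k) (pos n (k + 1))"
| bwd: "n \<ge> 1 \<Longrightarrow> R (pos n (k + 1)) (pos n k)"
| up: "pp n j \<le> k \<Longrightarrow> k \<le> pp n (j + 1) \<Longrightarrow> R (pos n j) (pos (Suc n) k)"
| down: "pp n j \<le> k \<Longrightarrow> k \<le> pp n (j + 1) \<Longrightarrow> R (pos (Suc n) k) (pos n j)"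

lemma R_sym: "R x y \<Longrightarrow> R y x"
  by (induction rule: R.induct) (auto intro: R.intros AD_sym)

lemma \<phi>_pos [simp]: "\<phi> (pos n k) = cc n k"
proof (cases "n = 0")
  case False
  have "cc n (k mod bb n) = cc n k" by (rule cc_cong) (simp add: mod_eq_dvd_iff[symmetric])
  then show ?thesis using False by (simp add: pos_def)
qed (simp add: pos_def lay_0)

lemma pos_eq: "pos n i = pos m j \<longleftrightarrow> n = m \<and> bb n dvd i - j"
  by (auto simp: pos_def c0_inj lay_0 mod_eq_dvd_iff)

lemma pos_eqE:
  assumes "pos n i = pos m j"
  obtains s where "m = n" "i = j + bb n * s"
proof -
  have "m = n" "bb n dvd i - j" using assms unfolding pos_eq by auto
  then show ?thesis using that by (metis dvd_def add.commute diff_add_cancel)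
qed

lemma pos_per: "pos n (i + bb n * s) = pos n i"
  unfolding pos_eq by simp

lemma pos_Inl: "pos n i = Inl v \<longleftrightarrow> n = 0 \<and> v = c0 i"
  by (auto simp: pos_def)

lemma R_hor: "R (pos n k) (pos n (k + 1))"
proof (cases "n = 0")
  case True
  have "Z 0 k (u0 k + 2) = c0 (k + 1)" using lyZ(4)[of 0 k] by (simp add: lay_0)
  moreover have "u0 k + 2 \<le> int r + 1" using lyD(7)[of 0 k] by (simp add: lay_0)
  ultimately have "AD (c0 k) (c0 (k + 1))" unfolding boundary by (force simp: Z_def lay_0)
  then show ?thesis using True R.disk by (simp add: pos_def)
qed (use R.fwd in simp)

text \<open>The neighbours of \<open>pos n i\<close> in the order of the ring below, so that
  \<open>\<phi>\<close> carries \<open>Y n i t\<close> to \<open>Z n i t\<close> for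
  \<open>t\<close> from 1 to \<open>r\<close>. The final case is the second lower neighbour of a
  shared vertex.\<close>

definition Y :: "nat \<Rightarrow> int \<Rightarrow> int \<Rightarrow> 'v + nat \<times> int" where
  "Y n i t = (if 2 \<le> t \<and> t \<le> uu n i + 1 then pos (Suc n) (pp n i + t - 2)
     else if n = 0 then Inl (Z 0 i t)
     else if t = 1 then pos n (i - 1) else if t = uu n i + 2 then pos n (i + 1)
     else if t = uu n i + 3 then pos (n - 1) (JJ (n - 1) i) else pos (n - 1) (JJ (n - 1) i - 1))"

lemma Y_1: "Y n i 1 = pos n (i - 1)"
proof (cases "n = 0")
  case True
  then show ?thesis using lyZ(3)[of 0 i] by (simp add: Y_def pos_def lay_0)
qed (simp add: Y_def)

lemma Y_up: "2 \<le> t \<Longrightarrow> t \<le> uu n i + 1 \<Longrightarrow> Y n i t = pos (Suc n) (pp n i + t - 2)"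
  by (simp add: Y_def)

lemma Y_2: "Y n i (uu n i + 2) = pos n (i + 1)"
proof (cases "n = 0")
  case True
  then show ?thesis using lyZ(4)[of 0 i] by (simp add: Y_def pos_def lay_0)
next
  case False
  then show ?thesis using lyD(6)[of n i] by (simp add: Y_def)
qed

lemma Y_3: "uu (Suc n) i + 3 \<le> t \<Longrightarrow> Y (Suc n) i t = (if t = uu (Suc n) i + 3 then pos n (JJ n i) else pos n (JJ n i - 1))"
  using lyD(6)[of "Suc n" i] by (simp add: Y_def)

lemma Y_0: "uu 0 i + 2 \<le> t \<Longrightarrow> Y 0 i t = Inl (Z 0 i t)"
  using lyD(6)[of 0 i] by (simp add: Y_def)

lemma Z_r: "Z n i (int r) = LL n (i - 1)" "Z n i (int r + 1) = cc n (i - 1)"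
  using lyZ(6)[of n i 0] lyZ(6)[of n i 1] lyZ(2,3)[of n i] by (simp_all add: add.commute)

text \<open>The positions \<open>t\<close> around a boundary vertex: \<open>1\<close> and \<open>uu n i + 2\<close> are its two neighbours in the
  same layer, those in between lie in the next layer, and the remaining ones up to \<open>r\<close> lie below.\<close>
lemma position_cases:
  assumes "1 \<le> t" "t \<le> int r"
  obtains (left) "t = 1" | (up) "2 \<le> t" "t \<le> uu n i + 1" | (right) "t = uu n i + 2"
    | (below0) "n = 0" "uu n i + 3 \<le> t"
    | (below1) m where "n = Suc m" "t = uu n i + 3"
    | (below2) m where "n = Suc m" "t = uu n i + 4" "t = int r" "uu n i = int r - 4" "i = pp m (JJ m i)"
proof -
  consider "t = 1" | "2 \<le> t" "t \<le> uu n i + 1" | "t = uu n i + 2" | "n = 0" "uu n i + 3 \<le> t"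
    | "n \<noteq> 0" "t = uu n i + 3" | "n \<noteq> 0" "t \<ge> uu n i + 4"
    using assms by linarith
  then show ?thesis
  proof cases
    case 5
    then show ?thesis using below1 not0_implies_Suc by blast
  next
    case 6
    then obtain m where m: "n = Suc m" using not0_implies_Suc by blast
    then show ?thesis using below2[OF m] uu_Suc[of m i] 6 assms by (auto split: if_splits)
  qed (use left up right below0 in auto)
qed

lemma \<phi>_Y: "1 \<le> t \<Longrightarrow> t \<le> int r \<Longrightarrow> \<phi> (Y n i t) = Z n i t"
proof -
  assume t: "1 \<le> t" "t \<le> int r"
  from t show ?thesis
  proof (cases rule: position_cases[where t = t and n = n and i = i])
    case left
    then show ?thesis using Y_1 lyZ(3) by simp
  next
    case up
    have "cc (Suc n) (pp n i + t - 2) = Z n i t"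
      using cc_Suc[of n i "pp n i + t - 2"] pp_Suc[of n i] up by simp
    then show ?thesis using Y_up[OF up] by simp
  next
    case right
    then show ?thesis using Y_2 lyZ(4) by simp
  next
    case below0
    then show ?thesis using Y_0[of i t] by simp
  next
    case (below1 m)
    then show ?thesis using Y_3[of m i t] lyZ(5)[of n i] lay_Suc(3)[of m] by simp
  next
    case (below2 m)
    have "JJ m (i - 1) = JJ m i - 1" using JJ_pred[of m i] below2(5) by simp
    then show ?thesis using Y_3[of m i t] below2 Z_r(1)[of n i] lay_Suc(3)[of m] by simp
  qed
qed

lemma R_Y: "1 \<le> t \<Longrightarrow> t \<le> int r \<Longrightarrow> R (pos n i) (Y n i t)"
proof -
  assume t: "1 \<le> t" "t \<le> int r"
  from t show ?thesis
  proof (cases rule: position_cases[where t = t and n = n and i = i])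
    case left
    then show ?thesis using Y_1 R_hor[of n "i - 1"] R_sym by simp
  next
    case up
    then show ?thesis using Y_up[OF up] pp_Suc[of n i] by (auto intro: R.up)
  next
    case right
    then show ?thesis using Y_2 R_hor by simp
  next
    case below0
    then have "AD (c0 i) (Z 0 i t)" unfolding boundary using t by (auto simp: Z_def lay_0)
    then show ?thesis using Y_0[of i t] below0 R.disk by (simp add: pos_def)
  next
    case (below1 m)
    then show ?thesis using Y_3[of m i t] JJ[where n = m and k = i] by (auto intro: R.down)
  next
    case (below2 m)
    have "pp m (JJ m i - 1) < i" using pp_less[of m "JJ m i - 1"] below2(5) by simp
    then show ?thesis using Y_3[of m i t] below2 by (auto intro!: R.down)
  qed
qed

text \<open>A vertex of the complex has many index representatives, and a rule of \<open>R\<close>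
  may use another one than \<open>i\<close>. In each case the other index of the rule is shifted by
  the corresponding multiple of the period of its own layer.\<close>

lemma R_YE: "R (pos n i) y \<Longrightarrow> \<exists>t. 1 \<le> t \<and> t \<le> int r \<and> y = Y n i t"
proof -
  have u: "2 \<le> uu n i" "uu n i \<le> int r - 2" using lyD(6,7) by auto
  have Y1: ?thesis if "y = pos n (i - 1)" using Y_1[of n i] that r_pos by (intro exI[of _ 1]) auto
  have Y2: ?thesis if "y = pos n (i + 1)" using Y_2[of n i] that u by (intro exI[of _ "uu n i + 2"]) auto
  assume "R (pos n i) y"
  then show ?thesis
  proof cases
    case (disk v w)
    then have n: "n = 0" "v = c0 i" unfolding pos_Inl by auto
    have ad: "AD (c0 i) w" using disk(3) n by simp
    obtain t where t: "u0 i + 2 \<le> t" "t \<le> int r + 1" "w = Z 0 i t"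
      using ad[unfolded boundary(1)] unfolding Z_def lay_0 by auto
    show ?thesis
    proof (cases "t = int r + 1")
      case True
      then show ?thesis using Y1 t(3) Z_r(2)[of 0 i] disk(2) n by (simp add: pos_def lay_0)
    next
      case False
      then show ?thesis using t Y_0[of i t] disk(2) n u by (intro exI[of _ t]) (auto simp: lay_0)
    qed
  next
    case (fwd m k)
    from fwd(1) obtain s where s: "m = n" "i = k + bb n * s" by (rule pos_eqE)
    have "pos n (i + 1) = pos n (k + 1)" unfolding pos_eq s by simp
    then show ?thesis using fwd(2) s(1) Y2 by simp
  next
    case (bwd m k)
    from bwd(1) obtain s where s: "m = n" "i = k + 1 + bb n * s" by (rule pos_eqE)
    have "pos n (i - 1) = pos n k" unfolding pos_eq s by simp
    then show ?thesis using bwd(2) s(1) Y1 by simp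
  next
    case (up m j k)
    from up(1) obtain s where s: "m = n" "i = j + bb n * s" by (rule pos_eqE)
    define k' where "k' = k + bb (Suc n) * s"
    have "i + 1 = (j + 1) + bb n * s" using s by simp
    then have "pp n i = pp n j + bb (Suc n) * s" "pp n (i + 1) = pp n (j + 1) + bb (Suc n) * s"
      using pp_add s(2) by metis+
    then have k': "pp n i \<le> k'" "k' \<le> pp n (i + 1)" using up(3,4) s(1) unfolding k'_def by auto
    have "y = pos (Suc n) k'" unfolding up(2) s(1) k'_def pos_per ..
    moreover have "Y n i (k' - pp n i + 2) = pos (Suc n) k'"
      using Y_up[of "k' - pp n i + 2" n i] k' pp_Suc[of n i] by simp
    ultimately show ?thesis using k' pp_Suc[of n i] u by (intro exI[of _ "k' - pp n i + 2"]) auto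
  next
    case (down m j k)
    from down(1) obtain s where s: "Suc m = n" "i = k + bb n * s" by (rule pos_eqE)
    define j' where "j' = j + bb m * s"
    have "j' + 1 = (j + 1) + bb m * s" unfolding j'_def by simp
    then have "pp m j' = pp m j + bb n * s" "pp m (j' + 1) = pp m (j + 1) + bb n * s"
      using pp_add s(1) unfolding j'_def by metis+
    then have j': "pp m j' \<le> i" "i \<le> pp m (j' + 1)" using down(3,4) s(2) by auto
    have y: "y = pos m j'" unfolding down(2) j'_def pos_per ..
    show ?thesis
    \<comment> \<open>At the right end of the fan of \<open>j'\<close> the slot of \<open>i\<close>
      is already \<open>j' + 1\<close>, so \<open>j'\<close> is the second lower neighbour, at
      position \<open>r\<close>.\<close>
    proof (cases "i = pp m (j' + 1)")
      case False
      then have "JJ m i = j'" using j' JJ_unique[of m j' i] by simp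
      then have "Y n i (uu n i + 3) = y" using Y_3[of m i "uu n i + 3"] y s(1) by simp
      moreover have "uu n i + 3 \<le> int r" using uu_Suc[of m i] s(1) by auto
      ultimately show ?thesis using u by (intro exI[of _ "uu n i + 3"]) auto
    next
      case True
      then have J: "JJ m i = j' + 1" using JJ_pp by simp
      then have "uu n i = int r - 4" using uu_Suc[of m i] True s(1) by auto
      moreover from this have "Y n i (int r) = y" using Y_3[of m i "int r"] y s(1) J by auto
      ultimately show ?thesis using r_pos by (intro exI[of _ "int r"]) auto
    qed
  qed
qed

text \<open>Consecutive neighbours are joined in the complex, also from position \<open>r\<close>
  back to 1. This is the content of \<open>N_T\<close> at vertices of the layers.\<close>

lemma R_Y_Y:
  assumes t: "1 \<le> t" "t \<le> int r"
  shows "R (Y n i t) (Y n i (if t = int r then 1 else t + 1))"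
proof -
  have u: "2 \<le> uu n i" "uu n i \<le> int r - 2" using lyD(6,7) by auto
  from t show ?thesis
  proof (cases rule: position_cases[where t = t and n = n and i = i])
    case left
    have "R (pos n (i - 1)) (pos (Suc n) (pp n i))" using pp_less[of n "i - 1"] by (intro R.up) auto
    then show ?thesis using left Y_1 Y_up[of 2 n i] u by simp
  next
    case up
    show ?thesis
    proof (cases "t = uu n i + 1")
      case True
      have "R (pos (Suc n) (pp n (i + 1))) (pos n (i + 1))" using pp_less[of n "i + 1"] by (intro R.down) auto
      moreover have "Y n i t = pos (Suc n) (pp n (i + 1))" using True Y_up[OF up] pp_Suc[of n i] by simp
      moreover have "Y n i (t + 1) = pos n (i + 1)" using True Y_2[of n i] by (simp add: add.commute)
      moreover have "t \<noteq> int r" using True u by simp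
      ultimately show ?thesis by simp
    next
      case False
      have "R (pos (Suc n) (pp n i + t - 2)) (pos (Suc n) (pp n i + t - 2 + 1))" by (rule R_hor)
      moreover have "Y n i (t + 1) = pos (Suc n) (pp n i + t - 2 + 1)"
        using False up Y_up[of "t + 1" n i] by (simp add: algebra_simps)
      moreover have "t \<noteq> int r" using up u by simp
      ultimately show ?thesis using Y_up[OF up] by simp
    qed
  next
    case right
    show ?thesis
    proof (cases n)
      case 0
      have ad: "AD (Z 0 i t) (Z 0 i (t + 1))" using boundary(2)[of i t] t right 0 by (simp add: Z_def lay_0)
      show ?thesis
      proof (cases "t = int r")
        case True
        have "Y 0 i 1 = Inl (Z 0 i (t + 1))" using Y_1[of 0 i] Z_r(2)[of 0 i] True by (simp add: pos_def lay_0)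
        then show ?thesis using True 0 ad Y_0[of i t] right by (auto intro: R.disk)
      next
        case False
        then show ?thesis using 0 ad Y_0[of i t] Y_0[of i "t + 1"] right by (auto intro: R.disk)
      qed
    next
      case (Suc m)
      have "uu n i + 2 < int r" using uu_Suc[of m i] Suc by auto
      moreover have "R (pos n (i + 1)) (pos m (JJ m i))"
        unfolding Suc using JJ[where n = m and k = i] by (intro R.down) auto
      ultimately show ?thesis using right Y_2[of n i] Y_3[of m i "t + 1"] Suc by simp
    qed
  next
    case below0
    have ad: "AD (Z 0 i t) (Z 0 i (t + 1))" using boundary(2)[of i t] t below0 by (simp add: Z_def lay_0)
    show ?thesis
    proof (cases "t = int r")
      case True
      have "Y 0 i 1 = Inl (Z 0 i (t + 1))" using Y_1[of 0 i] Z_r(2)[of 0 i] True by (simp add: pos_def lay_0)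
      then show ?thesis using True ad Y_0[of i t] below0 by (auto intro: R.disk)
    next
      case False
      then show ?thesis using ad Y_0[of i t] Y_0[of i "t + 1"] below0 by (auto intro: R.disk)
    qed
  next
    case (below1 m)
    show ?thesis
    proof (cases "i = pp m (JJ m i)")
      case True
      then have "uu n i = int r - 4" using uu_Suc[of m i] below1 by simp
      moreover have "R (pos m (JJ m i)) (pos m (JJ m i - 1))" using R_hor[of m "JJ m i - 1"] R_sym by simp
      ultimately show ?thesis using below1 Y_3[of m i t] Y_3[of m i "t + 1"] by simp
    next
      case False
      then have "uu n i = int r - 3" using uu_Suc[of m i] below1 by simp
      moreover have "R (pos m (JJ m i)) (pos n (i - 1))"
        unfolding below1(1) using JJ[where n = m and k = i] False by (intro R.up) auto
      ultimately show ?thesis using below1 Y_3[of m i t] Y_1[of n i] by simp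
    qed
  next
    case (below2 m)
    have "R (pos m (JJ m i - 1)) (pos n (i - 1))"
      unfolding below2(1) using pp_less[of m "JJ m i - 1"] below2(5) by (intro R.up) auto
    then show ?thesis using below2 Y_3[of m i t] Y_1[of n i] by simp
  qed
qed

lemma Z_inj: "1 \<le> s \<Longrightarrow> s \<le> int r \<Longrightarrow> 1 \<le> t \<Longrightarrow> t \<le> int r \<Longrightarrow> Z n i s = Z n i t \<Longrightarrow> s = t"
proof -
  assume st: "1 \<le> s" "s \<le> int r" "1 \<le> t" "t \<le> int r" "Z n i s = Z n i t"
  then have "int r dvd \<bar>s - t\<bar>" "\<bar>s - t\<bar> < int r" using link_inj[OF lyZ(1)] by auto
  then show "s = t" using zdvd_imp_le[of "int r" "\<bar>s - t\<bar>"] by force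
qed

lemma Z_surj: "A (cc n i) w \<Longrightarrow> \<exists>t. 1 \<le> t \<and> t \<le> int r \<and> w = Z n i t"
proof -
  assume "A (cc n i) w"
  then obtain s where s: "w = Z n i s" using link_range[OF lyZ(1)[of n i]] by blast
  define t where "t = (s - 1) mod int r + 1"
  have "(s - 1) mod int r - (s - 1) = - (int r * ((s - 1) div int r))"
    using minus_mod_eq_mult_div[of "s - 1" "int r"] by simp
  then have "int r dvd t - s" unfolding t_def by (metis add_diff_eq diff_diff_eq2 diff_add_eq dvd_minus_iff dvd_triv_left)
  then have "Z n i t = w" using link_inj[OF lyZ(1)] s by blast
  moreover have "1 \<le> t" "t \<le> int r" unfolding t_def using r_pos by (simp_all add: zless_imp_add1_zle)
  ultimately show ?thesis by blast
qed

definition N :: "'v + nat \<times> int \<Rightarrow> ('v + nat \<times> int) set" where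
  "N x = {y. R x y}"

lemma N_pos: "N (pos n i) = Y n i ` {1..int r}"
  unfolding N_def using R_Y R_YE by fastforce

lemma N_inner: "v \<notin> range c0 \<Longrightarrow> N (Inl v) = Inl ` {w. AD v w}"
proof -
  assume v: "v \<notin> range c0"
  have "y \<in> Inl ` {w. AD v w}" if "R (Inl v) y" for y
    using that
  proof (cases rule: R.cases)
    case (disk w)
    then show ?thesis by auto
  next
    case (up n j k)
    then show ?thesis using v pos_Inl[of n j v] by auto
  qed (use v in \<open>auto simp: pos_def split: if_splits\<close>)
  then show ?thesis unfolding N_def using R.disk by blast
qed

lemma X_cases:
  assumes "x \<in> X"
  obtains (inner) v where "x = Inl v" "v \<in> D" "v \<notin> range c0" | (layer) n i where "x = pos n i"
proof -
  consider v where "x = Inl v" "v \<in> D" | n i where "x = pos n i" using assms unfolding X_def by blast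
  then show ?thesis
  proof cases
    case (1 v)
    show ?thesis
    proof (cases "v \<in> range c0")
      case True
      then obtain i where "x = pos 0 i" using 1 by (auto simp: pos_def)
      then show ?thesis by (rule layer)
    qed (use 1 inner in blast)
  qed (use layer in blast)
qed

lemma pos_X: "pos n i \<in> X" unfolding X_def by blast

lemma R_X: "R x y \<Longrightarrow> y \<in> X"
  by (induction rule: R.induct) (auto simp: pos_X X_def dest: AD_D[OF AD_sym])

lemma conn_base: "x \<in> X \<Longrightarrow> R\<^sup>*\<^sup>* x (pos 0 0)"
proof -
  have inl: "R\<^sup>*\<^sup>* (Inl v) (Inl w)" if "AD\<^sup>*\<^sup>* v w" for v w
    using that by induction (auto intro: R.disk rtranclp.rtrancl_into_rtrancl)
  have D: "R\<^sup>*\<^sup>* (Inl v) (pos 0 0)" if "v \<in> D" for v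
    using inl[OF D_conn[OF that c0_D]] by (simp add: pos_def)
  have L: "R\<^sup>*\<^sup>* (pos n i) (pos 0 0)" for n i
  proof (induction n arbitrary: i)
    case 0
    then show ?case using D[OF c0_D] by (simp add: pos_def)
  next
    case (Suc n)
    have "R (pos (Suc n) i) (pos n (JJ n i))" using JJ[where n = n and k = i] by (intro R.down) auto
    then show ?case using Suc by (rule converse_rtranclp_into_rtranclp)
  qed
  assume "x \<in> X"
  then show ?thesis using D L unfolding X_def by auto
qed

text \<open>At a vertex inside the disk all neighbours and triangles belong to the disk. At a layer
  vertex the enumeration \<open>Y\<close> lies over the ring \<open>Z\<close>, whose positions 1 to
  \<open>r\<close> meet every neighbour once.\<close>

lemma covering: "surface_covering r A T X N \<phi>"
proof unfold_locales
  fix x assume x: "x \<in> X"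
  show "N x \<subseteq> X" unfolding N_def using R_X by blast
  show "x \<in> N y" if "y \<in> N x" for y using that R_sym unfolding N_def by blast
  from x show "bij_betw \<phi> (N x) {u. A (\<phi> x) u}"
  proof (cases rule: X_cases)
    case (inner v)
    have "{w. AD v w} = {w. A v w}" using interior(1)[OF inner(2,3)] AD_A by blast
    moreover have "inj_on \<phi> (Inl ` {w. AD v w})" by (rule inj_onI) auto
    ultimately show ?thesis unfolding inner(1) N_inner[OF inner(3)] bij_betw_def
      by (simp add: image_image)
  next
    case (layer n i)
    show ?thesis unfolding bij_betw_def layer N_pos
    proof
      show "inj_on \<phi> (Y n i ` {1..int r})"
      proof
        fix x y assume "x \<in> Y n i ` {1..int r}" "y \<in> Y n i ` {1..int r}" and eq: "\<phi> x = \<phi> y"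
        then obtain s t where st: "x = Y n i s" "1 \<le> s" "s \<le> int r" "y = Y n i t" "1 \<le> t" "t \<le> int r" by auto
        then have "Z n i s = Z n i t" using eq \<phi>_Y by simp
        then show "x = y" using Z_inj st by blast
      qed
      show "\<phi> ` Y n i ` {1..int r} = {u. A (\<phi> (pos n i)) u}"
      proof
        show "\<phi> ` Y n i ` {1..int r} \<subseteq> {u. A (\<phi> (pos n i)) u}"
          using \<phi>_Y[of _ n i] linkfD(4)[OF lyZ(1)[of n i]] by auto
        show "{u. A (\<phi> (pos n i)) u} \<subseteq> \<phi> ` Y n i ` {1..int r}"
        proof
          fix w assume "w \<in> {u. A (\<phi> (pos n i)) u}"
          then obtain t where t: "1 \<le> t" "t \<le> int r" "w = Z n i t" using Z_surj[of n i w] by auto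
          then have "w = \<phi> (Y n i t)" using \<phi>_Y by simp
          then show "w \<in> \<phi> ` Y n i ` {1..int r}" using t by auto
        qed
      qed
    qed
  qed
  fix y z assume yz: "y \<in> N x" "z \<in> N x" "T (\<phi> x) (\<phi> y) (\<phi> z)"
  from x show "z \<in> N y"
  proof (cases rule: X_cases)
    case (inner v)
    then obtain v1 v2 where "y = Inl v1" "z = Inl v2" using yz N_inner by auto
    then show ?thesis using interior(2)[OF inner(2,3), of v1 v2] yz(3) inner(1) R.disk unfolding N_def by auto
  next
    case (layer n i)
    obtain s t where st: "y = Y n i s" "1 \<le> s" "s \<le> int r" "z = Y n i t" "1 \<le> t" "t \<le> int r"
      using yz(1,2) unfolding layer N_pos by auto
    have T: "T (cc n i) (Z n i s) (Z n i t)" using yz(3) \<phi>_Y[of _ n i] st layer by simp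
    \<comment> \<open>Triangles at the vertex correspond to consecutive positions, up to exchanging
      \<open>s\<close> and \<open>t\<close>.\<close>
    have nxt: "R (Y n i s) (Y n i t)" if "1 \<le> s" "s \<le> int r" "1 \<le> t" "t \<le> int r" "Z n i t = Z n i (s + 1)" for s t
    proof -
      have "t = (if s = int r then 1 else s + 1)"
      proof (cases "s = int r")
        case True
        then have "Z n i t = Z n i 1" using that(5) lyZ(6)[of n i 1] by (simp add: add.commute)
        then show ?thesis using Z_inj[of t 1 n i] that True by simp
      next
        case False
        then show ?thesis using Z_inj[of t "s + 1" n i] that by simp
      qed
      then show ?thesis using R_Y_Y[OF that(1,2), of n i] by simp
    qed
    have "Z n i t = Z n i (s + 1) \<or> Z n i t = Z n i (s - 1)" using link_nbr[OF lyZ(1) T] .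
    then have "R (Y n i s) (Y n i t)"
    proof
      assume a: "Z n i t = Z n i (s - 1)"
      have "Z n i (t + 1) = Z n i s" using link_step[OF lyZ(1) a, of 1] by simp
      then show ?thesis using nxt[of t s] st R_sym by simp
    qed (use nxt[of s t] st in simp)
    then show ?thesis unfolding N_def st by simp
  qed
next
  fix x y assume xy: "x \<in> X" "y \<in> X"
  have N: "(\<lambda>x y. y \<in> N x) = R" unfolding N_def by auto
  have "R\<^sup>*\<^sup>* x (pos 0 0)" "R\<^sup>*\<^sup>* y (pos 0 0)" using conn_base xy by auto
  moreover have "symp R" using R_sym by (auto intro: sympI)
  ultimately have "R\<^sup>*\<^sup>* (pos 0 0) y" using symp_rtranclp sympD by metis
  then show "(\<lambda>x y. y \<in> N x)\<^sup>*\<^sup>* x y" unfolding N using \<open>R\<^sup>*\<^sup>* x (pos 0 0)\<close> rtranclp_trans by metis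
qed

text \<open>The decisive fact: the layers are simple cycles, pairwise disjoint, and only layer 0
  meets the disk.\<close>

lemma \<phi>_inj: "inj_on \<phi> X"
  using surface_covering.covering_inj[OF covering] .

subsection \<open>Counting the cells of a layer\<close>

primrec VV :: "nat \<Rightarrow> 'v set" where
  "VV 0 = D"
| "VV (Suc n) = VV n \<union> range (cc (Suc n))"

lemma cc_eq: "cc n i = cc m j \<longleftrightarrow> n = m \<and> bb n dvd i - j"
proof -
  have "cc n i = cc m j \<longleftrightarrow> pos n i = pos m j"
    using inj_on_eq_iff[OF \<phi>_inj pos_X[of n i] pos_X[of m j]] by simp
  then show ?thesis unfolding pos_eq .
qed

lemma cc_D: "cc n i \<in> D \<longleftrightarrow> n = 0"
proof
  assume d: "cc n i \<in> D"
  then have "Inl (cc n i) \<in> X" unfolding X_def by blast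
  then have "pos n i = Inl (cc n i)" using inj_on_eq_iff[OF \<phi>_inj pos_X[of n i], of "Inl (cc n i)"] by simp
  then show "n = 0" unfolding pos_Inl by simp
qed (use c0_D lay_0 in simp)

lemma cc_VV: "cc m i \<in> VV n \<longleftrightarrow> m \<le> n"
proof (induction n)
  case 0
  then show ?case using cc_D by simp
next
  case (Suc n)
  have "cc m i \<in> range (cc (Suc n)) \<longleftrightarrow> m = Suc n" using cc_eq by (metis rangeE rangeI)
  then show ?case using Suc by auto
qed

lemma D_VV: "D \<subseteq> VV n"
  by (induction n) auto

lemma VV_cases:
  assumes "v \<in> VV n"
  obtains "v \<in> D" | m i where "m \<le> n" "v = cc m i"
  using assms
proof (induction n arbitrary: thesis)
  case (Suc n)
  show ?case
  proof (cases "v \<in> VV n")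
    case True
    show ?thesis using Suc.IH[OF Suc.prems(1) _ True] Suc.prems(2) by (metis le_SucI)
  next
    case False
    then obtain i where "v = cc (Suc n) i" using Suc.prems(3) by auto
    then show ?thesis using Suc.prems(2) by blast
  qed
qed simp

lemma nbr_lift: "x \<in> X \<Longrightarrow> A (\<phi> x) w \<Longrightarrow> \<exists>y. R x y \<and> \<phi> y = w"
proof -
  assume "x \<in> X" "A (\<phi> x) w"
  then have "w \<in> \<phi> ` N x" using surface_covering.N_bij[OF covering, of x] by (simp add: bij_betw_def)
  then show ?thesis unfolding N_def by auto
qed

text \<open>The edge lifts at \<open>Inl v\<close>. By injectivity its other end is
  \<open>Inl w\<close>, and the only edges between points of this form are those of the
  disk.\<close>

lemma A_AD: "v \<in> D \<Longrightarrow> w \<in> D \<Longrightarrow> A v w \<Longrightarrow> AD v w"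
proof -
  assume v: "v \<in> D" and w: "w \<in> D" and a: "A v w"
  have X: "Inl v \<in> X" "Inl w \<in> X" using v w unfolding X_def by auto
  obtain y where y: "R (Inl v) y" "\<phi> y = w" using nbr_lift[OF X(1)] a by auto
  then have "y = Inl w" using inj_onD[OF \<phi>_inj _ R_X[OF y(1)] X(2)] by simp
  with y(1) have "R (Inl v) (Inl w)" by simp
  then show ?thesis
    by (cases rule: R.cases) (auto simp: pos_def split: if_splits)
qed

lemma R_VV: "R x y \<Longrightarrow> \<phi> x \<in> VV n \<Longrightarrow> \<phi> y \<in> VV (Suc n)"
proof (induction rule: R.induct)
  case (disk v w)
  then show ?case using AD_D[OF AD_sym] D_VV[of n] by auto
qed (simp_all add: cc_VV del: VV.simps)

lemma A_below: "A (cc (Suc n) k) (cc n (JJ n k))" "A (cc (Suc n) k) (cc (Suc n) (k + 1))"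
  "T (cc (Suc n) k) (cc (Suc n) (k + 1)) (cc n (JJ n k))"
proof -
  show "T (cc (Suc n) k) (cc (Suc n) (k + 1)) (cc n (JJ n k))" using lyD(5)[of "Suc n" k] by (simp add: lay_Suc(3))
  then show "A (cc (Suc n) k) (cc n (JJ n k))" "A (cc (Suc n) k) (cc (Suc n) (k + 1))"
    using T_A T_A2 by blast+
qed

text \<open>The triangle standing on an old boundary edge; its apex is the new vertex shared by the
  fans of \<open>j - 1\<close> and \<open>j\<close>.\<close>

lemma T_peak: "T (cc (Suc n) (pp n j)) (cc n j) (cc n (j - 1))"
proof -
  have "cc (Suc n) (pp n j) = Z n j 2" using cc_Suc[of n j "pp n j"] pp_less[of n j] by simp
  moreover have "T (cc n j) (Z n j 1) (Z n j (1 + 1))" using linkfD(1)[OF lyZ(1)] .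
  ultimately have "T (cc n j) (cc n (j - 1)) (cc (Suc n) (pp n j))" using lyZ(3)[of n j] by simp
  then show ?thesis using T_swap by blast
qed

text \<open>Identifies the abstract layers with the vertices added by \<open>expansion\<close>:
  every neighbour lifts to the complex, where an edge climbs at most one layer.\<close>

lemma VV_Suc: "VV (Suc n) = VV n \<union> {w. \<exists>u\<in>VV n. A u w}"
proof
  show "VV (Suc n) \<subseteq> VV n \<union> {w. \<exists>u\<in>VV n. A u w}"
  proof
    fix w assume "w \<in> VV (Suc n)"
    then consider "w \<in> VV n" | k where "w = cc (Suc n) k" by auto
    then show "w \<in> VV n \<union> {w. \<exists>u\<in>VV n. A u w}"
    proof cases
      case (2 k)
      then have "A (cc n (JJ n k)) w" using A_below(1) A_sym by blast
      then show ?thesis using cc_VV[of n _ n] by blast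
    qed simp
  qed
  show "VV n \<union> {w. \<exists>u\<in>VV n. A u w} \<subseteq> VV (Suc n)"
  proof
    fix w assume "w \<in> VV n \<union> {w. \<exists>u\<in>VV n. A u w}"
    then consider "w \<in> VV n" | v where "v \<in> VV n" "A v w" by auto
    then show "w \<in> VV (Suc n)"
    proof cases
      case (2 v)
      from 2(1) have "\<exists>x\<in>X. \<phi> x = v"
      proof (cases rule: VV_cases)
        case 1
        then show ?thesis unfolding X_def by (intro bexI[of _ "Inl v"]) auto
      next
        case (2 m i)
        then show ?thesis using pos_X[of m i] by (intro bexI[of _ "pos m i"]) auto
      qed
      then obtain x where x: "x \<in> X" "\<phi> x = v" by blast
      then obtain y where "R x y" "\<phi> y = w" using nbr_lift 2(2) by metis
      then show ?thesis using R_VV[of x y n] x(2) 2(1) by simp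
    qed simp
  qed
qed

lemma Z_up: "2 \<le> t \<Longrightarrow> t \<le> uu n i + 1 \<Longrightarrow> Z n i t \<notin> VV n"
proof -
  assume t: "2 \<le> t" "t \<le> uu n i + 1"
  then have "Z n i t = cc (Suc n) (pp n i + t - 2)"
    using cc_Suc[of n i "pp n i + t - 2"] pp_Suc[of n i] by simp
  then show ?thesis using cc_VV[of "Suc n"] by simp
qed

lemma Z_below:
  "Z (Suc n) k (uu (Suc n) k + 3) = cc n (JJ n k)"
  "uu (Suc n) k = int r - 4 \<Longrightarrow> Z (Suc n) k (int r) = cc n (JJ n k - 1) \<and> k = pp n (JJ n k)"
proof -
  show "Z (Suc n) k (uu (Suc n) k + 3) = cc n (JJ n k)" using lyZ(5)[of "Suc n" k] by (simp add: lay_Suc(3))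
  assume u: "uu (Suc n) k = int r - 4"
  then have k: "k = pp n (JJ n k)" using uu_Suc[of n k] by (auto split: if_splits)
  then have "JJ n (k - 1) = JJ n k - 1" using JJ_pred[of n k] by simp
  then show "Z (Suc n) k (int r) = cc n (JJ n k - 1) \<and> k = pp n (JJ n k)"
    using Z_r(1)[of "Suc n" k] k by (simp add: lay_Suc(3))
qed

lemma nbr_layer:
  assumes "A (cc (Suc n) k) w" "w \<in> VV (Suc n)"
  shows "w = cc (Suc n) (k + 1) \<or> w = cc (Suc n) (k - 1) \<or> w = cc n (JJ n k) \<or>
    k = pp n (JJ n k) \<and> w = cc n (JJ n k - 1)"
proof -
  obtain t where t: "1 \<le> t" "t \<le> int r" "w = Z (Suc n) k t" using Z_surj[OF assms(1)] by blast
  from t(1,2) show ?thesis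
  proof (cases rule: position_cases[where t = t and n = "Suc n" and i = k])
    case left
    then show ?thesis using t(3) lyZ(3)[of "Suc n" k] by simp
  next
    case up
    then show ?thesis using Z_up assms(2) t(3) by blast
  next
    case right
    then show ?thesis using t(3) lyZ(4)[of "Suc n" k] by simp
  next
    case (below1 m)
    then show ?thesis using t(3) Z_below(1)[of n k] by simp
  next
    case (below2 m)
    then show ?thesis using t(3) Z_below(2)[of n k] by simp
  qed simp
qed

text \<open>The new cells: triangles with base in the new or in the old layer (\<open>f1\<close>,
  \<open>f2\<close>), new boundary edges (\<open>g1\<close>), one edge downwards per new vertex
  (\<open>g2\<close>), and a second one at each shared vertex (\<open>g3\<close>). Families
  \<open>f1\<close>, \<open>g1\<close>, \<open>g2\<close> have the period of the new layer,
  \<open>f2\<close> and \<open>g3\<close> that of the old one, which yields the counts.\<close>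

definition f1 :: "nat \<Rightarrow> int \<Rightarrow> 'v set" where
  "f1 n k = {cc (Suc n) k, cc (Suc n) (k + 1), cc n (JJ n k)}"
definition f2 :: "nat \<Rightarrow> int \<Rightarrow> 'v set" where
  "f2 n j = {cc (Suc n) (pp n j), cc n j, cc n (j - 1)}"
definition g1 :: "nat \<Rightarrow> int \<Rightarrow> 'v set" where
  "g1 n k = {cc (Suc n) k, cc (Suc n) (k + 1)}"
definition g2 :: "nat \<Rightarrow> int \<Rightarrow> 'v set" where
  "g2 n k = {cc (Suc n) k, cc n (JJ n k)}"
definition g3 :: "nat \<Rightarrow> int \<Rightarrow> 'v set" where
  "g3 n j = {cc (Suc n) (pp n j), cc n (j - 1)}"

lemma tri_layer_aux:
  assumes t: "1 \<le> t" "t \<le> int r" and v: "Z (Suc n) k t \<in> VV (Suc n)" "Z (Suc n) k (t + 1) \<in> VV (Suc n)"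
  shows "{cc (Suc n) k, Z (Suc n) k t, Z (Suc n) k (t + 1)} \<in> range (f1 n) \<union> range (f2 n)"
proof -
  have u: "2 \<le> uu (Suc n) k" using lyD(6) by auto
  from t show ?thesis
  proof (cases rule: position_cases[where t = t and n = "Suc n" and i = k])
    case left
    then show ?thesis using Z_up[of 2 "Suc n" k] u v(2) by simp
  next
    case up
    then show ?thesis using Z_up[of t "Suc n" k] v(1) by blast
  next
    case right
    have "Z (Suc n) k (t + 1) = cc n (JJ n k)" using Z_below(1)[of n k] right by (simp add: add.commute)
    moreover have "Z (Suc n) k t = cc (Suc n) (k + 1)" using lyZ(4)[of "Suc n" k] right by simp
    ultimately have "{cc (Suc n) k, Z (Suc n) k t, Z (Suc n) k (t + 1)} = f1 n k" unfolding f1_def by simp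
    then show ?thesis by blast
  next
    case (below1 m)
    have zt: "Z (Suc n) k t = cc n (JJ n k)" using Z_below(1)[of n k] below1 by simp
    show ?thesis
    proof (cases "k = pp n (JJ n k)")
      case True
      then have "uu (Suc n) k = int r - 4" using uu_Suc[of n k] by simp
      then have "Z (Suc n) k (t + 1) = cc n (JJ n k - 1)" using Z_below(2)[of n k] below1(2) by simp
      then have "{cc (Suc n) k, Z (Suc n) k t, Z (Suc n) k (t + 1)} = f2 n (JJ n k)"
        unfolding f2_def using zt True by simp
      then show ?thesis by blast
    next
      case False
      then have "t = int r" using uu_Suc[of n k] below1(2) by simp
      then have "Z (Suc n) k (t + 1) = cc (Suc n) (k - 1)" using Z_r(2)[of "Suc n" k] by simp
      moreover have "JJ n (k - 1) = JJ n k" using JJ_pred[of n k] False by simp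
      ultimately have "{cc (Suc n) k, Z (Suc n) k t, Z (Suc n) k (t + 1)} = f1 n (k - 1)"
        unfolding f1_def using zt by auto
      then show ?thesis by blast
    qed
  next
    case (below2 m)
    have zt: "Z (Suc n) k t = cc n (JJ n k - 1)" using Z_below(2)[of n k] below2 by simp
    have "Z (Suc n) k (t + 1) = cc (Suc n) (k - 1)" using Z_r(2)[of "Suc n" k] below2(3) by simp
    moreover have "JJ n (k - 1) = JJ n k - 1" using JJ_pred[of n k] Z_below(2)[of n k] below2(4) by simp
    ultimately have "{cc (Suc n) k, Z (Suc n) k t, Z (Suc n) k (t + 1)} = f1 n (k - 1)"
      unfolding f1_def using zt by auto
    then show ?thesis by blast
  qed simp
qed

lemma tri_layer:
  assumes T: "T (cc (Suc n) k) x y" and v: "x \<in> VV (Suc n)" "y \<in> VV (Suc n)"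
  shows "{cc (Suc n) k, x, y} \<in> range (f1 n) \<union> range (f2 n)"
proof -
  have A: "A (cc (Suc n) k) x" "A (cc (Suc n) k) y" using T T_A T_A2 by blast+
  obtain s where s: "1 \<le> s" "s \<le> int r" "x = Z (Suc n) k s" using Z_surj[OF A(1)] by blast
  obtain t where t: "1 \<le> t" "t \<le> int r" "y = Z (Suc n) k t" using Z_surj[OF A(2)] by blast
  have "y = Z (Suc n) k (s + 1) \<or> y = Z (Suc n) k (s - 1)"
    using link_nbr[OF lyZ(1)] T s(3) by blast
  then show ?thesis
  proof
    assume "y = Z (Suc n) k (s + 1)"
    then show ?thesis using tri_layer_aux[OF s(1,2)] s(3) v by simp
  next
    assume a: "y = Z (Suc n) k (s - 1)"
    have "x = Z (Suc n) k (t + 1)"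
      using link_step[OF lyZ(1), of "Suc n" k t "s - 1" 1] a t(3) s(3) by simp
    then have "{cc (Suc n) k, y, x} \<in> range (f1 n) \<union> range (f2 n)"
      using tri_layer_aux[OF t(1,2)] t(3) v by simp
    then show ?thesis by (simp add: insert_commute)
  qed
qed

definition EE :: "nat \<Rightarrow> 'v set set" where
  "EE n = {{v, w} |v w. A v w \<and> v \<in> VV n \<and> w \<in> VV n}"
definition FF :: "nat \<Rightarrow> 'v set set" where
  "FF n = {{x, y, z} |x y z. T x y z \<and> x \<in> VV n \<and> y \<in> VV n \<and> z \<in> VV n}"

lemma EE_VV: "e \<in> EE n \<Longrightarrow> e \<subseteq> VV n" and FF_VV: "f \<in> FF n \<Longrightarrow> f \<subseteq> VV n"
  unfolding EE_def FF_def by auto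

lemma new_EE: "EE (Suc n) - EE n = range (g1 n) \<union> range (g2 n) \<union> range (g3 n)"
proof
  show "EE (Suc n) - EE n \<subseteq> range (g1 n) \<union> range (g2 n) \<union> range (g3 n)"
  proof
    fix e assume e: "e \<in> EE (Suc n) - EE n"
    then obtain v w where vw: "e = {v, w}" "A v w" "v \<in> VV (Suc n)" "w \<in> VV (Suc n)" unfolding EE_def by blast
    have "\<not> (v \<in> VV n \<and> w \<in> VV n)" using e vw unfolding EE_def by blast
    then have "\<exists>k x. e = {cc (Suc n) k, x} \<and> A (cc (Suc n) k) x \<and> x \<in> VV (Suc n)"
    proof (cases "v \<in> VV n")
      case False
      then show ?thesis using vw by auto
    next
      case True
      then have "w \<in> range (cc (Suc n))" using vw(4) \<open>\<not> (v \<in> VV n \<and> w \<in> VV n)\<close> by simp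
      then obtain k where k: "w = cc (Suc n) k" by blast
      have "e = {w, v}" using vw(1) by blast
      then show ?thesis using vw(3) A_sym[OF vw(2)] k by blast
    qed
    then obtain k x where k: "e = {cc (Suc n) k, x}" "A (cc (Suc n) k) x" "x \<in> VV (Suc n)" by blast
    from nbr_layer[OF k(2,3)] show "e \<in> range (g1 n) \<union> range (g2 n) \<union> range (g3 n)"
    proof (elim disjE conjE)
      assume "x = cc (Suc n) (k + 1)"
      then have "e = g1 n k" unfolding g1_def k(1) by simp
      then show ?thesis by blast
    next
      assume "x = cc (Suc n) (k - 1)"
      then have "e = g1 n (k - 1)" unfolding g1_def k(1) by auto
      then show ?thesis by blast
    next
      assume "x = cc n (JJ n k)"
      then have "e = g2 n k" unfolding g2_def k(1) by simp
      then show ?thesis by blast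
    next
      assume "k = pp n (JJ n k)" "x = cc n (JJ n k - 1)"
      then have "e = g3 n (JJ n k)" unfolding g3_def k(1) by simp
      then show ?thesis by blast
    qed
  qed
  have in_EE: "{v, w} \<in> EE (Suc n) - EE n"
    if "A v w" "v \<in> VV (Suc n)" "w \<in> VV (Suc n)" "v \<notin> VV n" for v w
    using that EE_VV[of "{v, w}" n] unfolding EE_def by blast
  have m: "cc (Suc n) i \<in> VV (Suc n)" "cc n i \<in> VV (Suc n)" "cc (Suc n) i \<notin> VV n" for i
    using cc_VV[of _ i] by (simp_all del: VV.simps)
  show "range (g1 n) \<union> range (g2 n) \<union> range (g3 n) \<subseteq> EE (Suc n) - EE n"
  proof -
    have "g1 n k \<in> EE (Suc n) - EE n" for k unfolding g1_def by (rule in_EE[OF A_below(2) m(1) m(1) m(3)])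
    moreover have "g2 n k \<in> EE (Suc n) - EE n" for k unfolding g2_def by (rule in_EE[OF A_below(1) m(1) m(2) m(3)])
    moreover have "g3 n k \<in> EE (Suc n) - EE n" for k unfolding g3_def
      using in_EE[OF _ m(1) m(2) m(3)] T_peak[of n k] T_A2(1) by blast
    ultimately show ?thesis by blast
  qed
qed

lemma new_FF: "FF (Suc n) - FF n = range (f1 n) \<union> range (f2 n)"
proof
  show "FF (Suc n) - FF n \<subseteq> range (f1 n) \<union> range (f2 n)"
  proof
    fix f assume f: "f \<in> FF (Suc n) - FF n"
    then obtain x y z where xyz: "f = {x, y, z}" "T x y z" "x \<in> VV (Suc n)" "y \<in> VV (Suc n)" "z \<in> VV (Suc n)"
      unfolding FF_def by blast
    have "\<not> (x \<in> VV n \<and> y \<in> VV n \<and> z \<in> VV n)" using f xyz unfolding FF_def by blast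
    then consider "x \<notin> VV n" | "y \<notin> VV n" | "z \<notin> VV n" by blast
    then have "\<exists>k y' z'. f = {cc (Suc n) k, y', z'} \<and> T (cc (Suc n) k) y' z' \<and> y' \<in> VV (Suc n) \<and> z' \<in> VV (Suc n)"
    proof cases
      case 1
      then obtain k where "x = cc (Suc n) k" using xyz(3) by auto
      then show ?thesis using xyz by blast
    next
      case 2
      then obtain k where k: "y = cc (Suc n) k" using xyz(4) by auto
      have "f = {y, x, z}" "T y x z" using xyz(1,2) T_swap(1) by auto
      then show ?thesis using xyz(3,5) k by blast
    next
      case 3
      then obtain k where k: "z = cc (Suc n) k" using xyz(5) by auto
      have "f = {z, x, y}" using xyz(1) by blast
      moreover have "T z x y" using T_swap(1)[OF T_swap(2)[OF xyz(2)]] .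
      ultimately show ?thesis using xyz(3,4) k by blast
    qed
    then show "f \<in> range (f1 n) \<union> range (f2 n)" using tri_layer by metis
  qed
  have in_FF: "{x, y, z} \<in> FF (Suc n) - FF n"
    if "T x y z" "x \<in> VV (Suc n)" "y \<in> VV (Suc n)" "z \<in> VV (Suc n)" "x \<notin> VV n" for x y z
    using that FF_VV[of "{x, y, z}" n] unfolding FF_def by blast
  have m: "cc (Suc n) i \<in> VV (Suc n)" "cc n i \<in> VV (Suc n)" "cc (Suc n) i \<notin> VV n" for i
    using cc_VV[of _ i] by (simp_all del: VV.simps)
  have "f1 n k \<in> FF (Suc n) - FF n" for k unfolding f1_def by (rule in_FF[OF A_below(3) m(1) m(1) m(2) m(3)])
  moreover have "f2 n k \<in> FF (Suc n) - FF n" for k unfolding f2_def by (rule in_FF[OF T_peak m(1) m(2) m(2) m(3)])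
  ultimately show "range (f1 n) \<union> range (f2 n) \<subseteq> FF (Suc n) - FF n" by blast
qed

lemma g1_eq: "g1 n k = g1 n l \<longleftrightarrow> bb (Suc n) dvd k - l"
proof
  assume "g1 n k = g1 n l"
  then consider "cc (Suc n) k = cc (Suc n) l" | "cc (Suc n) k = cc (Suc n) (l + 1)" "cc (Suc n) (k + 1) = cc (Suc n) l"
    unfolding g1_def doubleton_eq_iff by blast
  then show "bb (Suc n) dvd k - l"
  proof cases
    case 2
    \<comment> \<open>The reversed matching of the ends would make the layer length a divisor of 2,
      but it is at least 3.\<close>
    then have "bb (Suc n) dvd (k + 1 - l) - (k - (l + 1))" unfolding cc_eq using dvd_diff by blast
    then have "bb (Suc n) dvd 2" by simp
    then show ?thesis using zdvd_imp_le[of "bb (Suc n)" 2] lyD(1)[of "Suc n"] by simp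
  qed (simp add: cc_eq)
next
  assume d: "bb (Suc n) dvd k - l"
  then have "cc (Suc n) k = cc (Suc n) l" "cc (Suc n) (k + 1) = cc (Suc n) (l + 1)" unfolding cc_eq by simp_all
  then show "g1 n k = g1 n l" unfolding g1_def by simp
qed

lemma JJ_cong: "bb (Suc n) dvd k - l \<Longrightarrow> cc n (JJ n k) = cc n (JJ n l)"
proof -
  assume "bb (Suc n) dvd k - l"
  then obtain s where "k = l + bb (Suc n) * s" by (metis dvd_def add.commute diff_add_cancel)
  then show ?thesis using JJ_add cc_per by simp
qed

lemma pp_cong: "bb n dvd i - j \<Longrightarrow> cc (Suc n) (pp n i) = cc (Suc n) (pp n j)"
proof -
  assume "bb n dvd i - j"
  then obtain s where "i = j + bb n * s" by (metis dvd_def add.commute diff_add_cancel)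
  then show ?thesis using pp_add cc_per by simp
qed

lemma cc_ne: "cc (Suc n) i \<noteq> cc n j"
  unfolding cc_eq by simp

lemma cc_pp: "cc (Suc n) k = cc (Suc n) (pp n j) \<Longrightarrow> cc n (JJ n k) = cc n j"
  using JJ_cong[of n k "pp n j"] JJ_pp[of n j] unfolding cc_eq by simp

lemma cc_pp_eq: "cc (Suc n) (pp n i) = cc (Suc n) (pp n j) \<longleftrightarrow> bb n dvd i - j"
  using cc_pp[of n "pp n i" j] JJ_pp[of n i] pp_cong[of n i j] cc_eq by auto

lemma cc_succ_ne: "cc n (j - 1) \<noteq> cc n j" "cc n j \<noteq> cc n (j - 1)" "cc n j \<noteq> cc n (j + 1)"
proof -
  have "\<not> bb n dvd 1" using zdvd_imp_le[of "bb n" 1] lyD(1)[of n] by auto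
  then show "cc n (j - 1) \<noteq> cc n j" "cc n j \<noteq> cc n (j - 1)" "cc n j \<noteq> cc n (j + 1)" unfolding cc_eq by simp_all
qed

lemma g2_eq: "g2 n k = g2 n l \<longleftrightarrow> bb (Suc n) dvd k - l"
  unfolding g2_def doubleton_eq_iff using cc_ne[of n] JJ_cong[of n k l] cc_eq[of "Suc n" k "Suc n" l] by metis

lemma g3_eq: "g3 n i = g3 n j \<longleftrightarrow> bb n dvd i - j"
  unfolding g3_def doubleton_eq_iff using cc_ne[of n] cc_pp_eq[of n i j] cc_eq[of n "i - 1" n "j - 1"] by simp

text \<open>The trace on the new layer, an edge for \<open>f1\<close> and a single vertex for
  \<open>f2\<close>, distinguishes the two kinds of triangle and reduces equality within
  \<open>f1\<close> to \<open>g1_eq\<close>.\<close>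

lemma f1_int: "f1 n k \<inter> range (cc (Suc n)) = g1 n k"
proof -
  have "cc n (JJ n k) \<notin> range (cc (Suc n))" using cc_ne by (metis rangeE)
  then show ?thesis unfolding f1_def g1_def by auto
qed

lemma f2_int: "f2 n j \<inter> range (cc (Suc n)) = {cc (Suc n) (pp n j)}"
proof -
  have "cc n i \<notin> range (cc (Suc n))" for i using cc_ne by (metis rangeE)
  then show ?thesis unfolding f2_def by auto
qed

lemma f1_eq: "f1 n k = f1 n l \<longleftrightarrow> bb (Suc n) dvd k - l"
proof
  assume "f1 n k = f1 n l"
  then have "g1 n k = g1 n l" using f1_int by metis
  then show "bb (Suc n) dvd k - l" unfolding g1_eq .
next
  assume d: "bb (Suc n) dvd k - l"
  then have "g1 n k = g1 n l" unfolding g1_eq .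
  moreover have "f1 n k = insert (cc n (JJ n k)) (g1 n k)" for k unfolding f1_def g1_def by auto
  ultimately show "f1 n k = f1 n l" using JJ_cong[OF d] by simp
qed

lemma f2_eq: "f2 n i = f2 n j \<longleftrightarrow> bb n dvd i - j"
proof
  assume "f2 n i = f2 n j"
  then have "cc (Suc n) (pp n i) = cc (Suc n) (pp n j)" using f2_int by (metis singleton_inject)
  then show "bb n dvd i - j" unfolding cc_pp_eq .
next
  assume d: "bb n dvd i - j"
  then have "cc (Suc n) (pp n i) = cc (Suc n) (pp n j)" "cc n i = cc n j" "cc n (i - 1) = cc n (j - 1)"
    using cc_pp_eq cc_eq by simp_all
  then show "f2 n i = f2 n j" unfolding f2_def by simp
qed

lemma g_disjoint: "range (g1 n) \<inter> range (g2 n) = {}" "(range (g1 n) \<union> range (g2 n)) \<inter> range (g3 n) = {}"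
proof -
  have 1: "g1 n k \<noteq> g2 n l" "g1 n k \<noteq> g3 n l" for k l
    unfolding g1_def g2_def g3_def doubleton_eq_iff using cc_ne by metis+
  have 2: "g2 n k \<noteq> g3 n l" for k l
  proof
    assume "g2 n k = g3 n l"
    then have "cc (Suc n) k = cc (Suc n) (pp n l)" "cc n (JJ n k) = cc n (l - 1)"
      unfolding g2_def g3_def doubleton_eq_iff using cc_ne[of n] by metis+
    then have "cc n l = cc n (l - 1)" using cc_pp[of n k l] by simp
    then show False using cc_succ_ne by blast
  qed
  show "range (g1 n) \<inter> range (g2 n) = {}" "(range (g1 n) \<union> range (g2 n)) \<inter> range (g3 n) = {}"
    using 1 2 by blast+
qed

lemma f_disjoint: "range (f1 n) \<inter> range (f2 n) = {}"
proof -
  have "f1 n k \<noteq> f2 n l" for k l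
  proof
    assume "f1 n k = f2 n l"
    then have "g1 n k = {cc (Suc n) (pp n l)}" using f1_int f2_int by metis
    then show False unfolding g1_def using cc_succ_ne(3)[of "Suc n" k] by (metis insertCI singletonD)
  qed
  then show ?thesis by blast
qed

lemma bb_pos: "bb n > 0" using lyD(1)[of n] by simp

lemma card_VV: "card (VV (Suc n) - VV n) = nat (bb (Suc n))"
proof -
  have "cc (Suc n) i \<notin> VV n" for i using cc_VV[of "Suc n" i n] by simp
  then have "VV (Suc n) - VV n = range (cc (Suc n))" by auto
  then show ?thesis using card_range_periodic(2)[of "cc (Suc n)" "bb (Suc n)"] cc_eq bb_pos by simp
qed

lemma card_EE: "card (EE (Suc n) - EE n) = nat (2 * bb (Suc n) + bb n)"
proof -
  note f = card_range_periodic[OF g1_eq bb_pos, of n] card_range_periodic[OF g2_eq bb_pos, of n]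
    card_range_periodic[OF g3_eq bb_pos, of n]
  have "card (range (g1 n) \<union> range (g2 n)) = nat (bb (Suc n)) + nat (bb (Suc n))"
    using card_Un_disjoint[OF f(1,3) g_disjoint(1)] f by simp
  then have "card (range (g1 n) \<union> range (g2 n) \<union> range (g3 n)) = nat (bb (Suc n)) + nat (bb (Suc n)) + nat (bb n)"
    using card_Un_disjoint[OF _ f(5) g_disjoint(2)] f by simp
  then show ?thesis unfolding new_EE using bb_pos[of n] bb_pos[of "Suc n"] by (simp add: nat_add_distrib)
qed

lemma card_FF: "card (FF (Suc n) - FF n) = nat (bb (Suc n) + bb n)"
proof -
  note f = card_range_periodic[OF f1_eq bb_pos, of n] card_range_periodic[OF f2_eq bb_pos, of n]
  have "card (range (f1 n) \<union> range (f2 n)) = nat (bb (Suc n)) + nat (bb n)"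
    using card_Un_disjoint[OF f(1,3) f_disjoint] f by simp
  then show ?thesis unfolding new_FF using bb_pos[of n] bb_pos[of "Suc n"] by (simp add: nat_add_distrib)
qed

lemma bb_1: "bb (Suc 0) = (\<Sum>i\<in>{0..<b0}. u0 i - 1)"
  using lay_Suc(1)[of 0] bb_pos[of 0] by (simp add: lay_0 pp_def psum_def)

text \<open>A new vertex contributes its outer degree minus one, that is \<open>r - 4\<close>, or
  \<open>r - 5\<close> if it is shared by two fans. In one period the shared vertices correspond to
  the \<open>bb n\<close> old boundary vertices.\<close>

lemma bb_rec: "bb (Suc (Suc n)) = (int r - 4) * bb (Suc n) - bb n"
proof -
  define I where "I = {0..<bb (Suc n)}"
  define K where "K = {k\<in>I. k = pp n (JJ n k)}"
  have K: "K = pp n ` {0..<bb n}"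
  proof
    show "K \<subseteq> pp n ` {0..<bb n}"
    proof
      fix k assume "k \<in> K"
      then have k: "k = pp n (JJ n k)" "pp n 0 \<le> k" "k < pp n (bb n)"
        unfolding K_def I_def lay_Suc(1) pp_0 by auto
      then have "0 \<le> JJ n k" "JJ n k < bb n" using pp_le_iff[of n 0 "JJ n k"] pp_less_iff[of n "JJ n k" "bb n"] by auto
      then show "k \<in> pp n ` {0..<bb n}" using k(1) by auto
    qed
    show "pp n ` {0..<bb n} \<subseteq> K"
    proof
      fix k assume "k \<in> pp n ` {0..<bb n}"
      then obtain j where j: "k = pp n j" "0 \<le> j" "j < bb n" by auto
      then have "pp n 0 \<le> k" "k < pp n (bb n)" using pp_le_iff[of n 0 j] pp_less_iff[of n j "bb n"] by auto
      then show "k \<in> K" unfolding K_def I_def lay_Suc(1) using j(1) JJ_pp[of n j] pp_0 by auto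
    qed
  qed
  have "inj_on (pp n) {0..<bb n}" using pp_eq_iff[of n] by (auto simp: inj_on_def)
  then have cK: "int (card K) = bb n" unfolding K using bb_pos[of n] by (simp add: card_image)
  have fin: "finite I" "K \<subseteq> I" unfolding I_def K_def by auto
  have "bb (Suc (Suc n)) = (\<Sum>k\<in>I. uu (Suc n) k - 1)"
    unfolding lay_Suc(1)[of "Suc n"] pp_def psum_def I_def using bb_pos[of "Suc n"] by simp
  also have "\<dots> = (\<Sum>k\<in>I. (int r - 4) - (if k \<in> K then 1 else 0))"
    unfolding uu_Suc K_def by (intro sum.cong) auto
  also have "\<dots> = (\<Sum>k\<in>I. (int r - 4)) - (\<Sum>k\<in>I. if k \<in> K then 1 else 0)"
    by (rule sum_subtractf)
  also have "(\<Sum>k\<in>I. if k \<in> K then 1 else 0) = int (card K)"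
    using fin by (simp add: sum.If_cases Int_absorb1)
  also have "(\<Sum>k\<in>I. (int r - 4)) = (int r - 4) * bb (Suc n)"
    unfolding I_def using bb_pos[of "Suc n"] by simp
  finally show ?thesis using cK by simp
qed

end

section \<open>The expansions of a convex disk\<close>

context triangulated_mesh
begin

lemma surface: "triangulated_surface r nb T"
proof
  show "card {v. nb w v} = r" if "nb w u" for w u using card_nb[OF ed(5)[OF that]] .
  show "\<not> nb a a" for a using ed(4) by blast
qed (use r_pos T_sym T_D(1) nb_sym card_T link_connected in blast)+

sublocale S: triangulated_surface r nb T by (rule surface)

lemma cyc_Cyc: "S.cyc cs \<longleftrightarrow> Cyc cs"
  unfolding S.cyc_def Cyc_def ..

sublocale S: simply_connected_surface r nb T
proof
  fix P :: "complex list \<Rightarrow> bool" and cs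
  assume a: "S.cyc cs" "\<And>a b c. T a b c \<Longrightarrow> P [a, b, c]"
    "\<And>x xs. S.cyc (x # xs) \<Longrightarrow> P (xs @ [x]) \<Longrightarrow> P (x # xs)"
    "\<And>x p y q m. S.cyc (x # p @ y # q) \<Longrightarrow> S.cyc (x # p @ y # rev m) \<Longrightarrow> S.cyc (x # m @ y # q) \<Longrightarrow>
      P (x # p @ y # rev m) \<Longrightarrow> P (x # m @ y # q) \<Longrightarrow> P (x # p @ y # q)"
  from a(1) have "Cyc cs" unfolding cyc_Cyc .
  then show "P cs"
  proof (induction rule: disk_induct)
    case (split x p y q m)
    then show ?case using a(4)[unfolded cyc_Cyc] by blast
  qed (use a(2,3)[unfolded cyc_Cyc] in blast)+
qed

lemma dadj_sym: "dadj X u w \<Longrightarrow> dadj X w u"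
  unfolding dadj_def using nb_sym ed_commute by metis

lemma card_dadj: "w \<in> V \<Longrightarrow> card {u. dadj X w u} = deg (DE X) w"
proof -
  assume w: "w \<in> V"
  have "bij_betw (ed w) {u. dadj X w u} {e\<in>DE X. w \<in> e}"
    unfolding bij_betw_def
  proof
    show "inj_on (ed w) {u. dadj X w u}"
      by (auto simp: inj_on_def dadj_def ed_eq_iff doubleton_eq_iff)
    show "ed w ` {u. dadj X w u} = {e\<in>DE X. w \<in> e}"
    proof
      show "ed w ` {u. dadj X w u} \<subseteq> {e\<in>DE X. w \<in> e}"
        unfolding dadj_def using ed(2) by blast
      show "{e\<in>DE X. w \<in> e} \<subseteq> ed w ` {u. dadj X w u}"
      proof
        fix e assume e: "e \<in> {e\<in>DE X. w \<in> e}"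
        then obtain u v where uv: "nb u v" "e = ed u v" using edge_cases unfolding DE_def by blast
        then have "w = u \<or> w = v" using ed(2)[OF uv(1)] e w by blast
        then have "\<exists>x. nb w x \<and> e = ed w x" using uv nb_sym ed_commute by metis
        then show "e \<in> ed w ` {u. dadj X w u}" using e unfolding dadj_def by blast
      qed
    qed
  qed
  then show ?thesis by (simp add: deg_def bij_betw_same_card)
qed

section \<open>The boundary of a disk as an initial layer\<close>

definition cyc_vertex :: "complex list \<Rightarrow> int \<Rightarrow> complex" where
  "cyc_vertex cs i = cs ! nat (i mod int (length cs))"

context
  fixes cs assumes Ccs: "Cyc cs"
begin

abbreviation "X0 \<equiv> cedges cs"
abbreviation "b \<equiv> int (length cs)"
abbreviation "c \<equiv> cyc_vertex cs"

lemma b3: "b \<ge> 3" using Ccs unfolding Cyc_def by simp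

lemma mod_b: "0 \<le> k mod b" "k mod b < b"
proof -
  have "0 < b" using b3 by linarith
  then show "0 \<le> k mod b" "k mod b < b" by (rule pos_mod_sign, rule pos_mod_bound)
qed

lemma c_nat: "i < length cs \<Longrightarrow> c (int i) = cs ! i"
  unfolding cyc_vertex_def by simp

lemma c_mod: "\<exists>i<length cs. c k = cs ! i \<and> c (k + 1) = cs ! ((i + 1) mod length cs)"
proof -
  define i where "i = nat (k mod b)"
  have ik: "int i = k mod b" unfolding i_def using mod_b by simp
  then have "i < length cs" using mod_b(2)[of k] by simp
  moreover have "(k + 1) mod b = int ((i + 1) mod length cs)"
    using ik mod_add_left_eq[of k b 1] by (simp add: zmod_int add.commute)
  then have "c (k + 1) = cs ! ((i + 1) mod length cs)" unfolding cyc_vertex_def by simp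
  moreover have "c k = cs ! i" unfolding cyc_vertex_def i_def ..
  ultimately show ?thesis by blast
qed

lemma c_inj: "c i = c j \<longleftrightarrow> b dvd i - j"
proof -
  have "nat (i mod b) < length cs" "nat (j mod b) < length cs"
    using mod_b by (simp_all add: nat_less_iff)
  moreover have "distinct cs" using Ccs unfolding Cyc_def by simp
  ultimately have "c i = c j \<longleftrightarrow> nat (i mod b) = nat (j mod b)"
    unfolding cyc_vertex_def by (simp add: nth_eq_iff_index_eq)
  also have "\<dots> \<longleftrightarrow> i mod b = j mod b" using mod_b by (metis eq_nat_nat_iff)
  also have "\<dots> \<longleftrightarrow> b dvd i - j" by (rule mod_eq_dvd_iff)
  finally show ?thesis .
qed

lemma range_c: "range c = set cs"
proof
  show "range c \<subseteq> set cs" using c_mod by (metis imageE nth_mem subsetI)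
  show "set cs \<subseteq> range c" using c_nat by (metis in_set_conv_nth rangeI subsetI)
qed

lemma X0_conv: "X0 = {ed (c i) (c (i + 1)) |i. True}"
proof -
  have eq: "X0 = {ed (cs ! i) (cs ! ((i + 1) mod length cs)) |i. i < length cs}"
    unfolding cedges_def pedges_conv using nth_closed[of _ cs] by force
  show ?thesis
  proof
    show "{ed (c i) (c (i + 1)) |i. True} \<subseteq> X0"
    proof
      fix e assume "e \<in> {ed (c i) (c (i + 1)) |i. True}"
      then obtain k where "e = ed (c k) (c (k + 1))" by blast
      then show "e \<in> X0" unfolding eq using c_mod[of k] by auto
    qed
    show "X0 \<subseteq> {ed (c i) (c (i + 1)) |i. True}"
    proof
      fix e assume "e \<in> X0"
      then obtain i where i: "i < length cs" "e = ed (cs ! i) (cs ! ((i + 1) mod length cs))" unfolding eq by blast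
      have "(int i + 1) mod b = int ((i + 1) mod length cs)" by (simp add: zmod_int add.commute)
      then have "c (int i + 1) = cs ! ((i + 1) mod length cs)" unfolding cyc_vertex_def by simp
      then show "e \<in> {ed (c i) (c (i + 1)) |i. True}" using i c_nat by (intro CollectI exI[of _ "int i"]) simp
    qed
  qed
qed

lemma nb_c: "nb (c i) (c (i + 1))"
proof -
  obtain j where "j < length cs" "c i = cs ! j" "c (i + 1) = cs ! ((j + 1) mod length cs)" using c_mod by blast
  then show ?thesis using Ccs simple_cycle_Cyc unfolding simple_cycle_def by metis
qed

lemma c_V: "c i \<in> V" using ed(5)[OF nb_c] .

lemma V_X0: "V \<inter> \<Union>X0 = range c"
proof
  show "V \<inter> \<Union>X0 \<subseteq> range c" unfolding range_c using cedges_V[OF Ccs] by blast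
  show "range c \<subseteq> V \<inter> \<Union>X0" unfolding X0_conv using c_V ed(2)[OF nb_c] by blast
qed

lemma J0: "jcurve X0" using Cyc_jcurve[OF Ccs] .

lemma c_pm: "c (i + 1) \<noteq> c (i - 1)"
  unfolding c_inj using zdvd_imp_le[of b 2] b3 by auto

lemma ed_c_X0: "nb (c i) w \<Longrightarrow> ed (c i) w \<in> X0 \<longleftrightarrow> w = c (i + 1) \<or> w = c (i - 1)"
proof
  assume w: "nb (c i) w" "ed (c i) w \<in> X0"
  then obtain j where "ed (c i) w = ed (c j) (c (j + 1))" unfolding X0_conv by blast
  then have "{c i, w} = {c j, c (j + 1)}" using ed_eq_iff[OF w(1) nb_c] by blast
  then consider "c i = c j" "w = c (j + 1)" | "c i = c (j + 1)" "w = c j" unfolding doubleton_eq_iff by blast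
  then show "w = c (i + 1) \<or> w = c (i - 1)"
  proof cases
    case 1
    then have "c (i + 1) = c (j + 1)" unfolding c_inj by simp
    then show ?thesis using 1 by simp
  next
    case 2
    then have "c (i - 1) = c j" unfolding c_inj by (simp add: algebra_simps)
    then show ?thesis using 2 by simp
  qed
next
  assume w: "nb (c i) w" "w = c (i + 1) \<or> w = c (i - 1)"
  have "ed (c i) (c (i + 1)) \<in> X0" unfolding X0_conv by blast
  moreover have "ed (c (i - 1)) (c (i - 1 + 1)) \<in> X0" unfolding X0_conv by blast
  then have "ed (c i) (c (i - 1)) \<in> X0" using ed_commute by simp
  ultimately show "ed (c i) w \<in> X0" using w(2) by blast
qed

definition face_in :: "complex \<Rightarrow> complex \<Rightarrow> complex \<Rightarrow> bool" where
  "face_in x y w \<longleftrightarrow> inside (tri x y w) \<subseteq> inside (\<Union>X0)"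

lemma face_in_sym: "face_in x y w = face_in y x w" "face_in x y w = face_in x w y"
  unfolding face_in_def using tri_sym by metis+

definition apex :: "int \<Rightarrow> complex" where
  "apex i = (SOME x. T (c i) (c (i + 1)) x \<and> face_in (c i) (c (i + 1)) x)"

lemma apex: "T (c i) (c (i + 1)) (apex i)" "face_in (c i) (c (i + 1)) (apex i)"
proof -
  have "ed (c i) (c (i + 1)) \<in> X0" unfolding X0_conv by blast
  from T_side_curve(1)[OF J0 nb_c this] have "\<exists>x. T (c i) (c (i + 1)) x \<and> face_in (c i) (c (i + 1)) x"
    unfolding face_in_def .
  from someI_ex[OF this] show "T (c i) (c (i + 1)) (apex i)" "face_in (c i) (c (i + 1)) (apex i)"
    unfolding apex_def by auto
qed

lemma apex_eq: "T (c i) (c (i + 1)) x \<Longrightarrow> face_in (c i) (c (i + 1)) x \<Longrightarrow> x = apex i"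
proof (rule ccontr)
  assume x: "T (c i) (c (i + 1)) x" "face_in (c i) (c (i + 1)) x" "x \<noteq> apex i"
  have "ed (c i) (c (i + 1)) \<in> X0" unfolding X0_conv by blast
  from T_side_curve_unique[OF J0 this x(1) apex(1) x(3)] show False using x(2) apex(2) unfolding face_in_def by blast
qed

definition spoke :: "int \<Rightarrow> int \<Rightarrow> complex" where
  "spoke i = S.ring (c i) (apex (i - 1)) (c (i - 1))"

lemma apex_T: "T (c i) (apex (i - 1)) (c (i - 1))"
proof -
  have "T (c (i - 1)) (c (i - 1 + 1)) (apex (i - 1))" by (rule apex)
  then have "T (c (i - 1)) (c i) (apex (i - 1))" by simp
  then show ?thesis using T_sym by blast
qed

lemma spoke: "S.linkf (c i) (spoke i)" "spoke i 0 = apex (i - 1)" "spoke i 1 = c (i - 1)"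
  using S.ring[OF apex_T] unfolding spoke_def by auto

lemma spoke_per: "spoke i (t + int r) = spoke i t"
  using S.link_inj[OF spoke(1), of i "t + int r" t] by simp

lemma spoke_inj: "spoke i s = spoke i t \<Longrightarrow> \<bar>s - t\<bar> < int r \<Longrightarrow> s = t"
proof -
  assume st: "spoke i s = spoke i t" "\<bar>s - t\<bar> < int r"
  then have "int r dvd \<bar>s - t\<bar>" using S.link_inj[OF spoke(1)] by auto
  then show "s = t" using zdvd_imp_le[of "int r" "\<bar>s - t\<bar>"] st(2) by force
qed

lemma spoke_surj: "nb (c i) w \<Longrightarrow> \<exists>t. 1 \<le> t \<and> t \<le> int r \<and> w = spoke i t"
proof -
  assume "nb (c i) w"
  then obtain s where s: "w = spoke i s" using S.link_range[OF spoke(1)[of i]] by blast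
  define t where "t = (s - 1) mod int r + 1"
  have "t - s = - (int r * ((s - 1) div int r))"
    unfolding t_def using minus_mod_eq_mult_div[of "s - 1" "int r"] by simp
  then have "int r dvd t - s" by simp
  then have "spoke i t = w" using S.link_inj[OF spoke(1)] s by blast
  moreover have "1 \<le> t" "t \<le> int r" unfolding t_def using r_pos by (simp_all add: zless_imp_add1_zle)
  ultimately show ?thesis by blast
qed

lemma spoke_T: "T (c i) (spoke i t) (spoke i (t + 1))" "T (c i) (spoke i t) (spoke i (t - 1))" "nb (c i) (spoke i t)"
  using S.linkfD(1,2,4)[OF spoke(1)] by auto

text \<open>Going round \<open>c i\<close>, the faces change sides of the boundary curve only at the
  two boundary spokes; \<open>face_in_flip\<close> treats those.\<close>

lemma face_in_step:
  "spoke i t \<noteq> c (i + 1) \<Longrightarrow> spoke i t \<noteq> c (i - 1) \<Longrightarrow> face_in (c i) (spoke i t) (spoke i (t + 1)) \<longleftrightarrow> face_in (c i) (spoke i t) (spoke i (t - 1))"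
  "spoke i t \<noteq> c (i + 1) \<Longrightarrow> spoke i t \<noteq> c (i - 1) \<Longrightarrow> face_in (c i) (spoke i t) (spoke i (t + 1)) \<longleftrightarrow> ed (c i) (spoke i t) \<in> DE X0"
proof -
  assume "spoke i t \<noteq> c (i + 1)" "spoke i t \<noteq> c (i - 1)"
  then have n: "ed (c i) (spoke i t) \<notin> X0" using ed_c_X0[OF spoke_T(3)] by blast
  show "face_in (c i) (spoke i t) (spoke i (t + 1)) \<longleftrightarrow> face_in (c i) (spoke i t) (spoke i (t - 1))"
    unfolding face_in_def using T_side_inside[OF J0 spoke_T(1) n] T_side_inside[OF J0 spoke_T(2) n] by blast
  show "face_in (c i) (spoke i t) (spoke i (t + 1)) \<longleftrightarrow> ed (c i) (spoke i t) \<in> DE X0"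
    unfolding face_in_def using T_side_inside[OF J0 spoke_T(1) n] DE_iff[OF J0 ed(1)[OF spoke_T(3)]] n by blast
qed

lemma face_in_flip:
  "spoke i t = c (i + 1) \<or> spoke i t = c (i - 1) \<Longrightarrow> face_in (c i) (spoke i t) (spoke i (t + 1)) \<longleftrightarrow> \<not> face_in (c i) (spoke i t) (spoke i (t - 1))"
proof -
  assume "spoke i t = c (i + 1) \<or> spoke i t = c (i - 1)"
  then have "ed (c i) (spoke i t) \<in> X0" using ed_c_X0[OF spoke_T(3)] by blast
  from T_side_curve_unique[OF J0 this spoke_T(1,2)] S.linkfD(5)[OF spoke(1)] show ?thesis
    unfolding face_in_def by blast
qed

text \<open>The position of \<open>c (i + 1)\<close> in the link, less the 2 positions of
  \<open>apex (i - 1)\<close> and \<open>c (i - 1)\<close> before the outer neighbours.\<close>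

definition out_deg :: "int \<Rightarrow> int" where
  "out_deg i = (SOME t. 0 \<le> t \<and> t \<le> int r - 2 \<and> spoke i (t + 2) = c (i + 1))"

lemma out_deg: "0 \<le> out_deg i" "out_deg i \<le> int r - 2" "spoke i (out_deg i + 2) = c (i + 1)"
proof -
  obtain t where t: "1 \<le> t" "t \<le> int r" "c (i + 1) = spoke i t" using spoke_surj[OF nb_c] by blast
  have "t \<noteq> 1" using t(3) spoke(3)[of i] c_pm[of i] by metis
  then have "0 \<le> t - 2 \<and> t - 2 \<le> int r - 2 \<and> spoke i (t - 2 + 2) = c (i + 1)" using t by simp
  then have "\<exists>t. 0 \<le> t \<and> t \<le> int r - 2 \<and> spoke i (t + 2) = c (i + 1)" by blast
  from someI_ex[OF this] show "0 \<le> out_deg i" "out_deg i \<le> int r - 2" "spoke i (out_deg i + 2) = c (i + 1)"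
    unfolding out_deg_def by auto
qed

lemma spoke_regular: "2 \<le> t \<Longrightarrow> t \<le> int r \<Longrightarrow> t \<noteq> out_deg i + 2 \<Longrightarrow> spoke i t \<noteq> c (i + 1) \<and> spoke i t \<noteq> c (i - 1)"
proof -
  assume t: "2 \<le> t" "t \<le> int r" "t \<noteq> out_deg i + 2"
  have "\<bar>t - (out_deg i + 2)\<bar> < int r" "\<bar>t - 1\<bar> < int r" using t out_deg(1,2)[of i] by linarith+
  then show ?thesis using spoke_inj[of i t "out_deg i + 2"] spoke_inj[of i t 1] out_deg(3)[of i] spoke(3)[of i] t by auto
qed

text \<open>The face between positions 0 and 1 is inside by the choice of \<open>apex\<close>.
  Crossing \<open>c (i - 1)\<close> leads outside, and no side change occurs before
  \<open>c (i + 1)\<close>.\<close>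

lemma face_in_outer: "1 \<le> t \<Longrightarrow> t < out_deg i + 2 \<Longrightarrow> \<not> face_in (c i) (spoke i t) (spoke i (t + 1))"
proof (induction t rule: int_ge_induct)
  case base
  have "face_in (c (i - 1)) (c (i - 1 + 1)) (apex (i - 1))" by (rule apex)
  then have "face_in (c i) (spoke i 1) (spoke i (1 - 1))" using spoke(2,3)[of i] face_in_sym by simp
  then show ?case using face_in_flip[of i 1] spoke(3)[of i] by simp
next
  case (step t)
  have "spoke i (t + 1) \<noteq> c (i + 1) \<and> spoke i (t + 1) \<noteq> c (i - 1)" using spoke_regular[of "t + 1" i] step out_deg[of i] by simp
  then have "face_in (c i) (spoke i (t + 1)) (spoke i (t + 1 + 1)) \<longleftrightarrow> face_in (c i) (spoke i (t + 1)) (spoke i t)"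
    using face_in_step(1)[of i "t + 1"] by simp
  then show ?case using step face_in_sym by simp
qed

lemma face_in_inner: "out_deg i + 2 \<le> t \<Longrightarrow> t \<le> int r \<Longrightarrow> face_in (c i) (spoke i t) (spoke i (t + 1))"
proof (induction t rule: int_ge_induct)
  case base
  have "\<not> face_in (c i) (spoke i (out_deg i + 1)) (spoke i (out_deg i + 1 + 1))" using face_in_outer[of "out_deg i + 1" i] out_deg(1)[of i] by simp
  then have "\<not> face_in (c i) (spoke i (out_deg i + 2)) (spoke i (out_deg i + 2 - 1))"
    using face_in_sym(2)[of "c i" "spoke i (out_deg i + 1)"] by (simp add: algebra_simps)
  then show ?case using face_in_flip[of i "out_deg i + 2"] out_deg(3)[of i] by simp
next
  case (step t)
  have "spoke i (t + 1) \<noteq> c (i + 1) \<and> spoke i (t + 1) \<noteq> c (i - 1)" using spoke_regular[of "t + 1" i] step out_deg(1)[of i] by simp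
  then have "face_in (c i) (spoke i (t + 1)) (spoke i (t + 1 + 1)) \<longleftrightarrow> face_in (c i) (spoke i (t + 1)) (spoke i t)"
    using face_in_step(1)[of i "t + 1"] by simp
  then show ?case using step face_in_sym by simp
qed

lemma spoke_apex: "spoke i (out_deg i + 3) = apex i"
proof -
  have e: "out_deg i + 2 + 1 = out_deg i + 3" by simp
  have "T (c i) (c (i + 1)) (spoke i (out_deg i + 3))" using spoke_T(1)[of i "out_deg i + 2"] out_deg(3)[of i] unfolding e by simp
  moreover have "face_in (c i) (c (i + 1)) (spoke i (out_deg i + 3))"
    using face_in_inner[of i "out_deg i + 2"] out_deg[of i] unfolding e by simp
  ultimately show ?thesis by (rule apex_eq)
qed

lemma dadj_spoke: "1 \<le> t \<Longrightarrow> t \<le> int r \<Longrightarrow> dadj X0 (c i) (spoke i t) \<longleftrightarrow> t = 1 \<or> out_deg i + 2 \<le> t"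
proof -
  assume t: "1 \<le> t" "t \<le> int r"
  show ?thesis
  proof (cases "t = 1 \<or> t = out_deg i + 2")
    case True
    then have "spoke i t = c (i + 1) \<or> spoke i t = c (i - 1)" using spoke(3)[of i] out_deg(3)[of i] by auto
    then have "ed (c i) (spoke i t) \<in> X0" using ed_c_X0[OF spoke_T(3)] by blast
    then have "ed (c i) (spoke i t) \<in> DE X0" using DE_iff[OF J0 ed(1)[OF spoke_T(3)]] by blast
    then show ?thesis unfolding dadj_def using spoke_T(3) True by auto
  next
    case False
    then have r: "spoke i t \<noteq> c (i + 1)" "spoke i t \<noteq> c (i - 1)" using spoke_regular[of t i] t by auto
    have "dadj X0 (c i) (spoke i t) \<longleftrightarrow> face_in (c i) (spoke i t) (spoke i (t + 1))"
      unfolding dadj_def using face_in_step(2)[OF r] spoke_T(3) by blast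
    then show ?thesis using face_in_outer[of t i] face_in_inner[of i t] False t by (metis not_less)
  qed
qed

lemma dadj_c: "dadj X0 (c i) w \<longleftrightarrow> w \<in> spoke i ` {out_deg i + 2..int r + 1}"
proof
  assume d: "dadj X0 (c i) w"
  then obtain t where t: "1 \<le> t" "t \<le> int r" "w = spoke i t" using spoke_surj unfolding dadj_def by blast
  then have "t = 1 \<or> out_deg i + 2 \<le> t" using dadj_spoke d by blast
  then show "w \<in> spoke i ` {out_deg i + 2..int r + 1}"
  proof
    assume "t = 1"
    then have "w = spoke i (int r + 1)" using t(3) spoke_per[of i 1] by (simp add: add.commute)
    then show ?thesis using out_deg(2)[of i] by auto
  qed (use t in auto)
next
  assume "w \<in> spoke i ` {out_deg i + 2..int r + 1}"
  then obtain t where t: "out_deg i + 2 \<le> t" "t \<le> int r + 1" "w = spoke i t" by auto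
  show "dadj X0 (c i) w"
  proof (cases "t = int r + 1")
    case True
    then have "w = spoke i 1" using t(3) spoke_per[of i 1] by (simp add: add.commute)
    then show ?thesis using dadj_spoke[of 1 i] r_pos by simp
  next
    case False
    then show ?thesis using dadj_spoke[of t i] t out_deg(1)[of i] by simp
  qed
qed

text \<open>The disk neighbours fill the positions \<open>out_deg i + 2\<close> to
  \<open>r + 1\<close>. This translates the degree bound of convexity into a lower bound for
  \<open>out_deg\<close>.\<close>

lemma deg_c: "int (deg (DE X0) (c i)) = int r - out_deg i"
proof -
  have "inj_on (spoke i) {out_deg i + 2..int r + 1}"
    using spoke_inj[of i] out_deg(1)[of i] by (auto simp: inj_on_def)
  then have "card (spoke i ` {out_deg i + 2..int r + 1}) = nat (int r - out_deg i)" by (simp add: card_image)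
  moreover have "{w. dadj X0 (c i) w} = spoke i ` {out_deg i + 2..int r + 1}" using dadj_c by blast
  ultimately show ?thesis using card_dadj[OF c_V, of X0 i] out_deg(2)[of i] by simp
qed

text \<open>The open inside is a neighbourhood of such a vertex, so each of its edges starts inside;
  an open edge off the curve stays on one side.\<close>

lemma inner_vertex: "v \<in> DV X0 \<Longrightarrow> v \<notin> range c \<Longrightarrow> nb v w \<Longrightarrow> ed v w \<notin> X0 \<and> ed v w - V \<subseteq> inside (\<Union>X0)"
proof -
  assume v: "v \<in> DV X0" "v \<notin> range c" "nb v w"
  have "v \<in> V" "v \<in> \<Union>X0 \<union> inside (\<Union>X0)" using v(1) unfolding DV_def by auto
  then have vi: "v \<in> inside (\<Union>X0)" and vX: "v \<notin> \<Union>X0" using v(2) V_X0 by blast+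
  have vE: "v \<in> ed v w" using ed(2)[OF v(3)] by blast
  then have n: "ed v w \<notin> X0" using vX by blast
  have E: "ed v w \<in> E" using ed(1)[OF v(3)] .
  have "v \<in> closure (ed v w - V)" using edge_inner(3)[OF E] vE by blast
  then have "inside (\<Union>X0) \<inter> (ed v w - V) \<noteq> {}"
    using vi jc(3)[OF J0] open_Int_closure_eq_empty by blast
  then show ?thesis using n edge_side[OF J0 E n] inside_Int_outside[of "\<Union>X0"] by blast
qed

lemma patch:
  assumes r: "r \<ge> 6" and u2: "\<And>i. out_deg i \<ge> 2"
  shows "convex_patch r nb T (DV X0) (dadj X0) b c apex out_deg"
proof unfold_locales
  show "6 \<le> r" using r .
  show "dadj X0 v w \<Longrightarrow> nb v w" for v w unfolding dadj_def by blast
  show "dadj X0 v w \<Longrightarrow> v \<in> DV X0" for v w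
    unfolding dadj_def DE_def DV_def using ed(2,5) by blast
  show "dadj X0 v w \<Longrightarrow> dadj X0 w v" for v w by (rule dadj_sym)
  show "v \<in> DV X0 \<Longrightarrow> w \<in> DV X0 \<Longrightarrow> (dadj X0)\<^sup>*\<^sup>* v w" for v w by (rule disk_connected[OF Ccs])
  show "c i \<in> DV X0" for i unfolding DV_def using V_X0 by blast
  show "(c i = c j) = (b dvd i - j)" for i j by (rule c_inj)
  show "dadj X0 v w" if "v \<in> DV X0" "v \<notin> range c" "nb v w" for v w
    unfolding dadj_def using inner_vertex[OF that] DE_iff[OF J0 ed(1)[OF that(3)]] that(3) by blast
  show "dadj X0 x y" if v: "v \<in> DV X0" "v \<notin> range c" and t: "T v x y" for v x y
  proof -
    have "inside (tri v x y) \<subseteq> inside (\<Union>X0)"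
      using T_side_inside[OF J0 t] inner_vertex[OF v T_D(1)[OF t]] by blast
    then have "inside (tri x y v) \<subseteq> inside (\<Union>X0)" using tri_sym by metis
    then show ?thesis unfolding dadj_def using T_DE[OF J0, of x y v] t T_sym T_D(2) by metis
  qed
  show "S.layer b c apex out_deg"
    unfolding S.layer_def spoke_def[symmetric]
  proof (intro conjI allI)
    fix i
    have c: "c (i + b) = c i" "c (i + b + 1) = c (i + 1)" "c (i + b - 1) = c (i - 1)" unfolding c_inj by simp_all
    then show "c (i + b) = c i" by simp
    have Lp: "apex (j + b) = apex j" for j
    proof -
      have "c (j + b) = c j" "c (j + b + 1) = c (j + 1)" unfolding c_inj by simp_all
      then show ?thesis unfolding apex_def by simp
    qed
    then show "apex (i + b) = apex i" .
    have "apex (i + b - 1) = apex (i - 1)" using Lp[of "i - 1"] by (simp add: algebra_simps)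
    then have "spoke (i + b) = spoke i" unfolding spoke_def c by simp
    then show "out_deg (i + b) = out_deg i" unfolding out_deg_def c by simp
    show "T (c i) (c (i + 1)) (apex i)" by (rule apex)
    show "2 \<le> out_deg i" "out_deg i \<le> int r - 2" "spoke i (out_deg i + 2) = c (i + 1)" "spoke i (out_deg i + 3) = apex i"
      using u2 out_deg spoke_apex by auto
  qed (use b3 in simp)
  show "dadj X0 (c i) w = (w \<in> S.ring (c i) (apex (i - 1)) (c (i - 1)) ` {out_deg i + 2..int r + 1})" for i w
    using dadj_c unfolding spoke_def .
  show "dadj X0 (S.ring (c i) (apex (i - 1)) (c (i - 1)) t) (S.ring (c i) (apex (i - 1)) (c (i - 1)) (t + 1))"
    if "out_deg i + 2 \<le> t" "t \<le> int r" for i t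
  proof -
    have "inside (tri (spoke i t) (spoke i (t + 1)) (c i)) \<subseteq> inside (\<Union>X0)"
      using face_in_inner[OF that] tri_sym unfolding face_in_def by metis
    moreover have "T (spoke i t) (spoke i (t + 1)) (c i)" using spoke_T(1)[of i t] T_sym by metis
    ultimately show ?thesis unfolding dadj_def spoke_def[symmetric] using T_DE[OF J0] T_D(1) by blast
  qed
qed

text \<open>The degree sum in the disk: inner vertices keep all \<open>r\<close> neighbours, while
  the boundary vertex \<open>c i\<close> lacks \<open>out_deg i\<close> of them.\<close>

lemma handshake: "2 * card (DE X0) + (\<Sum>i\<in>{0..<b}. nat (out_deg i)) = r * card (DV X0)"
proof -
  have "(\<Sum>v\<in>DV X0. card {e\<in>DE X0. v \<in> e}) = 2 * card (DE X0)"
  proof (rule sum_multicount)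
    show "\<forall>e\<in>DE X0. card {v\<in>DV X0. v \<in> e} = 2"
    proof
      fix e assume e: "e \<in> DE X0"
      then obtain v w where vw: "nb v w" "e = ed v w" using edge_cases unfolding DE_def by blast
      have "{v\<in>DV X0. v \<in> e} = e \<inter> V" using e unfolding DE_def DV_def by blast
      then show "card {v\<in>DV X0. v \<in> e} = 2" using ed(2,4)[OF vw(1)] vw(2) by simp
    qed
  qed (use finite_DV[OF J0] finite_DE[OF J0] in auto)
  then have "2 * card (DE X0) = (\<Sum>v\<in>DV X0. deg (DE X0) v)" unfolding deg_def by simp
  also have "\<dots> = (\<Sum>v\<in>DV X0 - set cs. deg (DE X0) v) + (\<Sum>v\<in>set cs. deg (DE X0) v)"
  proof -
    have "set cs \<subseteq> DV X0" unfolding DV_def using V_X0 range_c by blast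
    then show ?thesis using sum.subset_diff finite_DV[OF J0] by blast
  qed
  also have "(\<Sum>v\<in>DV X0 - set cs. deg (DE X0) v) = (\<Sum>v\<in>DV X0 - set cs. r)"
  proof (rule sum.cong)
    fix v assume "v \<in> DV X0 - set cs"
    then have v: "v \<in> DV X0" "v \<notin> range c" "v \<in> V" using range_c unfolding DV_def by auto
    have "{w. dadj X0 v w} = {w. nb v w}"
      unfolding dadj_def using inner_vertex[OF v(1,2)] DE_iff[OF J0 ed(1)] by blast
    then show "deg (DE X0) v = r" using card_dadj[OF v(3)] card_nb[OF v(3)] by metis
  qed simp
  finally have *: "2 * card (DE X0) = (\<Sum>v\<in>DV X0 - set cs. r) + (\<Sum>v\<in>set cs. deg (DE X0) v)" .
  have cb: "c ` {0..<b} = set cs"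
  proof -
    have "c i \<in> c ` {0..<b}" for i
    proof -
      have "c i = c (i mod b)" unfolding c_inj by (simp add: minus_mod_eq_mult_div)
      moreover have "i mod b \<in> {0..<b}" using mod_b by simp
      ultimately show ?thesis by blast
    qed
    then show ?thesis unfolding range_c[symmetric] by blast
  qed
  have inj: "inj_on c {0..<b}"
  proof
    fix i j assume "i \<in> {0..<b}" "j \<in> {0..<b}" "c i = c j"
    then have "\<bar>i - j\<bar> < b" "b dvd \<bar>i - j\<bar>" using c_inj by auto
    then show "i = j" using zdvd_imp_le[of b "\<bar>i - j\<bar>"] by force
  qed
  have "(\<Sum>v\<in>set cs. deg (DE X0) v) = (\<Sum>i\<in>{0..<b}. deg (DE X0) (c i))"
    unfolding cb[symmetric] using sum.reindex[OF inj] by simp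
  moreover have "deg (DE X0) (c i) + nat (out_deg i) = r" for i using deg_c[of i] out_deg[of i] by simp
  then have "(\<Sum>i\<in>{0..<b}. deg (DE X0) (c i)) + (\<Sum>i\<in>{0..<b}. nat (out_deg i)) = r * length cs"
    unfolding sum.distrib[symmetric] by simp
  moreover have "card (DV X0 - set cs) + length cs = card (DV X0)"
  proof -
    have sub: "set cs \<subseteq> DV X0" unfolding DV_def using V_X0 range_c by blast
    have "card (set cs) = length cs" using Ccs distinct_card unfolding Cyc_def by blast
    then show ?thesis using card_Diff_subset[OF finite_set sub] card_mono[OF finite_DV[OF J0] sub] by simp
  qed
  ultimately show ?thesis using * by (simp add: algebra_simps flip: add_mult_distrib2)
qed

end

section \<open>Cells as vertex sets, and the evaluation of the Euler sums\<close>

lemma edges_image: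
  "(\<lambda>e. e \<inter> V) ` {e\<in>E. e \<inter> V \<subseteq> W} = {{v, w} |v w. nb v w \<and> v \<in> W \<and> w \<in> W}" (is "?l = ?r")
proof
  show "?l \<subseteq> ?r"
  proof
    fix s assume "s \<in> ?l"
    then obtain e where e: "e \<in> E" "e \<inter> V \<subseteq> W" "s = e \<inter> V" by blast
    then obtain v w where vw: "nb v w" "e = ed v w" using edge_cases by blast
    then have "e \<inter> V = {v, w}" using ed(2) by blast
    then show "s \<in> ?r" using e(2,3) vw(1) by blast
  qed
  show "?r \<subseteq> ?l"
  proof
    fix s assume "s \<in> ?r"
    then obtain v w where vw: "s = {v, w}" "nb v w" "v \<in> W" "w \<in> W" by blast
    then have "ed v w \<in> E" "ed v w \<inter> V = s" using ed(1,2)[OF vw(2)] by auto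
    then show "s \<in> ?l" using vw by (intro image_eqI[of _ _ "ed v w"]) auto
  qed
qed

lemma faces_of_iff:
  assumes abc: "T x y z"
  shows "inside (tri x y z) \<in> faces_of V E (W, {e\<in>E. e \<inter> V \<subseteq> W}) \<longleftrightarrow> x \<in> W \<and> y \<in> W \<and> z \<in> W"
proof -
  note nbs = T_D(1-3)[OF abc]
  have fr: "frontier (inside (tri x y z)) = tri x y z" using T_frontier[OF abc] .
  have F: "inside (tri x y z) \<in> faces V E" using T_D(4)[OF abc] .
  show ?thesis
  proof
    assume "inside (tri x y z) \<in> faces_of V E (W, {e\<in>E. e \<inter> V \<subseteq> W})"
    then have sub: "{e\<in>E. e \<subseteq> tri x y z} \<subseteq> {e\<in>E. e \<inter> V \<subseteq> W}" unfolding faces_of_def by (simp add: fr)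
    have "ed x y \<in> {e\<in>E. e \<subseteq> tri x y z}" "ed y z \<in> {e\<in>E. e \<subseteq> tri x y z}"
      using ed(1)[OF nbs(1)] ed(1)[OF nbs(2)] unfolding tri_def by auto
    then have "ed x y \<inter> V \<subseteq> W" "ed y z \<inter> V \<subseteq> W" using sub by auto
    then show "x \<in> W \<and> y \<in> W \<and> z \<in> W" unfolding ed(2)[OF nbs(1)] ed(2)[OF nbs(2)] by simp
  next
    assume W: "x \<in> W \<and> y \<in> W \<and> z \<in> W"
    have "e \<inter> V \<subseteq> W" if "e \<subseteq> tri x y z" for e
    proof -
      have "e \<inter> V \<subseteq> {x, y, z}" unfolding tri_V[OF nbs, symmetric] using that by blast
      then show ?thesis using W by auto
    qed
    then show "inside (tri x y z) \<in> faces_of V E (W, {e\<in>E. e \<inter> V \<subseteq> W})"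
      unfolding faces_of_def using F by (auto simp: fr)
  qed
qed

lemma faces_image:
  "(\<lambda>F. frontier F \<inter> V) ` faces_of V E (W, {e\<in>E. e \<inter> V \<subseteq> W}) =
    {{x, y, z} |x y z. T x y z \<and> x \<in> W \<and> y \<in> W \<and> z \<in> W}" (is "?l = ?r")
proof
  have v: "frontier (inside (tri x y z)) \<inter> V = {x, y, z}" if "T x y z" for x y z
    using T_frontier[OF that] tri_V[OF T_D(1-3)[OF that]] by simp
  show "?l \<subseteq> ?r"
  proof
    fix s assume "s \<in> ?l"
    then obtain F where F: "F \<in> faces_of V E (W, {e\<in>E. e \<inter> V \<subseteq> W})" "s = frontier F \<inter> V" by blast
    then have "F \<in> faces V E" unfolding faces_of_def by blast
    then obtain x y z where T: "T x y z" "F = inside (tri x y z)" using face_triangle by blast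
    then have "x \<in> W \<and> y \<in> W \<and> z \<in> W" using faces_of_iff F(1) by blast
    moreover have "s = {x, y, z}" using v[OF T(1)] T(2) F(2) by simp
    ultimately show "s \<in> ?r" using T(1) by blast
  qed
  show "?r \<subseteq> ?l"
  proof
    fix s assume "s \<in> ?r"
    then obtain x y z where s: "s = {x, y, z}" "T x y z" "x \<in> W \<and> y \<in> W \<and> z \<in> W" by blast
    then show "s \<in> ?l"
      using faces_of_iff[OF s(2), of W] v[OF s(2)] by (intro image_eqI[of _ _ "inside (tri x y z)"]) auto
  qed
qed

lemma card_diff_image:
  assumes "inj_on f C" "A \<subseteq> C" "B \<subseteq> C"
  shows "card (A - B) = card (f ` A - f ` B)"
proof -
  have "A - B \<subseteq> C" using assms by blast
  then have "f ` (A - B) = f ` A - f ` B" using inj_on_image_set_diff[OF assms(1)] assms(3) by blast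
  then show ?thesis using card_image[OF inj_on_subset[OF assms(1) \<open>A - B \<subseteq> C\<close>]] by simp
qed

theorem expansion_counts:
  assumes r: "r > 6" and C: "Cyc cs" and conv: "convex_disk r V E cs"
  defines "Gs \<equiv> (\<lambda>n. (expansion V E ^^ n) (comb_disk V E cs))"
  defines "vs \<equiv> layer_count fst Gs"
    and "es \<equiv> layer_count snd Gs"
    and "fs \<equiv> layer_count (faces_of V E) Gs"
  shows "lin_rec (real r - 4) vs \<and> lin_rec (real r - 4) es \<and> lin_rec (real r - 4) fs \<and>
         vs 0 + euler_sum (real r - 4) vs = -6 / (real r - 6) \<and>
         es 0 + euler_sum (real r - 4) es = -3 * real r / (real r - 6) \<and>
         fs 0 + euler_sum (real r - 4) fs = -2 * real r / (real r - 6)"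
proof -
  define X where "X = cedges cs"
  have J: "jcurve X" unfolding X_def by (rule Cyc_jcurve[OF C])
  have disk: "comb_disk V E cs = (DV X, DE X)" unfolding X_def by (rule comb_disk_eq[OF C])
  \<comment> \<open>Since \<open>out_deg\<close> is \<open>r\<close> minus the degree, it is at
    least \<open>r/2 - 1\<close>, which exceeds 2.\<close>
  have u2: "out_deg cs i \<ge> 2" for i
  proof -
    have "cyc_vertex cs i \<in> set cs" using range_c[OF C] by blast
    then have "real (deg (DE X) (cyc_vertex cs i)) \<le> 1 + real r / 2"
      using conv disk unfolding convex_disk_def by simp
    moreover have "int (deg (DE X) (cyc_vertex cs i)) = int r - out_deg cs i" unfolding X_def by (rule deg_c[OF C])
    ultimately show ?thesis using r by linarith
  qed
  have r6: "r \<ge> 6" using r by simp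
  have "convex_patch r nb T (DV X) (dadj X) (int (length cs)) (cyc_vertex cs) (apex cs) (out_deg cs)"
    unfolding X_def by (rule patch[OF C r6 u2])
  then interpret P: convex_patch r nb T "DV X" "dadj X" "int (length cs)" "cyc_vertex cs" "apex cs" "out_deg cs" .
  define ES where "ES n = {e\<in>E. e \<inter> V \<subseteq> P.VV n}" for n
  \<comment> \<open>An expansion is an induced subgraph by definition; that the initial disk is one
    too is \<open>A_AD\<close>.\<close>
  have ES0: "DE X = ES 0"
  proof
    show "DE X \<subseteq> ES 0"
    proof
      fix e assume "e \<in> DE X"
      then have "e \<in> E" "e \<inter> V \<subseteq> DV X" unfolding DE_def DV_def by auto
      then show "e \<in> ES 0" unfolding ES_def by simp
    qed
    show "ES 0 \<subseteq> DE X"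
    proof
      fix e assume "e \<in> ES 0"
      then have e: "e \<in> E" "e \<inter> V \<subseteq> DV X" unfolding ES_def by auto
      obtain v w where vw: "nb v w" "e = ed v w" using edge_cases[OF e(1)] by blast
      have "v \<in> DV X" "w \<in> DV X" using e(2) ed(2)[OF vw(1)] vw(2) by auto
      then show "e \<in> DE X" using P.A_AD[OF _ _ vw(1)] vw(2) unfolding dadj_def by blast
    qed
  qed
  have G: "Gs n = (P.VV n, ES n)" for n
  proof (induction n)
    case 0
    show ?case unfolding Gs_def using disk ES0 by simp
  next
    case (Suc n)
    have "Gs (Suc n) = expansion V E (Gs n)" unfolding Gs_def by simp
    moreover have "P.VV n \<union> {w\<in>V. \<exists>u\<in>P.VV n. nb u w} = P.VV (Suc n)"
      unfolding P.VV_Suc using ed(6) by blast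
    ultimately show ?case unfolding Suc expansion_def Let_def fst_conv ES_def by simp
  qed
  have ES_image: "(\<lambda>e. e \<inter> V) ` ES n = P.EE n" for n
    unfolding ES_def P.EE_def by (rule edges_image)
  have FS_image: "(\<lambda>F. frontier F \<inter> V) ` faces_of V E (Gs n) = P.FF n" for n
    unfolding G ES_def P.FF_def by (rule faces_image)
  have cE: "card (ES (Suc n) - ES n) = card (P.EE (Suc n) - P.EE n)" for n
  proof -
    have "inj_on (\<lambda>e. e \<inter> V) E" by (rule inj_onI) (rule edge_eqI)
    moreover have "ES m \<subseteq> E" for m unfolding ES_def by blast
    ultimately show ?thesis using card_diff_image[of "\<lambda>e. e \<inter> V" E] ES_image by metis
  qed
  have cF: "card (faces_of V E (Gs (Suc n)) - faces_of V E (Gs n)) = card (P.FF (Suc n) - P.FF n)" for n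
  proof -
    have "faces_of V E (Gs m) \<subseteq> faces V E" for m unfolding faces_of_def by blast
    then show ?thesis using card_diff_image[OF faces_inj] FS_image by metis
  qed
  define B where "B n = real_of_int (P.bb n)" for n
  have bp: "P.bb n > 0" for n by (rule P.bb_pos)
  have vn: "vs (Suc n) = B (Suc n)" for n
    unfolding vs_def layer_count_def B_def using P.card_VV[of n] bp[of "Suc n"] by (simp add: G del: P.VV.simps)
  have en: "es (Suc n) = 2 * B (Suc n) + B n" for n
    unfolding es_def layer_count_def B_def using P.card_EE[of n] cE[of n] bp[of "Suc n"] bp[of n] by (simp add: G)
  have fn: "fs (Suc n) = B (Suc n) + B n" for n
    unfolding fs_def layer_count_def B_def using P.card_FF[of n] cF[of n] bp[of "Suc n"] bp[of n] by simp
  have rec: "B (Suc (Suc n)) = (real r - 4) * B (Suc n) - B n" for n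
    unfolding B_def P.bb_rec[of n] by simp
  have lin: "lin_rec (real r - 4) vs" "lin_rec (real r - 4) es" "lin_rec (real r - 4) fs"
  proof -
    have *: "lin_rec (real r - 4) x"
      if x: "\<And>m. x (Suc (Suc (Suc m))) = (real r - 4) * x (Suc (Suc m)) - x (Suc m)" for x
      unfolding lin_rec_def
    proof (intro allI impI)
      fix n :: nat assume "n \<ge> 1"
      then obtain m where "n = Suc m" by (cases n) auto
      then show "x (n + 2) = (real r - 4) * x (n + 1) - x n" using x[of m] by simp
    qed
    show "lin_rec (real r - 4) vs" "lin_rec (real r - 4) es" "lin_rec (real r - 4) fs"
      by (rule *, simp add: vn en fn rec algebra_simps)+
  qed
  define v0 e0 f0 b where "v0 = real (card (DV X))" and "e0 = real (card (DE X))"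
    and "f0 = real (card (DF X))" and "b = real (length cs)"
  have zero: "vs 0 = v0" "es 0 = e0" "fs 0 = f0"
  proof -
    have "faces_of V E (Gs 0) = DF X"
      unfolding G ES0[symmetric] faces_of_def using DF_iff[OF J] by (auto simp: DF_def)
    then show "vs 0 = v0" "es 0 = e0" "fs 0 = f0"
      unfolding vs_def es_def fs_def layer_count_def v0_def e0_def f0_def by (simp_all add: G ES0)
  qed
  have B0: "B 0 = b" unfolding B_def b_def by (simp add: P.lay_0)
  \<comment> \<open>The first layer has length equal to the sum of \<open>out_deg - 1\<close> over
    the boundary, and \<open>handshake\<close> expresses the sum of \<open>out_deg\<close>.\<close>
  have B1: "B 1 = real r * v0 - 2 * e0 - b"
  proof -
    have "P.bb 1 = (\<Sum>i\<in>{0..<int (length cs)}. out_deg cs i) - int (length cs)"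
      using P.bb_1 by (simp add: sum_subtractf)
    moreover have "(\<Sum>i\<in>{0..<int (length cs)}. out_deg cs i) = int (\<Sum>i\<in>{0..<int (length cs)}. nat (out_deg cs i))"
      using out_deg(1)[OF C] by simp
    moreover have "int (2 * card (DE X) + (\<Sum>i\<in>{0..<int (length cs)}. nat (out_deg cs i))) = int (r * card (DV X))"
      using handshake[OF C] unfolding X_def by simp
    ultimately have "P.bb 1 = int r * int (card (DV X)) - 2 * int (card (DE X)) - int (length cs)" by simp
    then show ?thesis unfolding B_def v0_def e0_def b_def by simp
  qed
  have B2: "B 2 = (real r - 4) * B 1 - b" using rec[of 0] B0 by (simp add: numeral_2_eq_2)
  have "card (DV X) + card (DF X) = card (DE X) + 1" "3 * card (DF X) + length cs = 2 * card (DE X)"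
    using euler_disk[OF C] unfolding X_def by auto
  then have eu: "f0 = e0 + 1 - v0" "b = 2 * e0 - 3 * f0"
    unfolding v0_def e0_def f0_def b_def by linarith+
  then have b: "b = 3 * v0 - e0 - 3" by simp
  have v12: "vs 1 = B 1" "vs 2 = B 2" "es 1 = 2 * B 1 + b" "es 2 = 2 * B 2 + B 1"
    "fs 1 = B 1 + b" "fs 2 = B 2 + B 1"
    using vn[of 0] vn[of 1] en[of 0] en[of 1] fn[of 0] fn[of 1] B0 by (simp_all add: numeral_2_eq_2)
  have ne: "2 - (real r - 4) \<noteq> 0" "real r - 6 \<noteq> 0" using r by auto
  \<comment> \<open>Reduces each claim to a polynomial identity with right-hand side 6,
    \<open>3 * r\<close> or \<open>2 * r\<close>; \<open>b\<close> is eliminated by Euler's formula,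
    for faces \<open>f0\<close> as well.\<close>
  have frac: "x + y / (2 - (real r - 4)) = - w / (real r - 6)" if "x * (6 - real r) + y = w" for x y w
    using ne that by (simp add: divide_simps) (simp add: algebra_simps)
  have "vs 0 + euler_sum (real r - 4) vs = -6 / (real r - 6)"
    unfolding euler_sum_def zero v12 B2 B1 by (rule frac) (simp add: b algebra_simps)
  moreover have "es 0 + euler_sum (real r - 4) es = - (3 * real r) / (real r - 6)"
    unfolding euler_sum_def zero v12 B2 B1 by (rule frac) (simp add: b algebra_simps)
  moreover have "fs 0 + euler_sum (real r - 4) fs = - (2 * real r) / (real r - 6)"
    unfolding euler_sum_def zero v12 B2 B1 by (rule frac) (simp add: eu(1) b algebra_simps)
  ultimately show ?thesis using lin by simp
qed

end

theorem theorem1: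
  fixes r :: nat and V :: "complex set" and E :: "complex set set" and cs :: "complex list"
  assumes "r > 6"
    and "mesh r V E"
    and "simple_cycle V E cs"
    and "convex_disk r V E cs"
  defines "Gs \<equiv> (\<lambda>n. (expansion V E ^^ n) (comb_disk V E cs))"
  defines "vs \<equiv> layer_count fst Gs"
    and "es \<equiv> layer_count snd Gs"
    and "fs \<equiv> layer_count (faces_of V E) Gs"
  shows "lin_rec (real r - 4) vs \<and> lin_rec (real r - 4) es \<and> lin_rec (real r - 4) fs \<and>
         vs 0 + euler_sum (real r - 4) vs = -6 / (real r - 6) \<and>
         es 0 + euler_sum (real r - 4) es = -3 * real r / (real r - 6) \<and>
         fs 0 + euler_sum (real r - 4) fs = -2 * real r / (real r - 6)"
proof -
  interpret triangulated_mesh r V E by unfold_locales (use assms(1,2) in auto)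
  show ?thesis
    unfolding vs_def es_def fs_def Gs_def
    using assms(1,3,4) by (intro expansion_counts) (simp_all add: simple_cycle_Cyc)
qed

end
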